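(* Let $n\geq 3$ and let $V$ be a potential (a locally integrable function) on $\mathbb{R}^n$ such that $$\|V\|:=\sup_{Q}\bigg(\int_Q|V(x)|\,dx\bigg)^{-1}\int_Q\int_Q\frac{|V(x)V(y)|}{|x-y|^{n-2}}\,dx\,dy<\infty,$$ where the supremum is over all dyadic cubes $Q$ in $\mathbb{R}^n$. Let $E\in\mathbb{C}$ and let $\psi\in H^1(\mathbb{R}^n)$ be real-valued and a weak solution of $(-\Delta+V)\psi=E\psi$ in $\mathbb{R}^n$, that is, $$\int_{\mathbb{R}^n}\nabla\psi\cdot\nabla\phi+(V(x)-E)\psi\phi\,dx=0\qquad\text{for every }\phi\in H^1_0(\mathbb{R}^n).$$ Let $x_0\in\mathbb{R}^n$ and suppose that $\psi$ has a zero of infinite order at $x_0$, meaning that for all $m>0$, $$\int_{B(x_0,\varepsilon)}\psi(x)\,dx=O(\varepsilon^m)\quad\text{as }\varepsilon\to0.$$ Then either (a) $\psi$ is identically zero near $x_0$ (i.e. $\psi=0$ almost everywhere in some ball centered at $x_0$), or (b) $\psi$ has both positive and negative signs arbitrarily close to $x_0$ (i.e. for every $r>0$, both $\{x\in B(x_0,r):\psi(x)>0\}$ and $\{x\in B(x_0,r):\psi(x)<0\}$ have positive Lebesgue measure).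
   Context: $B(x_0,r)$ is the ball centered at $x_0$ with radius $r$. $H^1(\mathbb{R}^n)$ is the Sobolev space of functions whose (weak) derivatives up to order $1$ belong to $L^2(\mathbb{R}^n)$; $H^1_0(\mathbb{R}^n)$ is the closure of $C_c^\infty(\mathbb{R}^n)$ in $H^1(\mathbb{R}^n)$ (which equals $H^1(\mathbb{R}^n)$). Dyadic cubes are the cubes $2^{k}([0,1)^n+j)$ with $k\in\mathbb{Z}$, $j\in\mathbb{Z}^n$. In the supremum defining $\|V\|$, cubes $Q$ with $\int_Q|V|\,dx=0$ are disregarded. *)

theory Defs
  imports "HOL-Analysis.Analysis" "HOL-Library.Landau_Symbols"
begin

definition locally_integrable ::
    "(real ^ 'n::finite \<Rightarrow> 'b::euclidean_space) \<Rightarrow> bool" where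
  "locally_integrable f \<longleftrightarrow> (\<forall>K. compact K \<longrightarrow> set_integrable lebesgue K f)"

definition L2 :: "(real ^ 'n::finite \<Rightarrow> 'b::euclidean_space) set" where
  "L2 = {f. f \<in> borel_measurable lebesgue \<and> integrable lebesgue (\<lambda>x. (norm (f x))\<^sup>2)}"

definition partial_deriv ::
    "'n::finite \<Rightarrow> (real ^ 'n \<Rightarrow> 'b::euclidean_space) \<Rightarrow> real ^ 'n \<Rightarrow> 'b" where
  "partial_deriv i f x = frechet_derivative f (at x) (axis i 1)"

primrec C_k :: "nat \<Rightarrow> (real ^ 'n::finite \<Rightarrow> 'b::euclidean_space) \<Rightarrow> bool" where
  "C_k 0 f \<longleftrightarrow> continuous_on UNIV f"
| "C_k (Suc k) f \<longleftrightarrow> f differentiable_on UNIV \<and> (\<forall>i. C_k k (partial_deriv i f))"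

definition Cc_infinity :: "(real ^ 'n::finite \<Rightarrow> 'b::euclidean_space) set" where
  "Cc_infinity = {f. (\<forall>k. C_k k f) \<and> compact (closure {x. f x \<noteq> 0})}"

text \<open>Real-valued test functions suffice for the distributional derivatives of vector-valued
  (e.g. complex-valued) functions, by linearity.\<close>

definition is_weak_gradient ::
    "(real ^ 'n::finite \<Rightarrow> 'b::euclidean_space) \<Rightarrow> (real ^ 'n \<Rightarrow> 'b ^ 'n) \<Rightarrow> bool" where
  "is_weak_gradient f g \<longleftrightarrow> locally_integrable f \<and> locally_integrable g \<and>
     (\<forall>(\<eta> :: real ^ 'n \<Rightarrow> real) \<in> Cc_infinity. \<forall>i.
        (\<integral>x. partial_deriv i \<eta> x *\<^sub>R f x \<partial>lebesgue) = - (\<integral>x. \<eta> x *\<^sub>R (g x $ i) \<partial>lebesgue))"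

text \<open>Weak gradients are unique up to null sets, so the choice made here never matters
  inside an integral.\<close>

definition weak_grad ::
    "(real ^ 'n::finite \<Rightarrow> 'b::euclidean_space) \<Rightarrow> real ^ 'n \<Rightarrow> 'b ^ 'n" where
  "weak_grad f = (SOME g. is_weak_gradient f g)"

definition H1 :: "(real ^ 'n::finite \<Rightarrow> 'b::euclidean_space) set" where
  "H1 = {f \<in> L2. \<exists>g \<in> L2. is_weak_gradient f g}"

definition H1_norm :: "(real ^ 'n::finite \<Rightarrow> 'b::euclidean_space) \<Rightarrow> real" where
  "H1_norm f = sqrt ((\<integral>x. (norm (f x))\<^sup>2 \<partial>lebesgue) + (\<integral>x. (norm (weak_grad f x))\<^sup>2 \<partial>lebesgue))"

definition H1_0 :: "(real ^ 'n::finite \<Rightarrow> 'b::euclidean_space) set" where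
  "H1_0 = {f \<in> H1. \<forall>\<epsilon>>0. \<exists>\<eta> \<in> Cc_infinity. H1_norm (\<lambda>x. f x - \<eta> x) < \<epsilon>}"

definition dyadic_cubes :: "(real ^ 'n::finite) set set" where
  "dyadic_cubes = {(\<lambda>x. ((2::real) powi k) *\<^sub>R (x + (\<chi> i. of_int (j $ i)))) ` {x. \<forall>i. 0 \<le> x $ i \<and> x $ i < 1}
                   | (k :: int) (j :: int ^ 'n). True}"

text \<open>The values lie in the extended nonnegative reals, and the empty supremum is \<open>0\<close>. The truncated
  subtraction in the exponent is exact because the dimension is assumed to be at least 3; the
  diagonal, where the kernel divides by zero, is a null set.\<close>

definition potential_norm :: "(real ^ 'n::finite \<Rightarrow> complex) \<Rightarrow> ennreal" where
  "potential_norm V =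
     (SUP Q \<in> {Q \<in> dyadic_cubes. (\<integral>\<^sup>+x\<in>Q. ennreal (cmod (V x)) \<partial>lebesgue) \<noteq> 0}.
        inverse (\<integral>\<^sup>+x\<in>Q. ennreal (cmod (V x)) \<partial>lebesgue) *
        (\<integral>\<^sup>+y\<in>Q. (\<integral>\<^sup>+x\<in>Q.
            ennreal (cmod (V x * V y) / norm (x - y) ^ (CARD('n) - 2)) \<partial>lebesgue) \<partial>lebesgue))"

text \<open>The products below are bilinear, without complex conjugation. The weak equation includes that
  its integrand is integrable (the Bochner integral of a nonintegrable function would be \<open>0\<close> by
  convention).\<close>

definition weak_solution ::
    "(real ^ 'n::finite \<Rightarrow> complex) \<Rightarrow> complex \<Rightarrow> (real ^ 'n \<Rightarrow> real) \<Rightarrow> bool" where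
  "weak_solution V E \<psi> \<longleftrightarrow>
     (\<forall>(\<phi> :: real ^ 'n \<Rightarrow> complex) \<in> H1_0.
        has_bochner_integral lebesgue
          (\<lambda>x. (\<Sum>i\<in>UNIV. complex_of_real (weak_grad \<psi> x $ i) * (weak_grad \<phi> x $ i))
               + (V x - E) * complex_of_real (\<psi> x) * \<phi> x) 0)"

definition zero_of_infinite_order ::
    "(real ^ 'n::finite \<Rightarrow> real) \<Rightarrow> real ^ 'n \<Rightarrow> bool" where
  "zero_of_infinite_order \<psi> x\<^sub>0 \<longleftrightarrow>
     (\<forall>m::real. m > 0 \<longrightarrow>
        (\<lambda>\<epsilon>. LINT x:ball x\<^sub>0 \<epsilon>|lebesgue. \<psi> x) \<in> O[at_right 0](\<lambda>\<epsilon>. \<epsilon> powr m))"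

end

theory Submission
  imports Defs "HOL-Real_Asymp.Real_Asymp"
begin

text \<open>
  Suppose that \<open>\<psi>\<close> has one sign near \<open>x\<^sub>0\<close>, say \<open>\<psi> \<ge> 0\<close>. Restricting the double integral to a dyadic cube
  of side \<open>l\<close> and bounding the kernel below gives \<open>\<integral>|V| \<le> C l^(n-2)\<close> over that cube, hence over balls.
  Testing the equation with \<open>\<zeta> / (\<psi> + \<delta>)\<close> for a cutoff \<open>\<zeta>\<close> then bounds the Dirichlet integral of
  \<open>w = ln (\<psi> + \<delta>)\<close> over \<open>B(x\<^sub>0,r)\<close> by \<open>C r^(n-2)\<close>, and by Poincare's inequality the mean oscillation of
  \<open>w\<close> over \<open>B(x\<^sub>0,r)\<close> is bounded uniformly in \<open>r\<close> and \<open>\<delta>\<close>. Therefore the average of \<open>w\<close> drops by at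
  most a constant when \<open>r\<close> is halved, and by Jensen's inequality the average of \<open>\<psi>\<close> decays at most like
  a power of \<open>r\<close>, unless the averages of \<open>w\<close> tend to minus infinity as \<open>\<delta> \<rightarrow> 0\<close>; the latter forces
  \<open>\<psi> = 0\<close> almost everywhere.

  The weak equation is only ever tested with smooth bumps centred at \<open>y\<close>, which says that the
  mollification \<open>u\<close> of \<open>\<psi>\<close> satisfies \<open>\<Delta>u = g\<close> classically, with \<open>g\<close> the mollification of
  \<open>Re (V - E) \<psi>\<close>. The energy estimate is carried out for \<open>u\<close> and only \<open>L\<^sup>1\<close> convergence of mollifications
  is needed afterwards.
\<close>

section \<open>Smooth functions with compact support\<close>

text \<open>Two things are not given. Local integrability of \<open>V\<close> and square
  integrability of \<open>\<psi>\<close> do not make \<open>V \<psi>\<close> locally integrable, and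
  the quotient \<open>\<zeta> / (\<psi> + \<delta>)\<close> would first have to be placed in
  \<open>H1_0\<close>. The weak equation settles the first, since its integrand is integrable for
  every bump; mollifying circumvents the second. The price is that the decisive cancellation, the
  bound of \<open>|Re (V - E)| \<psi> / (\<psi> + \<delta>)\<close> by \<open>|V| + |E|\<close>,
  holds for the original functions and not for their mollifications. So the radius and
  \<open>\<delta>\<close> are fixed, the mollification parameter goes to 0 in the right-hand side of
  the energy estimate, and only then are the constants read off, uniformly in both. The shift
  \<open>\<delta>\<close> keeps denominators and logarithms under control during this limit and is
  removed last. \<open>V\<close> and \<open>E\<close> may be complex; with \<open>\<psi>\<close> and
  the bumps real, the energy estimate uses the real part of the equation. The term with
  \<open>E\<close> contributes \<open>r^n\<close>, which is of lower order than
  \<open>r^(n-2)\<close>.\<close>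

lemma partial_deriv_eq:
  "(f has_derivative f') (at x) \<Longrightarrow> partial_deriv i f x = f' (axis i 1)"
  unfolding partial_deriv_def by (metis frechet_derivative_at)

text \<open>Any explicitly given derivative may serve, so the inductions below need not compute
  \<open>frechet_derivative\<close> of a composite function.\<close>

lemma C_k_SucI:
  assumes "\<And>x. (f has_derivative f' x) (at x)" and "\<And>i. C_k k (\<lambda>x. f' x (axis i 1))"
  shows "C_k (Suc k) f"
proof -
  have "partial_deriv i f = (\<lambda>x. f' x (axis i 1))" for i
    using partial_deriv_eq[OF assms(1)] by blast
  then show ?thesis
    using assms by (auto simp: differentiable_on_def differentiable_def intro: has_derivative_at_withinI)
qed

lemma C_k_SucD: "C_k (Suc k) f \<Longrightarrow> C_k k f"
proof (induction k arbitrary: f)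
  case 0
  then show ?case by (simp add: differentiable_imp_continuous_on)
next
  case (Suc k)
  then show ?case by simp
qed

lemma C_k_Suc_has_derivative:
  assumes "C_k (Suc k) f"
  shows "(f has_derivative frechet_derivative f (at x)) (at x)"
  using assms by (simp add: differentiable_on_def frechet_derivative_works)

lemma C_k_const: "C_k k (\<lambda>x. c)"
proof (induction k arbitrary: c)
  case (Suc k)
  show ?case by (rule C_k_SucI[where f' = "\<lambda>x h. 0"]) (use Suc in auto)
qed simp

lemma C_k_add:
  "C_k k f \<Longrightarrow> C_k k g \<Longrightarrow> C_k k (\<lambda>x. f x + g x)"
proof (induction k arbitrary: f g)
  case 0
  then show ?case by (simp add: continuous_on_add)
next
  case (Suc k)
  show ?case
    by (rule C_k_SucI[OF has_derivative_add[OF C_k_Suc_has_derivative C_k_Suc_has_derivative]])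
       (use Suc in \<open>auto simp flip: partial_deriv_def\<close>)
qed

text \<open>Each term of the product rule keeps one factor undifferentiated, so the induction also
  needs the factors themselves at the lower order; \<open>C_k_SucD\<close> supplies this.\<close>

lemma C_k_mult:
  fixes f g :: "real ^ 'n::finite \<Rightarrow> real"
  shows "C_k k f \<Longrightarrow> C_k k g \<Longrightarrow> C_k k (\<lambda>x. f x * g x)"
proof (induction k arbitrary: f g)
  case 0
  then show ?case by (simp add: continuous_on_mult)
next
  case (Suc k)
  show ?case
    by (rule C_k_SucI[OF has_derivative_mult[OF C_k_Suc_has_derivative C_k_Suc_has_derivative]])
       (use Suc C_k_SucD[OF Suc.prems(1)] C_k_SucD[OF Suc.prems(2)] in
         \<open>auto simp flip: partial_deriv_def intro!: C_k_add\<close>)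
qed

lemma C_k_scaleR: "C_k k f \<Longrightarrow> C_k k (\<lambda>x. c *\<^sub>R f x)"
proof (induction k arbitrary: f)
  case 0
  then show ?case by (simp add: continuous_on_scaleR)
next
  case (Suc k)
  show ?case
    by (rule C_k_SucI[OF has_derivative_scaleR_right[OF C_k_Suc_has_derivative]])
       (use Suc in \<open>auto simp flip: partial_deriv_def\<close>)
qed

lemma C_k_prod:
  fixes f :: "'i \<Rightarrow> real ^ 'n::finite \<Rightarrow> real"
  shows "(\<And>i. i \<in> I \<Longrightarrow> C_k k (f i)) \<Longrightarrow> C_k k (\<lambda>x. \<Prod>i\<in>I. f i x)"
  by (induction I rule: infinite_finite_induct) (auto intro: C_k_const C_k_mult)

lemma C_k_affine: "C_k k f \<Longrightarrow> C_k k (\<lambda>x. f (a + c *\<^sub>R x))"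
proof (induction k arbitrary: f)
  case 0
  then show ?case
    by (auto intro!: continuous_on_compose2[where g = f and t = UNIV] continuous_intros)
next
  case (Suc k)
  have 1: "((\<lambda>x. f (a + c *\<^sub>R x)) has_derivative (\<lambda>h. c *\<^sub>R frechet_derivative f (at (a + c *\<^sub>R x)) h)) (at x)" for x
  proof -
    have "((\<lambda>x. a + c *\<^sub>R x) has_derivative (\<lambda>h. c *\<^sub>R h)) (at x)"
      by (auto intro!: derivative_eq_intros)
    from has_derivative_compose[OF this C_k_Suc_has_derivative[OF Suc.prems]]
    show ?thesis
      by (rule has_derivative_eq_rhs)
        (simp add: linear_cmul[OF has_derivative_linear[OF C_k_Suc_has_derivative[OF Suc.prems]]])
  qed
  show ?case
    by (rule C_k_SucI[OF 1]) (use Suc in \<open>auto simp flip: partial_deriv_def intro!: C_k_scaleR\<close>)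
qed

lemma has_derivative_complex_of_real:
  "(f has_derivative f') F \<Longrightarrow> ((\<lambda>x. complex_of_real (f x)) has_derivative (\<lambda>h. complex_of_real (f' h))) F"
  by (rule bounded_linear.has_derivative[OF bounded_linear_of_real])

lemma C_k_complex_of_real: "C_k k f \<Longrightarrow> C_k k (\<lambda>x. complex_of_real (f x))"
proof (induction k arbitrary: f)
  case 0
  then show ?case by (simp add: continuous_on_of_real)
next
  case (Suc k)
  show ?case
    by (rule C_k_SucI[OF has_derivative_complex_of_real[OF C_k_Suc_has_derivative]])
       (use Suc in \<open>auto simp flip: partial_deriv_def\<close>)
qed

text \<open>The derivative of \<open>flat m\<close> lies in the span of \<open>flat (m + 1)\<close> and \<open>flat (m + 2)\<close>; proving smoothness
  for all \<open>m\<close> at once thus needs no induction hypothesis other than the one on the order.\<close>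

definition flat :: "nat \<Rightarrow> real \<Rightarrow> real" where
  "flat m t = (if t > 0 then exp (- inverse t) * inverse t ^ m else 0)"

text \<open>In the variable \<open>1 / t\<close> this says that the exponential beats every
  power.\<close>

lemma flat_tendsto_0: "(flat m \<longlongrightarrow> 0) (at 0)"
proof -
  have "((\<lambda>t. inverse t ^ m / exp (inverse t)) \<longlongrightarrow> (0::real)) (at_right 0)"
    by (rule filterlim_compose[OF tendsto_power_div_exp_0 filterlim_inverse_at_top_right])
  then have R: "(flat m \<longlongrightarrow> 0) (at_right 0)"
    by (rule Lim_transform_eventually)
       (auto simp: flat_def exp_minus field_simps intro!: eventually_at_rightI[of 0 1])
  have L: "(flat m \<longlongrightarrow> 0) (at_left 0)"
    by (rule Lim_transform_eventually[OF tendsto_const])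
       (auto simp: flat_def intro!: eventually_at_leftI[of "-1"])
  from L R show ?thesis by (simp add: filterlim_split_at)
qed

lemma DERIV_flat: "(flat m has_real_derivative flat (m + 2) t - m * flat (m + 1) t) (at t)"
proof -
  consider "t > 0" | "t < 0" | "t = 0" by linarith
  then show ?thesis
  proof cases
    case 1
    have e: "((\<lambda>t. exp (- inverse t)) has_real_derivative exp (- inverse t) * (inverse t)\<^sup>2) (at t)"
      using 1 by (auto intro!: derivative_eq_intros simp: power2_eq_square)
    have "((\<lambda>t. inverse t ^ m) has_real_derivative - (m * inverse t ^ (m + 1))) (at t)"
      using DERIV_power[OF DERIV_inverse, of t m UNIV] 1
      by (cases m) (auto simp: power2_eq_square algebra_simps)
    from DERIV_mult[OF e this]
    have "((\<lambda>t. exp (- inverse t) * inverse t ^ m) has_real_derivative flat (m + 2) t - m * flat (m + 1) t) (at t)"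
      by (rule DERIV_cong) (use 1 in \<open>simp add: flat_def power2_eq_square algebra_simps\<close>)
    then show ?thesis
      by (rule DERIV_cong_ev[THEN iffD1, rotated -1])
         (use 1 in \<open>auto simp: flat_def intro!: eventually_nhds_in_open[of "{0<..}", THEN eventually_mono]\<close>)
  next
    case 2
    have "((\<lambda>t. 0) has_real_derivative flat (m + 2) t - m * flat (m + 1) t) (at t)"
      using 2 by (auto simp: flat_def)
    then show ?thesis
      by (rule DERIV_cong_ev[THEN iffD1, rotated -1])
         (use 2 in \<open>auto simp: flat_def intro!: eventually_nhds_in_open[of "{..<0}", THEN eventually_mono]\<close>)
  next
    case 3
    \<comment> \<open>Dividing by h adds one factor \<open>inverse h\<close>, so the difference
      quotient of \<open>flat m\<close> at 0 is \<open>flat (Suc m)\<close>.\<close>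
    have "((\<lambda>h. (flat m h - flat m 0) / (h - 0)) \<longlongrightarrow> 0) (at 0)"
      by (rule Lim_transform_eventually[OF flat_tendsto_0[of "Suc m"]])
         (auto simp: flat_def field_simps eventually_at_filter)
    then show ?thesis using 3 by (simp add: has_field_derivative_iff flat_def)
  qed
qed

lemma C_k_flat: "C_k k (\<lambda>x::real ^ 'n::finite. flat m (a + c * x $ i))"
proof (induction k arbitrary: m)
  case 0
  have "continuous_on UNIV (flat m)"
    using DERIV_flat by (meson DERIV_isCont continuous_at_imp_continuous_on)
  then show ?case
    by (auto intro!: continuous_on_compose2[where g = "flat m" and t = UNIV] continuous_intros)
next
  case (Suc k)
  let ?d = "\<lambda>x::real ^ 'n. flat (m + 2) (a + c * x $ i) - m * flat (m + 1) (a + c * x $ i)"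
  have 1: "((\<lambda>x::real ^ 'n. flat m (a + c * x $ i)) has_derivative (\<lambda>h. ?d x * (c * h $ i))) (at x)" for x
  proof -
    have "((\<lambda>x::real ^ 'n. a + c * x $ i) has_derivative (\<lambda>h. c * h $ i)) (at x)"
      by (auto intro!: derivative_eq_intros bounded_linear_imp_has_derivative[OF bounded_linear_vec_nth])
    from has_derivative_compose[OF this DERIV_flat[unfolded has_field_derivative_def]]
    show ?thesis by (simp add: mult.commute)
  qed
  have 2: "C_k k (\<lambda>x. (flat (m + 2) (a + c * x $ i) + (- m) * flat (m + 1) (a + c * x $ i)) * (c * axis j 1 $ i))" for j
    by (intro C_k_mult C_k_add C_k_const Suc.IH)
  show ?case
    by (rule C_k_SucI[OF 1]) (use 2 in \<open>simp\<close>)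
qed

lemma partial_deriv_eq_0:
  assumes "open U" "\<And>x. x \<in> U \<Longrightarrow> f x = 0" "x \<in> U"
  shows "partial_deriv i f x = 0"
proof -
  have "(f has_derivative (\<lambda>h. 0)) (at x)"
    by (rule has_derivative_transform_within_open[OF has_derivative_const[of 0] assms(1)]) (use assms in auto)
  from partial_deriv_eq[OF this] show ?thesis .
qed

lemma Cc_infinity_partial_deriv:
  assumes "f \<in> Cc_infinity" shows "partial_deriv i f \<in> Cc_infinity"
proof -
  have "C_k k (partial_deriv i f)" for k
    using assms by (auto simp: Cc_infinity_def dest: spec[of _ "Suc k"])
  moreover have "partial_deriv i f x = 0" if "x \<notin> closure {x. f x \<noteq> 0}" for x
    by (rule partial_deriv_eq_0[of "- closure {x. f x \<noteq> 0}"])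
       (use that closure_subset[of "{x. f x \<noteq> 0}"] in auto)
  then have "closure {x. partial_deriv i f x \<noteq> 0} \<subseteq> closure {x. f x \<noteq> 0}"
    by (intro closure_minimal) auto
  ultimately show ?thesis
    using assms by (auto simp: Cc_infinity_def compact_eq_bounded_closed intro: bounded_subset)
qed

text \<open>Vanishing far out is the form of the support condition that the boundedness and
  integrability arguments use.\<close>

lemma Cc_infinity_iff:
  "f \<in> Cc_infinity \<longleftrightarrow> (\<forall>k. C_k k f) \<and> (\<exists>R. \<forall>x. norm x > R \<longrightarrow> f x = 0)"
proof -
  have "bounded {x. f x \<noteq> 0} \<longleftrightarrow> (\<exists>R. \<forall>x. norm x > R \<longrightarrow> f x = 0)"
  proof
    assume "bounded {x. f x \<noteq> 0}"
    then obtain R where "\<forall>x\<in>{x. f x \<noteq> 0}. norm x \<le> R" unfolding bounded_iff by blast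
    then show "\<exists>R. \<forall>x. norm x > R \<longrightarrow> f x = 0" by (intro exI[of _ R]) force
  next
    assume "\<exists>R. \<forall>x. norm x > R \<longrightarrow> f x = 0"
    then obtain R where "\<forall>x. norm x > R \<longrightarrow> f x = 0" by blast
    then show "bounded {x. f x \<noteq> 0}" unfolding bounded_iff by (intro exI[of _ R]) force
  qed
  moreover have "compact (closure {x. f x \<noteq> 0}) \<longleftrightarrow> bounded {x. f x \<noteq> 0}"
    by (simp add: compact_closure)
  ultimately show ?thesis by (simp add: Cc_infinity_def)
qed

lemma Cc_infinity_complex_of_real:
  "f \<in> Cc_infinity \<Longrightarrow> (\<lambda>x. complex_of_real (f x)) \<in> Cc_infinity"
  by (simp add: Cc_infinity_iff C_k_complex_of_real)

lemma Cc_infinity_affine: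
  assumes "f \<in> Cc_infinity" "c \<noteq> 0" shows "(\<lambda>x. d *\<^sub>R f (a + c *\<^sub>R x)) \<in> Cc_infinity"
proof -
  obtain R where R: "\<And>x. norm x > R \<Longrightarrow> f x = 0" using assms by (auto simp: Cc_infinity_iff)
  have "f (a + c *\<^sub>R x) = 0" if "norm x > (R + norm a) / \<bar>c\<bar>" for x
  proof (rule R)
    have "R + norm a < \<bar>c\<bar> * norm x" using that assms(2) by (simp add: field_simps)
    then show "R < norm (a + c *\<^sub>R x)"
      using norm_triangle_ineq4[of "a + c *\<^sub>R x" a] by simp
  qed
  then show ?thesis using assms by (auto simp: Cc_infinity_iff intro!: C_k_scaleR C_k_affine)
qed

lemma Cc_infinity_cont: "f \<in> Cc_infinity \<Longrightarrow> continuous_on UNIV f"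
  by (auto simp: Cc_infinity_def dest: spec[of _ 0])

lemma Cc_infinity_has_derivative:
  assumes "f \<in> Cc_infinity" shows "(f has_derivative frechet_derivative f (at x)) (at x)"
  using assms by (intro C_k_Suc_has_derivative[of 0]) (simp add: Cc_infinity_def del: C_k.simps)

definition gradient :: "(real ^ 'n::finite \<Rightarrow> real) \<Rightarrow> real ^ 'n \<Rightarrow> real ^ 'n" where
  "gradient f x = (\<chi> i. partial_deriv i f x)"

lemma Cc_infinity_GDERIV:
  fixes f :: "real ^ 'n::finite \<Rightarrow> real"
  assumes "f \<in> Cc_infinity" shows "GDERIV f x :> gradient f x"
proof -
  interpret linear "frechet_derivative f (at x)"
    using Cc_infinity_has_derivative[OF assms] has_derivative_linear by blast
  have *: "frechet_derivative f (at x) h = h \<bullet> gradient f x" for h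
  proof -
    have "frechet_derivative f (at x) (\<Sum>i\<in>UNIV. h $ i *\<^sub>R axis i 1) = h \<bullet> gradient f x"
      by (simp add: sum scale gradient_def partial_deriv_def inner_vec_def)
    then show ?thesis by (simp add: basis_expansion scalar_mult_eq_scaleR[symmetric])
  qed
  then have "frechet_derivative f (at x) = (\<lambda>h. h \<bullet> gradient f x)" by blast
  then show ?thesis
    using Cc_infinity_has_derivative[OF assms, of x] unfolding gderiv_def by presburger
qed

lemma Cc_infinity_bounded:
  assumes "f \<in> Cc_infinity" shows "\<exists>B\<ge>0. \<forall>x. norm (f x) \<le> B"
proof -
  obtain R where R: "\<And>x. norm x > R \<Longrightarrow> f x = 0" using assms by (auto simp: Cc_infinity_iff)
  have "compact (f ` cball 0 R)"
    using Cc_infinity_cont[OF assms] by (intro compact_continuous_image) (auto intro: continuous_on_subset)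
  then obtain B where B: "B > 0" "\<And>x. x \<in> cball 0 R \<Longrightarrow> norm (f x) \<le> B"
    by (auto simp: bounded_pos dest!: compact_imp_bounded)
  have "norm (f x) \<le> B" for x
    using B(2)[of x] R[of x] B(1) by (cases "norm x > R") auto
  then show ?thesis using B(1) by (intro exI[of _ B]) simp
qed

text \<open>The bump is a product over the coordinates, with factors that are positive exactly when
  \<open>|x $ i| < 1 / N\<close>, where N is the dimension. A vector of norm at least 1 has
  \<open>l^1\<close> norm at least 1, hence a coordinate of size at least \<open>1 / N\<close>,
  which kills the product. The radius \<open>s\<close> of positivity serves later to bound a
  rescaled bump below on a prescribed ball.\<close>

lemma exists_mollifier:
  obtains \<rho> :: "real ^ 'n::finite \<Rightarrow> real" and s where
    "\<rho> \<in> Cc_infinity" "\<And>x. \<rho> x \<ge> 0" "\<And>x. norm x \<ge> 1 \<Longrightarrow> \<rho> x = 0" "s > 0" "\<And>x. norm x < s \<Longrightarrow> \<rho> x > 0"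
    "integrable lborel \<rho>" "(\<integral>x. \<rho> x \<partial>lborel) = 1"
proof -
  define N where "N = real CARD('n)"
  have N: "N > 0" by (simp add: N_def)
  define \<eta> :: "real ^ 'n \<Rightarrow> real" where "\<eta> x = (\<Prod>i\<in>UNIV. flat 0 (1 + N * x $ i) * flat 0 (1 + (- N) * x $ i))" for x
  have nn: "\<eta> x \<ge> 0" for x by (auto simp: \<eta>_def flat_def intro!: prod_nonneg)
  have out: "\<eta> x = 0" if "norm x \<ge> 1" for x
  proof -
    have ge1: "1 \<le> (\<Sum>i\<in>UNIV. \<bar>x $ i\<bar>)" using norm_le_l1_cart[of x] that by simp
    have "\<exists>i. \<bar>x $ i\<bar> \<ge> 1 / N"
    proof (rule ccontr)
      assume "\<not> ?thesis"
      then have "(\<Sum>i\<in>UNIV. \<bar>x $ i\<bar>) < (\<Sum>i\<in>(UNIV::'n set). 1 / N)"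
        by (intro sum_strict_mono) (auto simp: not_le)
      also have "\<dots> = 1" by (simp add: N_def)
      finally show False using ge1 by simp
    qed
    then obtain i where "\<bar>x $ i\<bar> \<ge> 1 / N" by blast
    then have "1 \<le> N * \<bar>x $ i\<bar>" using N by (simp add: field_simps)
    then have "1 + N * x $ i \<le> 0 \<or> 1 + (- N) * x $ i \<le> 0" by (auto simp: abs_if split: if_splits)
    then show ?thesis unfolding \<eta>_def by (intro prod_zero bexI[of _ i]) (auto simp: flat_def)
  qed
  have pos: "\<eta> x > 0" if "norm x < 1 / N" for x
  proof -
    have "\<bar>x $ i\<bar> < 1 / N" for i using component_le_norm_cart[of x i] that by linarith
    then have "N * \<bar>x $ i\<bar> < 1" for i using N by (simp add: field_simps)
    then have "\<bar>N * x $ i\<bar> < 1" for i using N by (simp add: abs_mult)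
    then have "- 1 < N * x $ i \<and> N * x $ i < 1" for i unfolding abs_less_iff by (metis minus_less_iff)
    then have "0 < 1 + N * x $ i" "0 < 1 + (- N) * x $ i" for i
      using add_strict_left_mono[of "- 1" "N * x $ i" 1] by (simp_all)
    then show ?thesis unfolding \<eta>_def by (intro prod_pos) (simp add: flat_def)
  qed
  have Cc: "\<eta> \<in> Cc_infinity"
    unfolding Cc_infinity_iff
  proof (intro conjI allI exI[of _ 1] impI)
    show "C_k k \<eta>" for k unfolding \<eta>_def by (intro C_k_prod C_k_mult C_k_flat)
  qed (auto intro!: out)
  have int: "integrable lborel \<eta>"
  proof -
    have "integrable lborel (\<lambda>x. indicator (cball 0 1) x *\<^sub>R \<eta> x)"
      by (rule borel_integrable_compact) (auto intro: continuous_on_subset[OF Cc_infinity_cont[OF Cc]])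
    moreover have "(\<lambda>x. indicator (cball 0 1) x *\<^sub>R \<eta> x) = \<eta>"
      using out by (auto simp: fun_eq_iff indicator_def not_le)
    ultimately show ?thesis by simp
  qed
  have "(\<integral>x. \<eta> x \<partial>lborel) \<noteq> 0"
  proof
    assume "(\<integral>x. \<eta> x \<partial>lborel) = 0"
    then have "AE x in lborel. \<eta> x = 0" using integral_nonneg_eq_0_iff_AE[OF int] nn by auto
    then have "AE x in lborel. x \<notin> ball (0::real ^ 'n) (1 / N)" by eventually_elim (use pos in force)
    then have "emeasure lborel (ball (0::real ^ 'n) (1 / N)) = 0"
      by (subst (asm) AE_iff_null_sets[symmetric]) auto
    then show False using N content_ball_gt_0_iff[of "0::real ^ 'n" "1 / N"] by (simp add: measure_def del: content_ball_gt_0_iff)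
  qed
  then have I: "(\<integral>x. \<eta> x \<partial>lborel) > 0" using nn by (simp add: order_less_le integral_nonneg_AE)
  let ?\<rho> = "\<lambda>x. inverse (\<integral>x. \<eta> x \<partial>lborel) *\<^sub>R \<eta> (0 + 1 *\<^sub>R x)"
  show ?thesis
    by (rule that[of ?\<rho> "1 / N"]) (use Cc_infinity_affine[OF Cc, of 1 _ 0] nn out I N pos int in auto)
qed

section \<open>Mollification\<close>

lemma nn_integral_lborel_affine:
  fixes t :: "'a::euclidean_space"
  assumes [measurable]: "f \<in> borel_measurable borel" and "c \<noteq> 0"
  shows "(\<integral>\<^sup>+x. f x \<partial>lborel) = ennreal (\<bar>c\<bar> ^ DIM('a)) * (\<integral>\<^sup>+x. f (t + c *\<^sub>R x) \<partial>lborel)"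
  by (subst lborel_affine[OF assms(2), of t])
     (simp add: nn_integral_density nn_integral_distr nn_integral_cmult ennreal_power)

lemma nn_integral_lborel_shift:
  fixes t :: "'a::euclidean_space"
  assumes "f \<in> borel_measurable borel"
  shows "(\<integral>\<^sup>+x. f (x + t) \<partial>lborel) = (\<integral>\<^sup>+x. f x \<partial>lborel)"
  using nn_integral_lborel_affine[OF assms, of 1 t] by (simp add: add.commute)

lemma integral_lborel_affine:
  fixes t :: "'a::euclidean_space" and f :: "'a \<Rightarrow> real"
  assumes [measurable]: "f \<in> borel_measurable borel" and "c \<noteq> 0"
  shows "(\<integral>x. f x \<partial>lborel) = \<bar>c\<bar> ^ DIM('a) * (\<integral>x. f (t + c *\<^sub>R x) \<partial>lborel)"
  by (subst lborel_affine[OF assms(2), of t])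
     (simp add: integral_density integral_distr ennreal_power)

lemma integrable_lborel_affine:
  fixes t :: "'a::euclidean_space" and f :: "'a \<Rightarrow> real"
  assumes f: "integrable lborel f" and "c \<noteq> 0"
  shows "integrable lborel (\<lambda>x. f (t + c *\<^sub>R x))"
proof -
  have [measurable]: "f \<in> borel_measurable borel" using f by simp
  have "(\<integral>\<^sup>+x. ennreal (norm (f x)) \<partial>lborel) < \<infinity>" using f by (simp add: integrable_iff_bounded)
  then show ?thesis
    using assms(2) by (subst (asm) nn_integral_lborel_affine[where c = c and t = t])
      (auto simp: integrable_iff_bounded ennreal_mult_less_top)
qed

section \<open>Continuity of translations in \<open>L^1\<close>\<close>

definition L1_shift :: "('a::euclidean_space \<Rightarrow> real) \<Rightarrow> 'a \<Rightarrow> ennreal" where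
  "L1_shift f z = (\<integral>\<^sup>+x. ennreal \<bar>f (x + z) - f x\<bar> \<partial>lborel)"

text \<open>The error of replacing f by g is paid once at x and once at \<open>x + z\<close>; by
  translation invariance both cost the same, hence the factor 2.\<close>

lemma L1_shift_triangle:
  assumes [measurable]: "f \<in> borel_measurable borel" "g \<in> borel_measurable borel"
  shows "L1_shift f z \<le> L1_shift g z + 2 * (\<integral>\<^sup>+x. ennreal \<bar>f x - g x\<bar> \<partial>lborel)"
proof -
  have "L1_shift f z \<le> (\<integral>\<^sup>+x. ennreal \<bar>g (x + z) - g x\<bar> + (ennreal \<bar>f (x + z) - g (x + z)\<bar> + ennreal \<bar>f x - g x\<bar>) \<partial>lborel)"
    unfolding L1_shift_def
  proof (rule nn_integral_mono)
    fix x
    have "ennreal \<bar>f (x + z) - f x\<bar> \<le> ennreal (\<bar>g (x + z) - g x\<bar> + (\<bar>f (x + z) - g (x + z)\<bar> + \<bar>f x - g x\<bar>))"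
      by (intro ennreal_leI) linarith
    then show "ennreal \<bar>f (x + z) - f x\<bar> \<le> ennreal \<bar>g (x + z) - g x\<bar> + (ennreal \<bar>f (x + z) - g (x + z)\<bar> + ennreal \<bar>f x - g x\<bar>)"
      by simp
  qed
  also have "\<dots> = L1_shift g z + ((\<integral>\<^sup>+x. ennreal \<bar>f (x + z) - g (x + z)\<bar> \<partial>lborel) + (\<integral>\<^sup>+x. ennreal \<bar>f x - g x\<bar> \<partial>lborel))"
    by (simp add: nn_integral_add L1_shift_def)
  also have "(\<integral>\<^sup>+x. ennreal \<bar>f (x + z) - g (x + z)\<bar> \<partial>lborel) = (\<integral>\<^sup>+x. ennreal \<bar>f x - g x\<bar> \<partial>lborel)"
    by (rule nn_integral_lborel_shift) auto
  finally show ?thesis by (simp add: mult_2)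
qed

lemma ennreal_squeeze_0:
  fixes f g :: "nat \<Rightarrow> ennreal"
  assumes "\<And>n. f n \<le> g n" "g \<longlonglongrightarrow> 0"
  shows "f \<longlonglongrightarrow> 0"
  by (rule tendsto_sandwich[OF _ _ tendsto_const assms(2)]) (use assms(1) in auto)

text \<open>The functions whose translates converge in \<open>L^1\<close> form a closed set in
  \<open>L^1\<close>. This is used twice below: to pass from open to Borel sets, and in the limit
  step of the induction.\<close>

lemma L1_shift_approx:
  assumes [measurable]: "f \<in> borel_measurable borel" and z: "z \<longlonglongrightarrow> 0"
    and *: "\<And>e::real. e > 0 \<Longrightarrow> \<exists>g. g \<in> borel_measurable borel \<and> (\<integral>\<^sup>+x. ennreal \<bar>f x - g x\<bar> \<partial>lborel) < e
        \<and> (\<lambda>n. L1_shift g (z n)) \<longlonglongrightarrow> 0"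
  shows "(\<lambda>n. L1_shift f (z n)) \<longlonglongrightarrow> 0"
proof (rule tendsto_zero_ennreal)
  fix r :: real assume r: "r > 0"
  then obtain g where [measurable]: "g \<in> borel_measurable borel"
    and 1: "(\<integral>\<^sup>+x. ennreal \<bar>f x - g x\<bar> \<partial>lborel) < ennreal (r / 4)" and 2: "(\<lambda>n. L1_shift g (z n)) \<longlonglongrightarrow> 0"
    using *[of "r / 4"] by auto
  have "\<forall>\<^sub>F n in sequentially. L1_shift g (z n) < ennreal (r / 4)"
    using order_tendstoD(2)[OF 2, of "ennreal (r / 4)"] r by simp
  then show "\<forall>\<^sub>F n in sequentially. L1_shift f (z n) < ennreal r"
  proof eventually_elim
    case (elim n)
    have "L1_shift f (z n) \<le> L1_shift g (z n) + 2 * (\<integral>\<^sup>+x. ennreal \<bar>f x - g x\<bar> \<partial>lborel)"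
      by (rule L1_shift_triangle) auto
    also have "\<dots> \<le> ennreal (r / 4) + 2 * ennreal (r / 4)"
      using elim 1 by (intro add_mono mult_left_mono) auto
    also have "\<dots> = ennreal (r / 4) + ennreal (2 * (r / 4))"
      using r by (subst ennreal_mult) auto
    also have "\<dots> = ennreal (r / 4 + 2 * (r / 4))"
      using r by (subst ennreal_plus[symmetric]) auto
    also have "\<dots> < ennreal r"
      using r by (intro ennreal_lessI) auto
    finally show ?case .
  qed
qed

text \<open>For an open set, the indicator function is lower semicontinuous, which gives pointwise convergence of
  its translates on the set itself.\<close>

lemma open_shift_defect:
  fixes U :: "'a::euclidean_space set"
  assumes U: "open U" "emeasure lborel U < \<infinity>" and z: "z \<longlonglongrightarrow> 0"
  shows "(\<lambda>n. \<integral>\<^sup>+x. indicator U x * indicator (- U) (x + z n) \<partial>lborel) \<longlonglongrightarrow> 0"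
proof -
  have [measurable]: "U \<in> sets borel" using U by auto
  have "(\<lambda>n. \<integral>\<^sup>+x. indicator U x * indicator (- U) (x + z n) \<partial>lborel) \<longlonglongrightarrow> (\<integral>\<^sup>+x. 0 \<partial>(lborel :: 'a measure))"
  proof (rule nn_integral_dominated_convergence[where w = "indicator U"])
    show "(\<integral>\<^sup>+x. indicator U x \<partial>lborel) < \<infinity>" using U by simp
    have "(\<lambda>n. indicator U x * indicator (- U) (x + z n) :: ennreal) \<longlonglongrightarrow> 0" for x
    proof (cases "x \<in> U")
      case True
      have "(\<lambda>n. x + z n) \<longlonglongrightarrow> x" using tendsto_add[OF tendsto_const z, of x] by simp
      then have "\<forall>\<^sub>F n in sequentially. x + z n \<in> U" using U(1) True topological_tendstoD by blast
      then have "\<forall>\<^sub>F n in sequentially. (0::ennreal) = indicator U x * indicator (- U) (x + z n)"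
        by eventually_elim simp
      then show ?thesis by (rule Lim_transform_eventually[OF tendsto_const])
    qed auto
    then show "AE x in lborel. (\<lambda>n. indicator U x * indicator (- U) (x + z n) :: ennreal) \<longlonglongrightarrow> 0"
      by simp
  qed (auto simp: indicator_def)
  then show ?thesis by simp
qed

text \<open>The integrand lives on the symmetric difference of U and a translate of U. One half of
  it is the defect treated above; the other half becomes that defect for the opposite shift after a
  translation of the variable.\<close>

lemma L1_shift_open:
  fixes U :: "'a::euclidean_space set"
  assumes U: "open U" "emeasure lborel U < \<infinity>" and z: "z \<longlonglongrightarrow> 0"
  shows "(\<lambda>n. L1_shift (\<lambda>x. indicator U x * c) (z n)) \<longlonglongrightarrow> 0"
proof -
  have [measurable]: "U \<in> sets borel" using U by auto
  let ?D = "\<lambda>z. \<integral>\<^sup>+x. indicator U x * indicator (- U) (x + z) \<partial>lborel"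
  have "L1_shift (\<lambda>x. indicator U x * c) w \<le> ennreal \<bar>c\<bar> * (?D w + ?D (- w))" for w
  proof -
    have "L1_shift (\<lambda>x. indicator U x * c) w
      \<le> (\<integral>\<^sup>+x. ennreal \<bar>c\<bar> * (indicator U x * indicator (- U) (x + w) + indicator U (x + w) * indicator (- U) x) \<partial>lborel)"
      unfolding L1_shift_def by (intro nn_integral_mono) (auto simp: indicator_def)
    also have "\<dots> = ennreal \<bar>c\<bar> * (?D w + (\<integral>\<^sup>+x. indicator U (x + w) * indicator (- U) x \<partial>lborel))"
      by (simp add: nn_integral_cmult nn_integral_add)
    also have "(\<integral>\<^sup>+x. indicator U (x + w) * indicator (- U) x \<partial>lborel) = ?D (- w)"
      using nn_integral_lborel_shift[of "\<lambda>x. indicator U x * indicator (- U) (x - w)" w] by simp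
    finally show ?thesis .
  qed
  moreover have "(\<lambda>n. ennreal \<bar>c\<bar> * (?D (z n) + ?D (- z n))) \<longlonglongrightarrow> ennreal \<bar>c\<bar> * (0 + 0)"
    using tendsto_minus[OF z] by (intro tendsto_add ennreal_tendsto_cmult open_shift_defect U z) auto
  ultimately show ?thesis
    unfolding add_0_right mult_zero_right by (rule ennreal_squeeze_0)
qed

text \<open>Induction over integrable functions, with open sets in the role that continuous
  functions often have: by outer regularity a Borel set of finite measure is approximated by open
  sets containing it.\<close>

lemma L1_shift_tendsto_0:
  fixes f :: "'a::euclidean_space \<Rightarrow> real"
  assumes "integrable lborel f" and z: "z \<longlonglongrightarrow> 0"
  shows "(\<lambda>n. L1_shift f (z n)) \<longlonglongrightarrow> 0"
  using assms(1)
proof (induction f rule: integrable_induct)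
  case (base A c)
  have [measurable]: "A \<in> sets borel" using base by simp
  have key: "\<exists>g. g \<in> borel_measurable borel \<and> (\<integral>\<^sup>+x. ennreal \<bar>indicat_real A x *\<^sub>R c - g x\<bar> \<partial>lborel) < ennreal e
        \<and> (\<lambda>n. L1_shift g (z n)) \<longlonglongrightarrow> 0" if e: "e > 0" for e :: real
  proof -
    \<comment> \<open>The summand 1 covers the case \<open>c = 0\<close>.\<close>
    have "e / (\<bar>c\<bar> + 1) > 0" using e by simp
    moreover have "A \<in> sets lebesgue" by simp
    ultimately obtain U where U: "open U" "A \<subseteq> U" "(U - A) \<in> lmeasurable" "emeasure lebesgue (U - A) < ennreal (e / (\<bar>c\<bar> + 1))"
      using sets_lebesgue_outer_open by metis
    have [measurable]: "U \<in> sets borel" using U by simp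
    have eU: "emeasure lborel (U - A) < ennreal (e / (\<bar>c\<bar> + 1))" using U(4) by simp
    have "emeasure lborel U = emeasure lborel A + emeasure lborel (U - A)"
      using U(2) by (subst plus_emeasure) (auto intro!: arg_cong[where f = "emeasure lborel"])
    also have "\<dots> < \<infinity>" using base eU by (simp add: order_less_trans[OF _ ennreal_less_top])
    finally have fin: "emeasure lborel U < \<infinity>" .
    have "(\<integral>\<^sup>+x. ennreal \<bar>indicat_real A x *\<^sub>R c - indicator U x * c\<bar> \<partial>lborel)
        = (\<integral>\<^sup>+x. ennreal \<bar>c\<bar> * indicator (U - A) x \<partial>lborel)"
      using U(2) by (intro nn_integral_cong) (auto simp: indicator_def)
    also have "\<dots> = ennreal \<bar>c\<bar> * emeasure lborel (U - A)" by (simp add: nn_integral_cmult)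
    also have "\<dots> \<le> ennreal \<bar>c\<bar> * ennreal (e / (\<bar>c\<bar> + 1))" using eU by (intro mult_left_mono) auto
    also have "\<dots> = ennreal (\<bar>c\<bar> * (e / (\<bar>c\<bar> + 1)))" using e by (simp add: ennreal_mult[symmetric])
    also have "\<dots> < ennreal e" using e by (intro ennreal_lessI) (auto simp: field_simps)
    finally show ?thesis
      by (intro exI[of _ "\<lambda>x. indicator U x * c"] conjI L1_shift_open U fin z) auto
  qed
  show ?case by (rule L1_shift_approx[OF _ z key]) auto
next
  case (add f g)
  have [measurable]: "f \<in> borel_measurable borel" "g \<in> borel_measurable borel" using add by auto
  have "L1_shift (\<lambda>x. f x + g x) w \<le> L1_shift f w + L1_shift g w" for w
  proof -
    have "L1_shift (\<lambda>x. f x + g x) w \<le> (\<integral>\<^sup>+x. ennreal \<bar>f (x + w) - f x\<bar> + ennreal \<bar>g (x + w) - g x\<bar> \<partial>lborel)"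
      unfolding L1_shift_def by (intro nn_integral_mono) (simp flip: ennreal_plus)
    then show ?thesis by (simp add: L1_shift_def nn_integral_add)
  qed
  moreover have "(\<lambda>n. L1_shift f (z n) + L1_shift g (z n)) \<longlonglongrightarrow> 0"
    using tendsto_add[OF add.IH] by simp
  ultimately show ?case by (rule ennreal_squeeze_0)
next
  case (lim f s)
  have [measurable]: "\<And>i. s i \<in> borel_measurable borel" "f \<in> borel_measurable borel" using lim by auto
  have c: "(\<lambda>i. \<integral>\<^sup>+x. ennreal (norm (f x - s i x)) \<partial>lborel) \<longlonglongrightarrow> 0"
  proof (rule nn_integral_dominated_convergence_norm[where w = "\<lambda>x. 2 * norm (f x)"])
    show "(\<integral>\<^sup>+x. ennreal (2 * norm (f x)) \<partial>lborel) < \<infinity>"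
      using \<open>integrable lborel f\<close> by (simp add: integrable_iff_bounded ennreal_mult nn_integral_cmult ennreal_mult_less_top)
  qed (use lim in auto)
  have key: "\<exists>g. g \<in> borel_measurable borel \<and> (\<integral>\<^sup>+x. ennreal \<bar>f x - g x\<bar> \<partial>lborel) < ennreal e
        \<and> (\<lambda>n. L1_shift g (z n)) \<longlonglongrightarrow> 0" if "e > 0" for e :: real
  proof -
    have "\<forall>\<^sub>F i in sequentially. (\<integral>\<^sup>+x. ennreal (norm (f x - s i x)) \<partial>lborel) < ennreal e"
      using that by (intro order_tendstoD(2)[OF c]) auto
    then obtain i where "(\<integral>\<^sup>+x. ennreal (norm (f x - s i x)) \<partial>lborel) < ennreal e"
      by (auto simp: eventually_sequentially)
    then show ?thesis using lim.IH by (intro exI[of _ "s i"]) auto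
  qed
  show ?case by (rule L1_shift_approx[OF _ z key]) auto
qed

section \<open>Convolution with a mollifier\<close>

text \<open>The kernel is \<open>K (x - y)\<close> rather than \<open>K (y - x)\<close>, so that \<open>conv (moll \<rho> \<epsilon>) f y\<close> pairs \<open>f\<close> with a test
  function centred at \<open>y\<close>; derivatives in \<open>y\<close> pick up a sign.\<close>

definition conv :: "('a::euclidean_space \<Rightarrow> real) \<Rightarrow> ('a \<Rightarrow> real) \<Rightarrow> 'a \<Rightarrow> real" where
  "conv K f y = (\<integral>x. f x * K (x - y) \<partial>lborel)"

definition moll :: "('a::euclidean_space \<Rightarrow> real) \<Rightarrow> real \<Rightarrow> 'a \<Rightarrow> real" where
  "moll \<rho> \<epsilon> z = inverse \<epsilon> ^ DIM('a) * \<rho> (inverse \<epsilon> *\<^sub>R z)"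

lemma integrable_mult_bounded:
  fixes f g :: "'a \<Rightarrow> real"
  assumes "integrable M f" "g \<in> borel_measurable M" "\<And>x. \<bar>g x\<bar> \<le> B"
  shows "integrable M (\<lambda>x. f x * g x)"
proof (rule Bochner_Integration.integrable_bound)
  show "integrable M (\<lambda>x. B * f x)" using assms by simp
  show "AE x in M. norm (f x * g x) \<le> norm (B * f x)"
  proof (rule AE_I2)
    fix x show "norm (f x * g x) \<le> norm (B * f x)"
      using mult_left_mono[OF assms(3)[of x], of "\<bar>f x\<bar>"] assms(3)[of x]
      by (simp add: abs_mult mult.commute)
  qed
qed (use assms in auto)

lemma conv_moll_eq:
  fixes f :: "'a::euclidean_space \<Rightarrow> real"
  assumes [measurable]: "f \<in> borel_measurable borel" "\<rho> \<in> borel_measurable borel" and "\<epsilon> > 0"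
  shows "conv (moll \<rho> \<epsilon>) f y = (\<integral>z. f (y + \<epsilon> *\<^sub>R z) * \<rho> z \<partial>lborel)"
proof -
  have "conv (moll \<rho> \<epsilon>) f y
      = \<bar>\<epsilon>\<bar> ^ DIM('a) * (\<integral>z. f (y + \<epsilon> *\<^sub>R z) * moll \<rho> \<epsilon> (y + \<epsilon> *\<^sub>R z - y) \<partial>lborel)"
    unfolding conv_def using assms(3)
    by (subst integral_lborel_affine[where c = \<epsilon> and t = y]) (auto simp: moll_def)
  also have "(\<lambda>z. f (y + \<epsilon> *\<^sub>R z) * moll \<rho> \<epsilon> (y + \<epsilon> *\<^sub>R z - y)) = (\<lambda>z. inverse \<epsilon> ^ DIM('a) * (f (y + \<epsilon> *\<^sub>R z) * \<rho> z))"
    using assms(3) by (auto simp: moll_def)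
  finally show ?thesis using assms(3) by (simp add: field_simps)
qed

text \<open>Since \<open>\<rho>\<close> has integral 1, the difference of the mollification and f is
  the \<open>\<rho>\<close>-weighted average of the differences of f with its translates. Moving the
  absolute value inside and exchanging the integrals gives the bound.\<close>

lemma conv_moll_le:
  fixes f :: "'a::euclidean_space \<Rightarrow> real"
  assumes f: "integrable lborel f" and \<rho>: "integrable lborel \<rho>" "\<And>x. \<rho> x \<ge> 0" "(\<integral>x. \<rho> x \<partial>lborel) = 1" "\<And>x. \<rho> x \<le> B"
    and \<epsilon>: "\<epsilon> > 0"
  shows "(\<integral>\<^sup>+y. ennreal \<bar>conv (moll \<rho> \<epsilon>) f y - f y\<bar> \<partial>lborel) \<le> (\<integral>\<^sup>+z. ennreal (\<rho> z) * L1_shift f (\<epsilon> *\<^sub>R z) \<partial>lborel)"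
proof -
  have [measurable]: "f \<in> borel_measurable borel" "\<rho> \<in> borel_measurable borel" using f \<rho> by auto
  have 1: "ennreal \<bar>conv (moll \<rho> \<epsilon>) f y - f y\<bar> \<le> (\<integral>\<^sup>+z. ennreal (\<rho> z) * ennreal \<bar>f (y + \<epsilon> *\<^sub>R z) - f y\<bar> \<partial>lborel)" for y
  proof -
    have i: "integrable lborel (\<lambda>z. f (y + \<epsilon> *\<^sub>R z) * \<rho> z)"
      using \<epsilon> \<rho>(2,4) by (intro integrable_mult_bounded[where B = B] integrable_lborel_affine f) auto
    have "conv (moll \<rho> \<epsilon>) f y - f y = (\<integral>z. f (y + \<epsilon> *\<^sub>R z) * \<rho> z \<partial>lborel) - (\<integral>z. f y * \<rho> z \<partial>lborel)"
      using \<rho>(1,3) \<epsilon> by (simp add: conv_moll_eq)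
    also have "\<dots> = (\<integral>z. f (y + \<epsilon> *\<^sub>R z) * \<rho> z - f y * \<rho> z \<partial>lborel)"
      using i \<rho>(1) by simp
    finally have e: "conv (moll \<rho> \<epsilon>) f y - f y = (\<integral>z. f (y + \<epsilon> *\<^sub>R z) * \<rho> z - f y * \<rho> z \<partial>lborel)" .
    have "ennreal (norm (conv (moll \<rho> \<epsilon>) f y - f y)) \<le> (\<integral>\<^sup>+z. ennreal (norm (f (y + \<epsilon> *\<^sub>R z) * \<rho> z - f y * \<rho> z)) \<partial>lborel)"
      unfolding e using i \<rho>(1) by (intro integral_norm_bound_ennreal) simp
    also have "\<dots> = (\<integral>\<^sup>+z. ennreal (\<rho> z) * ennreal \<bar>f (y + \<epsilon> *\<^sub>R z) - f y\<bar> \<partial>lborel)"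
    proof (rule nn_integral_cong)
      fix z
      have "f (y + \<epsilon> *\<^sub>R z) * \<rho> z - f y * \<rho> z = \<rho> z * (f (y + \<epsilon> *\<^sub>R z) - f y)" by (simp add: algebra_simps)
      then show "ennreal (norm (f (y + \<epsilon> *\<^sub>R z) * \<rho> z - f y * \<rho> z)) = ennreal (\<rho> z) * ennreal \<bar>f (y + \<epsilon> *\<^sub>R z) - f y\<bar>"
        using \<rho>(2)[of z] by (simp add: abs_mult ennreal_mult del: right_diff_distrib)
    qed
    finally show ?thesis by simp
  qed
  have "(\<integral>\<^sup>+y. ennreal \<bar>conv (moll \<rho> \<epsilon>) f y - f y\<bar> \<partial>lborel)
     \<le> (\<integral>\<^sup>+y. (\<integral>\<^sup>+z. ennreal (\<rho> z) * ennreal \<bar>f (y + \<epsilon> *\<^sub>R z) - f y\<bar> \<partial>lborel) \<partial>lborel)"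
    by (intro nn_integral_mono 1)
  also have "\<dots> = (\<integral>\<^sup>+z. (\<integral>\<^sup>+y. ennreal (\<rho> z) * ennreal \<bar>f (y + \<epsilon> *\<^sub>R z) - f y\<bar> \<partial>lborel) \<partial>lborel)"
    by (rule lborel_pair.Fubini') measurable
  also have "\<dots> = (\<integral>\<^sup>+z. ennreal (\<rho> z) * L1_shift f (\<epsilon> *\<^sub>R z) \<partial>lborel)"
    by (simp add: nn_integral_cmult L1_shift_def)
  finally show ?thesis .
qed

lemma L1_shift_le:
  assumes "f \<in> borel_measurable borel"
  shows "L1_shift f w \<le> 2 * (\<integral>\<^sup>+x. ennreal \<bar>f x\<bar> \<partial>lborel)"
  using L1_shift_triangle[OF assms, of "\<lambda>_. 0" w] by (simp add: L1_shift_def)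

text \<open>This yields integrability of the difference directly from the translation estimate,
  which is the form that convergence in \<open>L^1\<close> needs.\<close>

lemma conv_moll_diff_finite:
  fixes f :: "'a::euclidean_space \<Rightarrow> real"
  assumes f: "integrable lborel f" and \<rho>: "integrable lborel \<rho>" "\<And>x. \<rho> x \<ge> 0" "(\<integral>x. \<rho> x \<partial>lborel) = 1" "\<And>x. \<rho> x \<le> B"
    and \<epsilon>: "\<epsilon> > 0"
  shows "(\<integral>\<^sup>+y. ennreal \<bar>conv (moll \<rho> \<epsilon>) f y - f y\<bar> \<partial>lborel) < \<infinity>"
proof -
  have [measurable]: "f \<in> borel_measurable borel" "\<rho> \<in> borel_measurable borel" using f \<rho> by auto
  have "(\<integral>\<^sup>+y. ennreal \<bar>conv (moll \<rho> \<epsilon>) f y - f y\<bar> \<partial>lborel) \<le> (\<integral>\<^sup>+z. ennreal (\<rho> z) * L1_shift f (\<epsilon> *\<^sub>R z) \<partial>lborel)"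
    by (rule conv_moll_le[OF assms])
  also have "\<dots> \<le> (\<integral>\<^sup>+z. ennreal (\<rho> z) * (2 * (\<integral>\<^sup>+x. ennreal \<bar>f x\<bar> \<partial>lborel)) \<partial>lborel)"
    by (intro nn_integral_mono mult_left_mono L1_shift_le) auto
  also have "\<dots> < \<infinity>"
    using f \<rho>(1,2) by (simp add: nn_integral_multc integrable_iff_bounded ennreal_mult_less_top)
  finally show ?thesis .
qed

text \<open>Dominated convergence in the variable z of \<open>conv_moll_le\<close>: each translate
  converges, and \<open>L1_shift\<close> never exceeds twice the \<open>L^1\<close> norm.\<close>

lemma conv_moll_L1:
  fixes f :: "'a::euclidean_space \<Rightarrow> real"
  assumes f: "integrable lborel f" and \<rho>: "integrable lborel \<rho>" "\<And>x. \<rho> x \<ge> 0" "(\<integral>x. \<rho> x \<partial>lborel) = 1" "\<And>x. \<rho> x \<le> B"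
    and \<epsilon>: "\<And>n. \<epsilon> n > 0" "\<epsilon> \<longlonglongrightarrow> 0"
  shows "(\<lambda>n. \<integral>\<^sup>+y. ennreal \<bar>conv (moll \<rho> (\<epsilon> n)) f y - f y\<bar> \<partial>lborel) \<longlonglongrightarrow> 0"
proof -
  have [measurable]: "f \<in> borel_measurable borel" "\<rho> \<in> borel_measurable borel" using f \<rho> by auto
  have "(\<integral>\<^sup>+y. ennreal \<bar>conv (moll \<rho> (\<epsilon> n)) f y - f y\<bar> \<partial>lborel) \<le> (\<integral>\<^sup>+z. ennreal (\<rho> z) * L1_shift f (\<epsilon> n *\<^sub>R z) \<partial>lborel)" for n
    by (rule conv_moll_le[OF f \<rho> \<epsilon>(1)])
  moreover have "(\<lambda>n. \<integral>\<^sup>+z. ennreal (\<rho> z) * L1_shift f (\<epsilon> n *\<^sub>R z) \<partial>lborel) \<longlonglongrightarrow> 0"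
  proof -
    have "(\<lambda>n. \<integral>\<^sup>+z. ennreal (\<rho> z) * L1_shift f (\<epsilon> n *\<^sub>R z) \<partial>lborel) \<longlonglongrightarrow> (\<integral>\<^sup>+z. 0 \<partial>(lborel :: 'a measure))"
    proof (rule nn_integral_dominated_convergence[where w = "\<lambda>z. ennreal (\<rho> z) * (2 * (\<integral>\<^sup>+x. ennreal \<bar>f x\<bar> \<partial>lborel))"])
      show "(\<integral>\<^sup>+z. ennreal (\<rho> z) * (2 * (\<integral>\<^sup>+x. ennreal \<bar>f x\<bar> \<partial>lborel)) \<partial>lborel) < \<infinity>"
        using f \<rho>(1,2) by (simp add: nn_integral_multc integrable_iff_bounded ennreal_mult_less_top)
      have "(\<lambda>n. ennreal (\<rho> z) * L1_shift f (\<epsilon> n *\<^sub>R z)) \<longlonglongrightarrow> 0" for z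
      proof -
        have "(\<lambda>n. \<epsilon> n *\<^sub>R z) \<longlonglongrightarrow> 0" using tendsto_scaleR[OF \<epsilon>(2) tendsto_const[of z]] by simp
        from ennreal_tendsto_cmult[OF _ L1_shift_tendsto_0[OF f this], of "ennreal (\<rho> z)"]
        show ?thesis by simp
      qed
      then show "AE z in lborel. (\<lambda>n. ennreal (\<rho> z) * L1_shift f (\<epsilon> n *\<^sub>R z)) \<longlonglongrightarrow> 0" by simp
      show "AE z in lborel. ennreal (\<rho> z) * L1_shift f (\<epsilon> n *\<^sub>R z) \<le> ennreal (\<rho> z) * (2 * (\<integral>\<^sup>+x. ennreal \<bar>f x\<bar> \<partial>lborel))" for n
        by (intro AE_I2 mult_left_mono L1_shift_le) auto
    qed (simp_all add: L1_shift_def)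
    then show ?thesis by simp
  qed
  ultimately show ?thesis by (rule ennreal_squeeze_0)
qed

section \<open>Gradients of convolutions and integrals of gradients\<close>

lemma GDERIV_continuous_on: "(\<And>x. GDERIV f x :> D x) \<Longrightarrow> continuous_on UNIV f"
  unfolding gderiv_def by (meson continuous_at_imp_continuous_on has_derivative_continuous)

text \<open>A kernel with Lipschitz gradient has a first-order Taylor remainder of at most
  \<open>L * |y' - y|^2\<close>, uniformly in the point. Integrated against f this is quadratic in
  \<open>y' - y\<close>, which gives differentiability of the convolution without a limit theorem
  for integrals.\<close>

lemma conv_GDERIV:
  fixes f :: "'a::euclidean_space \<Rightarrow> real"
  assumes f: "integrable lborel f" and K: "\<And>x. GDERIV K x :> K' x"
    and bd: "\<And>x. \<bar>K x\<bar> \<le> B" "\<And>x. norm (K' x) \<le> B"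
    and lip: "\<And>x y. norm (K' x - K' y) \<le> L * norm (x - y)" 
  shows "GDERIV (conv K f) y :> - (\<integral>x. f x *\<^sub>R K' (x - y) \<partial>lborel)"
proof -
  have L: "L \<ge> 0"
  proof -
    obtain b :: 'a where "b \<in> Basis" using nonempty_Basis by blast
    then have "0 \<le> L * 1" using order_trans[OF norm_ge_zero lip[of b 0]] by simp
    then show ?thesis by simp
  qed
  have "continuous_on UNIV K" by (rule GDERIV_continuous_on[OF K])
  then have mK[measurable]: "K \<in> borel_measurable borel" by (rule borel_measurable_continuous_onI)
  have "continuous_on UNIV K'"
    by (rule lipschitz_on_continuous_on[of L]) (use lip L in \<open>auto simp: lipschitz_on_def dist_norm\<close>)
  then have mK'[measurable]: "K' \<in> borel_measurable borel" by (rule borel_measurable_continuous_onI)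
  have [measurable]: "f \<in> borel_measurable borel" using f by simp
  have iK: "integrable lborel (\<lambda>x. f x * K (x - y))" for y
    using bd(1) by (intro integrable_mult_bounded[where B = B] f) auto
  have iK': "integrable lborel (\<lambda>x. f x *\<^sub>R K' (x - y))" for y
  proof (rule Bochner_Integration.integrable_bound)
    show "integrable lborel (\<lambda>x. B * f x)" using f by simp
    show "AE x in lborel. norm (f x *\<^sub>R K' (x - y)) \<le> norm (B * f x)"
    proof (rule AE_I2)
      fix x show "norm (f x *\<^sub>R K' (x - y)) \<le> norm (B * f x)"
        using mult_left_mono[OF bd(2)[of "x - y"], of "\<bar>f x\<bar>"] order_trans[OF norm_ge_zero bd(2)]
        by (simp add: abs_mult mult.commute)
    qed
  qed auto
  let ?I = "\<lambda>y. \<integral>x. f x *\<^sub>R K' (x - y) \<partial>lborel"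
  have est: "\<bar>K (x - y') - K (x - y) - (y' - y) \<bullet> (- K' (x - y))\<bar> \<le> L * (norm (y' - y))\<^sup>2" for x y'
  proof -
    have "norm (K (x - y') - K (x - y) - ((x - y') - (x - y)) \<bullet> K' (x - y)) \<le> norm ((x - y') - (x - y)) * (L * norm (y' - y))"
    proof (rule differentiable_bound_linearization[where S = "cball (x - y) (norm (y' - y))" and f' = "\<lambda>z h. h \<bullet> K' z"])
      fix t :: real assume "t \<in> {0..1}"
      then show "x - y + t *\<^sub>R (x - y' - (x - y)) \<in> cball (x - y) (norm (y' - y))"
        by (auto simp: dist_norm norm_minus_commute mult_left_le_one_le)
    next
      fix z
      show "(K has_derivative (\<lambda>h. h \<bullet> K' z)) (at z within cball (x - y) (norm (y' - y)))"
        using K by (simp add: gderiv_def has_derivative_at_withinI)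
    next
      fix z assume z: "z \<in> cball (x - y) (norm (y' - y))"
      show "onorm ((\<lambda>h. h \<bullet> K' z) - (\<lambda>h. h \<bullet> K' (x - y))) \<le> L * norm (y' - y)"
      proof (rule onorm_bound)
        show "0 \<le> L * norm (y' - y)" using L by simp
        fix h
        have "norm (h \<bullet> K' z - h \<bullet> K' (x - y)) \<le> norm h * norm (K' z - K' (x - y))"
          unfolding inner_diff_right[symmetric] using Cauchy_Schwarz_ineq2 by simp
        also have "\<dots> \<le> norm h * (L * norm (y' - y))"
          using z L order_trans[OF lip mult_left_mono[of "norm (z - (x - y))" "norm (y' - y)" L]]
          by (intro mult_left_mono) (auto simp: dist_norm norm_minus_commute)
        finally show "norm (((\<lambda>h. h \<bullet> K' z) - (\<lambda>h. h \<bullet> K' (x - y))) h) \<le> L * norm (y' - y) * norm h"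
          by (simp add: mult_ac)
      qed
    qed auto
    then show ?thesis by (simp add: power2_eq_square norm_minus_commute algebra_simps)
  qed
  show ?thesis
    unfolding gderiv_def
  proof (rule has_derivativeI_sandwich[where e = 1 and H = "\<lambda>y'. L * (\<integral>x. \<bar>f x\<bar> \<partial>lborel) * norm (y' - y)"])
    show "bounded_linear (\<lambda>h. h \<bullet> - ?I y)" by (rule bounded_linear_inner_left)
    show "((\<lambda>y'. L * (\<integral>x. \<bar>f x\<bar> \<partial>lborel) * norm (y' - y)) \<longlongrightarrow> 0) (at y)"
      by (auto intro!: tendsto_eq_intros)
    fix y' assume ne: "y' \<noteq> y"
    have eq: "conv K f y' - conv K f y - (y' - y) \<bullet> - ?I y
       = (\<integral>x. f x * (K (x - y') - K (x - y) - (y' - y) \<bullet> (- K' (x - y))) \<partial>lborel)"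
    proof -
      have 1: "(\<integral>x. f x * ((y' - y) \<bullet> K' (x - y)) \<partial>lborel) = (y' - y) \<bullet> ?I y"
        using integral_inner_right[OF iK'[of y], of "y' - y"] by simp
      have 2: "integrable lborel (\<lambda>x. f x * ((y' - y) \<bullet> K' (x - y)))"
        using integrable_inner_right[OF iK'[of y], of "y' - y"] by simp
      show ?thesis
        unfolding conv_def
        using 1 2 iK by (simp add: right_diff_distrib inner_minus_right distrib_left del: integral_inner_right)
    qed
    have "norm (conv K f y' - conv K f y - (y' - y) \<bullet> - ?I y)
       \<le> (\<integral>x. norm (f x * (K (x - y') - K (x - y) - (y' - y) \<bullet> (- K' (x - y)))) \<partial>lborel)"
      unfolding eq by (rule integral_norm_bound)
    also have "\<dots> \<le> (\<integral>x. \<bar>f x\<bar> * (L * (norm (y' - y))\<^sup>2) \<partial>lborel)"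
    proof (rule integral_mono')
      show "integrable lborel (\<lambda>x. \<bar>f x\<bar> * (L * (norm (y' - y))\<^sup>2))" using f by simp
      show "norm (f x * (K (x - y') - K (x - y) - (y' - y) \<bullet> - K' (x - y))) \<le> \<bar>f x\<bar> * (L * (norm (y' - y))\<^sup>2)" for x
        using mult_left_mono[OF est[where x = x and y' = y'], of "\<bar>f x\<bar>"] by (simp add: abs_mult)
      show "0 \<le> \<bar>f x\<bar> * (L * (norm (y' - y))\<^sup>2)" for x using L by simp
    qed
    also have "\<dots> = L * (\<integral>x. \<bar>f x\<bar> \<partial>lborel) * norm (y' - y) * norm (y' - y)"
      by (simp add: power2_eq_square)
    finally show "norm (conv K f y' - conv K f y - (y' - y) \<bullet> - ?I y) / norm (y' - y) \<le> L * (\<integral>x. \<bar>f x\<bar> \<partial>lborel) * norm (y' - y)"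
      using ne by (simp add: field_simps)
  qed simp
qed

lemma GDERIV_bounded_imp_lipschitz:
  fixes F :: "'a::real_inner \<Rightarrow> real"
  assumes F: "\<And>x. GDERIV F x :> G x" and B: "\<And>x. norm (G x) \<le> B"
  shows "\<bar>F x - F y\<bar> \<le> B * norm (x - y)"
  unfolding real_norm_def[symmetric]
proof (rule differentiable_bound[where S = UNIV and f' = "\<lambda>x h. h \<bullet> G x"])
  show "(F has_derivative (\<lambda>h. h \<bullet> G x)) (at x within UNIV)" for x using F by (simp add: gderiv_def)
  show "onorm (\<lambda>h. h \<bullet> G x) \<le> B" for x
  proof (rule onorm_bound)
    show "norm (h \<bullet> G x) \<le> B * norm h" for h
      using order_trans[OF Cauchy_Schwarz_ineq2[of h "G x"] mult_left_mono[OF B[of x], of "norm h"]]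
      by (simp add: mult.commute)
  qed (use order_trans[OF norm_ge_zero B] in auto)
qed auto

lemma Cc_infinity_lipschitz:
  fixes f :: "real ^ 'n::finite \<Rightarrow> real"
  assumes "f \<in> Cc_infinity"
  shows "\<exists>L\<ge>0. (\<forall>x y. \<bar>f x - f y\<bar> \<le> L * norm (x - y)) \<and> (\<forall>x. norm (gradient f x) \<le> L)"
proof -
  have "\<exists>B. B \<ge> 0 \<and> (\<forall>x. \<bar>partial_deriv i f x\<bar> \<le> B)" for i
    using Cc_infinity_bounded[OF Cc_infinity_partial_deriv[OF assms, of i]] by (metis real_norm_def)
  then obtain B where B: "\<And>i. B i \<ge> 0" "\<And>i x. \<bar>partial_deriv i f x\<bar> \<le> B i" by metis
  have g: "norm (gradient f x) \<le> sum B UNIV" for x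
    using B by (intro order_trans[OF norm_le_l1_cart] sum_mono) (auto simp: gradient_def)
  have "\<bar>f x - f y\<bar> \<le> sum B UNIV * norm (x - y)" for x y
    by (rule GDERIV_bounded_imp_lipschitz[OF Cc_infinity_GDERIV[OF assms] g])
  moreover have "sum B UNIV \<ge> 0" using B(1) by (intro sum_nonneg) auto
  ultimately show ?thesis using g by (intro exI[of _ "sum B UNIV"]) auto
qed

lemma conv_Cc_GDERIV:
  fixes f :: "real ^ 'n::finite \<Rightarrow> real"
  assumes f: "integrable lborel f" and K: "K \<in> Cc_infinity"
  shows "GDERIV (conv K f) y :> - (\<chi> i. conv (partial_deriv i K) f y)"
proof -
  obtain B where B: "B \<ge> 0" "\<And>x. norm (K x) \<le> B" using Cc_infinity_bounded[OF K] by blast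
  obtain L where L: "L \<ge> 0" "\<And>x. norm (gradient K x) \<le> L" using Cc_infinity_lipschitz[OF K] by blast
  have "\<exists>L. \<forall>x y. \<bar>partial_deriv i K x - partial_deriv i K y\<bar> \<le> L * norm (x - y)" for i
    using Cc_infinity_lipschitz[OF Cc_infinity_partial_deriv[OF K, of i]] by blast
  then obtain M where M: "\<And>i x y. \<bar>partial_deriv i K x - partial_deriv i K y\<bar> \<le> M i * norm (x - y)" by metis
  have lip: "norm (gradient K x - gradient K y) \<le> sum M UNIV * norm (x - y)" for x y
    unfolding sum_distrib_right
    using M by (intro order_trans[OF norm_le_l1_cart] sum_mono) (auto simp: gradient_def)
  have g: "GDERIV (conv K f) y :> - (\<integral>x. f x *\<^sub>R gradient K (x - y) \<partial>lborel)"
    using B L lip by (intro conv_GDERIV[where B = "max B L" and L = "sum M UNIV"] f Cc_infinity_GDERIV K)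
      (auto simp: le_max_iff_disj)
  have mg: "gradient K \<in> borel_measurable borel"
    using Cc_infinity_cont[OF Cc_infinity_partial_deriv[OF K]]
    unfolding gradient_def[abs_def] by (intro borel_measurable_continuous_onI continuous_on_vec_lambda)
  have "integrable lborel (\<lambda>x. f x *\<^sub>R gradient K (x - y))"
  proof (rule Bochner_Integration.integrable_bound)
    show "integrable lborel (\<lambda>x. L * f x)" using f by simp
    show "AE x in lborel. norm (f x *\<^sub>R gradient K (x - y)) \<le> norm (L * f x)"
    proof (rule AE_I2)
      fix x show "norm (f x *\<^sub>R gradient K (x - y)) \<le> norm (L * f x)"
        using mult_left_mono[OF L(2)[of "x - y"], of "\<bar>f x\<bar>"] L(1) by (simp add: abs_mult mult.commute)
    qed
  qed (use f mg in auto)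
  from integral_bounded_linear[OF bounded_linear_vec_nth this]
  have "(\<integral>x. f x *\<^sub>R gradient K (x - y) \<partial>lborel) = (\<chi> i. conv (partial_deriv i K) f y)"
    by (simp add: vec_eq_iff conv_def gradient_def)
  with g show ?thesis by simp
qed

lemma continuous_on_conv_Cc:
  fixes f :: "real ^ 'n::finite \<Rightarrow> real"
  assumes "integrable lborel f" "K \<in> Cc_infinity"
  shows "continuous_on UNIV (conv K f)"
  by (rule GDERIV_continuous_on[OF conv_Cc_GDERIV[OF assms]])

lemma GDERIV_cong_open:
  assumes "GDERIV f x :> D" "open S" "x \<in> S" "\<And>y. y \<in> S \<Longrightarrow> f y = g y"
  shows "GDERIV g x :> D"
  using assms unfolding gderiv_def by (rule has_derivative_transform_within_open)

text \<open>By translation invariance the difference quotients of \<open>F\<close> have integral 0.\<close>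

lemma integral_gradient_eq_0:
  fixes F :: "'a::euclidean_space \<Rightarrow> real"
  assumes F: "\<And>x. GDERIV F x :> G x" and G: "continuous_on UNIV G" and R: "\<And>x. norm x \<ge> R \<Longrightarrow> F x = 0"
  shows "integrable lborel (\<lambda>x. G x \<bullet> b)" "(\<integral>x. G x \<bullet> b \<partial>lborel) = 0"
proof -
  \<comment> \<open>Vanishing of F passes to its gradient only on open sets, so the gradient is
    claimed to vanish from a slightly larger radius on.\<close>
  define R' where "R' = \<bar>R\<bar> + 1"
  have G0: "G x = 0" if "norm x \<ge> R'" for x
  proof -
    have "GDERIV F x :> 0"
      by (rule GDERIV_cong_open[OF GDERIV_const[of 0], of "- cball 0 R"]) (use that R in \<open>auto simp: R'_def\<close>)
    then have "(\<lambda>h. h \<bullet> G x) = (\<lambda>h. h \<bullet> 0)"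
      using F[of x] unfolding gderiv_def by (rule has_derivative_unique[rotated])
    then have "G x \<bullet> G x = 0" by (metis inner_zero_right)
    then show ?thesis by simp
  qed
  have "compact (G ` cball 0 R')" using G by (intro compact_continuous_image) (auto intro: continuous_on_subset)
  then obtain B where B: "B > 0" "\<And>x. x \<in> cball 0 R' \<Longrightarrow> norm (G x) \<le> B"
    by (auto simp: bounded_pos dest!: compact_imp_bounded)
  have GB: "norm (G x) \<le> B" for x using B(2)[of x] G0[of x] B(1) by (cases "norm x \<ge> R'") auto
  have lip: "\<bar>F x - F y\<bar> \<le> B * norm (x - y)" for x y
    by (rule GDERIV_bounded_imp_lipschitz[OF F GB])
  have "continuous_on UNIV F" by (rule GDERIV_continuous_on[OF F])
  then have [measurable]: "F \<in> borel_measurable borel" by (rule borel_measurable_continuous_onI)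
  have [measurable]: "G \<in> borel_measurable borel" using G by (rule borel_measurable_continuous_onI)
  have "F x = indicator (cball 0 R') x *\<^sub>R F x" for x using R by (auto simp: indicator_def R'_def)
  then have iF: "integrable lborel F"
    using borel_integrable_compact[of "cball 0 R'" F] \<open>continuous_on UNIV F\<close>
    by (metis (no_types, lifting) compact_cball continuous_on_subset ext subset_UNIV)
  define s where "s n x = (F (x + inverse (Suc n) *\<^sub>R b) - F x) / inverse (Suc n)" for n x
  \<comment> \<open>All steps \<open>inverse (Suc n) *\<^sub>R b\<close> are at most as long as b,
    so the difference quotients vanish outside the ball enlarged by \<open>norm b\<close>; inside,
    they are controlled by the Lipschitz constant of F.\<close>
  define w where "w x = B * norm b * indicator (cball 0 (R' + norm b)) x" for x :: 'a
  have w: "integrable lborel w"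
    unfolding w_def by (intro integrable_mult_right integrable_real_indicator) (use emeasure_lborel_cball_finite in auto)
  have [measurable]: "s n \<in> borel_measurable borel" for n unfolding s_def by measurable
  have conv: "(\<lambda>n. s n x) \<longlonglongrightarrow> G x \<bullet> b" for x
  proof -
    have "((\<lambda>t. F (x + t *\<^sub>R b)) has_real_derivative b \<bullet> G x) (at 0)"
    proof -
      have "((\<lambda>t. x + t *\<^sub>R b) has_derivative (\<lambda>t. t *\<^sub>R b)) (at 0)" by (auto intro!: derivative_eq_intros)
      moreover have "(F has_derivative (\<lambda>h. h \<bullet> G x)) (at (x + 0 *\<^sub>R b))" using F by (simp add: gderiv_def)
      ultimately have "((\<lambda>t. F (x + t *\<^sub>R b)) has_derivative (\<lambda>t. (t *\<^sub>R b) \<bullet> G x)) (at 0)"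
        by (rule has_derivative_compose)
      then show ?thesis unfolding has_field_derivative_def by (rule has_derivative_eq_rhs) auto
    qed
    then have "((\<lambda>t. (F (x + t *\<^sub>R b) - F x) / t) \<longlongrightarrow> b \<bullet> G x) (at 0)"
      by (simp add: has_field_derivative_iff)
    moreover have "filterlim (\<lambda>n. inverse (real (Suc n))) (at 0) sequentially"
      unfolding filterlim_at using LIMSEQ_inverse_real_of_nat by auto
    ultimately have "(\<lambda>n. s n x) \<longlonglongrightarrow> b \<bullet> G x"
      unfolding s_def by (rule filterlim_compose)
    then show ?thesis by (simp add: inner_commute)
  qed
  have bound: "norm (s n x) \<le> w x" for n x
  proof (cases "x \<in> cball 0 (R' + norm b)")
    case True
    have "\<bar>s n x\<bar> \<le> B * norm (inverse (Suc n) *\<^sub>R b) / inverse (Suc n)"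
      using lip[of "x + inverse (Suc n) *\<^sub>R b" x] unfolding s_def abs_divide by (subst pos_divide_le_eq) (auto simp: mult_ac)
    then show ?thesis using True by (simp add: w_def)
  next
    case False
    have "norm (inverse (Suc n) *\<^sub>R b) \<le> norm b" by (simp add: field_simps)
    then have "norm (x + inverse (Suc n) *\<^sub>R b) \<ge> R'"
      using False norm_triangle_ineq4[of "x + inverse (Suc n) *\<^sub>R b" "inverse (Suc n) *\<^sub>R b"] by simp
    moreover have "norm x \<ge> R'" using False norm_ge_zero[of b] by (simp del: norm_ge_zero)
    ultimately have "F (x + inverse (Suc n) *\<^sub>R b) = 0" "F x = 0"
      by (auto intro!: R simp: R'_def)
    then show ?thesis using False by (simp add: s_def w_def)
  qed
  have s_int: "(\<integral>x. s n x \<partial>lborel) = 0" for n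
  proof -
    have "(\<integral>x. F (x + inverse (Suc n) *\<^sub>R b) \<partial>lborel) = (\<integral>x. F x \<partial>lborel)"
      using integral_lborel_affine[of F 1 "inverse (Suc n) *\<^sub>R b"] by (simp add: add.commute)
    moreover have "integrable lborel (\<lambda>x. F (x + inverse (Suc n) *\<^sub>R b))"
      using integrable_lborel_affine[OF iF, of 1 "inverse (Suc n) *\<^sub>R b"] by (simp add: add.commute)
    ultimately show ?thesis using iF by (simp add: s_def)
  qed
  show "integrable lborel (\<lambda>x. G x \<bullet> b)"
    by (rule integrable_dominated_convergence[where s = s and w = w]) (use conv bound w in auto)
  have "(\<lambda>n. \<integral>x. s n x \<partial>lborel) \<longlonglongrightarrow> (\<integral>x. G x \<bullet> b \<partial>lborel)"
    by (rule integral_dominated_convergence[where w = w]) (use conv bound w in auto)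
  then show "(\<integral>x. G x \<bullet> b \<partial>lborel) = 0"
    unfolding s_int using LIMSEQ_unique tendsto_const by blast
qed

section \<open>Weak gradients and the distributional equation\<close>

lemma integrable_lborel_compact_support:
  fixes f :: "'a::euclidean_space \<Rightarrow> 'b::{banach, second_countable_topology}"
  assumes "continuous_on UNIV f" "\<And>x. norm x > R \<Longrightarrow> f x = 0"
  shows "integrable lborel f"
proof -
  have "integrable lborel (\<lambda>x. indicator (cball 0 R) x *\<^sub>R f x)"
    by (rule borel_integrable_compact) (auto intro: continuous_on_subset assms(1))
  moreover have "(\<lambda>x. indicator (cball 0 R) x *\<^sub>R f x) = f"
    using assms(2) by (auto simp: fun_eq_iff indicator_def)
  ultimately show ?thesis by simp
qed

section \<open>Lebesgue measurable functions and Borel representatives\<close>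

lemma integrable_lebesgue_lborel:
  fixes f :: "'a::euclidean_space \<Rightarrow> 'b::{banach, second_countable_topology}"
  shows "integrable lborel f \<Longrightarrow> integrable lebesgue f"
  by (simp add: integrable_completion)

lemma continuous_imp_lebesgue_measurable:
  fixes f :: "'a::euclidean_space \<Rightarrow> 'b::topological_space"
  shows "continuous_on UNIV f \<Longrightarrow> f \<in> borel_measurable lebesgue"
  by (intro measurable_completion) (simp add: borel_measurable_continuous_onI)

lemma integral_lebesgue_borel_cong:
  fixes f f' :: "'a::euclidean_space \<Rightarrow> real"
  assumes "integrable lebesgue f" "integrable lborel f'" "AE x in lebesgue. f x = f' x"
    and [measurable]: "K \<in> borel_measurable borel"
  shows "(\<integral>x. f x * K x \<partial>lebesgue) = (\<integral>x. f' x * K x \<partial>lborel)"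
proof -
  have [measurable]: "f' \<in> borel_measurable borel" using assms by simp
  have [measurable]: "K \<in> borel_measurable lebesgue" by (intro measurable_completion) simp
  have [measurable]: "f' \<in> borel_measurable lebesgue" by (intro measurable_completion) simp
  have [measurable]: "f \<in> borel_measurable lebesgue" using assms by simp
  have "(\<integral>x. f x * K x \<partial>lebesgue) = (\<integral>x. f' x * K x \<partial>lebesgue)"
    by (rule integral_cong_AE) (use assms(3) in auto)
  also have "\<dots> = (\<integral>x. f' x * K x \<partial>lborel)" by (rule integral_completion) simp
  finally show ?thesis .
qed

text \<open>The given functions are only Lebesgue measurable, while the convolution and Fubini
  arguments run over \<open>lborel\<close>. They are therefore replaced by Borel functions equal to
  them almost everywhere, and \<open>integral_lebesgue_borel_cong\<close> translates the
  integrals.\<close>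

lemma lebesgue_borel_rep:
  fixes f :: "'a::euclidean_space \<Rightarrow> real"
  assumes "integrable lebesgue f"
  obtains f' where "integrable lborel f'" "AE x in lebesgue. f x = f' x"
proof -
  obtain f' where f': "f' \<in> borel_measurable lborel" "AE x in lborel. f x = f' x"
    using completion_ex_borel_measurable_real[of f lborel] assms by auto
  have ae: "AE x in lebesgue. f x = f' x" using f'(2) by (rule AE_completion)
  have "integrable lebesgue f'"
    by (rule integrable_cong_AE_imp[OF assms _ ae]) (intro measurable_completion f'(1))
  then show ?thesis using that[of f'] ae f'(1) by (simp add: integrable_completion)
qed

lemma locally_integrable_cball:
  "locally_integrable f \<Longrightarrow> integrable lebesgue (\<lambda>x. indicator (cball a r) x *\<^sub>R f x)"
  by (simp add: locally_integrable_def set_integrable_def)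

lemma locally_integrable_measurable:
  assumes "locally_integrable f" shows "f \<in> borel_measurable lebesgue"
proof (rule borel_measurable_LIMSEQ_metric)
  show "(\<lambda>x. indicator (cball 0 (real n)) x *\<^sub>R f x) \<in> borel_measurable lebesgue" for n
    using locally_integrable_cball[OF assms] by (rule borel_measurable_integrable)
  fix x
  have "\<forall>\<^sub>F n in sequentially. f x = indicator (cball 0 (real n)) x *\<^sub>R f x"
    using eventually_ge_at_top[of "nat \<lceil>norm x\<rceil>"] by eventually_elim (auto simp: indicator_def nat_le_iff ceiling_le_iff)
  then show "(\<lambda>n. indicator (cball 0 (real n)) x *\<^sub>R f x) \<longlonglongrightarrow> f x"
    by (rule Lim_transform_eventually[OF tendsto_const])
qed

lemma locally_integrable_scaleR_Cc:
  fixes g :: "real ^ 'n::finite \<Rightarrow> 'b::euclidean_space"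
  assumes "locally_integrable g" "\<eta> \<in> Cc_infinity"
  shows "integrable lebesgue (\<lambda>x. (\<eta> x :: real) *\<^sub>R g x)"
proof -
  obtain B where B: "B \<ge> 0" "\<And>x. norm (\<eta> x) \<le> B" using Cc_infinity_bounded[OF assms(2)] by blast
  obtain R where R: "\<And>x. norm x > R \<Longrightarrow> \<eta> x = 0" using assms(2) by (auto simp: Cc_infinity_iff)
  let ?g = "\<lambda>x. indicator (cball 0 R) x *\<^sub>R g x"
  have g: "integrable lebesgue ?g" by (rule locally_integrable_cball[OF assms(1)])
  have [measurable]: "\<eta> \<in> borel_measurable lebesgue"
    by (intro continuous_imp_lebesgue_measurable Cc_infinity_cont assms)
  have "integrable lebesgue (\<lambda>x. \<eta> x *\<^sub>R ?g x)"
  proof (rule Bochner_Integration.integrable_bound)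
    show "integrable lebesgue (\<lambda>x. B *\<^sub>R ?g x)" by (intro integrable_scaleR_right g)
    show "AE x in lebesgue. norm (\<eta> x *\<^sub>R ?g x) \<le> norm (B *\<^sub>R ?g x)"
      unfolding norm_scaleR using B by (intro AE_I2 mult_right_mono) auto
  qed (intro borel_measurable_scaleR borel_measurable_integrable[OF g], auto)
  moreover have "(\<lambda>x. \<eta> x *\<^sub>R ?g x) = (\<lambda>x. \<eta> x *\<^sub>R g x)"
  proof
    show "\<eta> x *\<^sub>R ?g x = \<eta> x *\<^sub>R g x" for x by (cases "norm x > R") (auto simp: R)
  qed
  ultimately show ?thesis by simp
qed

lemma moll_Cc:
  fixes \<rho> :: "real ^ 'n::finite \<Rightarrow> real"
  assumes "\<rho> \<in> Cc_infinity" "\<epsilon> > 0"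
  shows "moll \<rho> \<epsilon> \<in> Cc_infinity" "(\<lambda>x. moll \<rho> \<epsilon> (x - y)) \<in> Cc_infinity"
proof -
  have *: "moll \<rho> \<epsilon> (x - y) = (inverse \<epsilon> ^ CARD('n)) *\<^sub>R \<rho> (- (inverse \<epsilon> *\<^sub>R y) + inverse \<epsilon> *\<^sub>R x)" for x y :: "real ^ 'n"
    by (simp add: moll_def algebra_simps)
  show "(\<lambda>x. moll \<rho> \<epsilon> (x - y)) \<in> Cc_infinity" for y
    unfolding * using assms by (intro Cc_infinity_affine) auto
  from this[of 0] show "moll \<rho> \<epsilon> \<in> Cc_infinity" by simp
qed

lemma moll_eq_0:
  assumes "\<And>x. norm x \<ge> 1 \<Longrightarrow> \<rho> x = 0" "\<epsilon> > 0" "norm z \<ge> \<epsilon>"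
  shows "moll \<rho> \<epsilon> z = 0"
  using assms by (simp add: moll_def field_simps)

text \<open>Mollifications of g are integrals of g against test functions, so they vanish. As they
  converge to g in \<open>L^1\<close> after truncation to a ball, g itself vanishes on every
  ball.\<close>

lemma fundamental_lemma_weak:
  fixes g :: "real ^ 'n::finite \<Rightarrow> real"
  assumes g: "locally_integrable g"
    and 0: "\<And>\<eta>. \<eta> \<in> Cc_infinity \<Longrightarrow> (\<integral>x. \<eta> x * g x \<partial>lebesgue) = 0"
  shows "AE x in lebesgue. g x = 0"
proof -
  obtain \<rho> :: "real ^ 'n \<Rightarrow> real" and s where \<rho>: "\<rho> \<in> Cc_infinity" "\<And>x. \<rho> x \<ge> 0" "\<And>x. norm x \<ge> 1 \<Longrightarrow> \<rho> x = 0"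
    "integrable lborel \<rho>" "(\<integral>x. \<rho> x \<partial>lborel) = 1"
    by (rule exists_mollifier) blast
  obtain B where B: "\<And>x. norm (\<rho> x) \<le> B" using Cc_infinity_bounded[OF \<rho>(1)] by blast
  have "AE x in lebesgue. x \<in> ball 0 (real k) \<longrightarrow> g x = 0" for k
  proof -
    \<comment> \<open>The margin 1 is the largest mollification radius: seen from a point of the
      ball of radius k, truncated and original function have the same mollification.\<close>
    let ?h = "\<lambda>x. indicator (cball 0 (real k + 1)) x * g x"
    have ih: "integrable lebesgue ?h" using locally_integrable_cball[OF g] by simp
    obtain h where h: "integrable lborel h" "AE x in lebesgue. ?h x = h x"
      using lebesgue_borel_rep[OF ih] by blast
    have [measurable]: "h \<in> borel_measurable borel" using h by simp
    define \<epsilon> where "\<epsilon> n = inverse (real (Suc n))" for n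
    have \<epsilon>: "\<epsilon> n > 0" "\<epsilon> n \<le> 1" for n by (auto simp: \<epsilon>_def field_simps)
    have L: "(\<lambda>n. \<integral>\<^sup>+y. ennreal \<bar>conv (moll \<rho> (\<epsilon> n)) h y - h y\<bar> \<partial>lborel) \<longlonglongrightarrow> 0"
    proof (rule conv_moll_L1[OF h(1) \<rho>(4,2,5)])
      show "\<rho> x \<le> B" for x using B[of x] by simp
      show "\<epsilon> \<longlonglongrightarrow> 0" unfolding \<epsilon>_def by (rule LIMSEQ_inverse_real_of_nat)
    qed (rule \<epsilon>)
    have c0: "conv (moll \<rho> (\<epsilon> n)) h y = 0" if "y \<in> ball 0 (real k)" for n y
    proof -
      have "conv (moll \<rho> (\<epsilon> n)) h y = (\<integral>x. ?h x * moll \<rho> (\<epsilon> n) (x - y) \<partial>lebesgue)"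
        unfolding conv_def using Cc_infinity_cont[OF moll_Cc(2)[OF \<rho>(1) \<epsilon>(1)]]
        by (intro integral_lebesgue_borel_cong[symmetric] ih h borel_measurable_continuous_onI)
      also have "\<dots> = (\<integral>x. moll \<rho> (\<epsilon> n) (x - y) * g x \<partial>lebesgue)"
      proof (rule Bochner_Integration.integral_cong)
        fix x
        show "?h x * moll \<rho> (\<epsilon> n) (x - y) = moll \<rho> (\<epsilon> n) (x - y) * g x"
        proof (cases "norm (x - y) \<ge> \<epsilon> n")
          case True then show ?thesis using moll_eq_0[of \<rho> "\<epsilon> n" "x - y"] \<rho>(3) \<epsilon>(1)[of n] by simp
        next
          case False
          then have "norm x \<le> k + 1" using that norm_triangle_sub[of x y] \<epsilon>(2)[of n] by simp
          then show ?thesis by simp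
        qed
      qed simp
      also have "\<dots> = 0" by (intro 0 moll_Cc \<rho>(1) \<epsilon>)
      finally show ?thesis .
    qed
    have "(\<integral>\<^sup>+y. indicator (ball 0 (real k)) y * ennreal \<bar>h y\<bar> \<partial>lborel) \<le> (\<integral>\<^sup>+y. ennreal \<bar>conv (moll \<rho> (\<epsilon> n)) h y - h y\<bar> \<partial>lborel)" for n
      by (intro nn_integral_mono) (auto simp: indicator_def c0)
    then have "(\<integral>\<^sup>+y. indicator (ball 0 (real k)) y * ennreal \<bar>h y\<bar> \<partial>lborel) \<le> 0"
      by (intro LIMSEQ_le_const[OF L]) auto
    moreover have m: "(\<lambda>y. indicator (ball 0 (real k)) y * ennreal \<bar>h y\<bar>) \<in> borel_measurable lborel"
      by (intro borel_measurable_times_ennreal borel_measurable_indicator) simp_all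
    ultimately have "AE y in lborel. indicator (ball 0 (real k)) y * ennreal \<bar>h y\<bar> = 0"
      using nn_integral_0_iff_AE[OF m] by simp
    from AE_completion[OF this] h(2) show ?thesis
      by eventually_elim (auto simp: indicator_def split: if_splits)
  qed
  then have "AE x in lebesgue. \<forall>k. x \<in> ball 0 (real k) \<longrightarrow> g x = 0" by (subst AE_all_countable) blast
  then show ?thesis
    by eventually_elim (metis dist_0_norm mem_ball reals_Archimedean2)
qed

lemma locally_integrable_bounded_linear:
  assumes "locally_integrable g" "bounded_linear T"
  shows "locally_integrable (\<lambda>x. T (g x))"
  unfolding locally_integrable_def set_integrable_def
proof (intro allI impI)
  interpret bounded_linear T by fact
  fix K :: "(real ^ 'a) set" assume "compact K"
  then have "integrable lebesgue (\<lambda>x. indicator K x *\<^sub>R g x)"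
    using assms by (simp add: locally_integrable_def set_integrable_def)
  from integrable_bounded_linear[OF assms(2) this]
  show "integrable lebesgue (\<lambda>x. indicat_real K x *\<^sub>R T (g x))" by (simp add: scaleR)
qed

text \<open>\<open>weak_grad\<close> is an arbitrary choice. Uniqueness up to null sets is what
  identifies it with the classical gradient for a test function. The scalar lemma above is applied
  to each real component.\<close>

lemma weak_gradient_unique:
  fixes f :: "real ^ 'n::finite \<Rightarrow> 'b::euclidean_space"
  assumes g: "is_weak_gradient f g" and h: "is_weak_gradient f h"
  shows "AE x in lebesgue. g x = h x"
proof -
  have "AE x in lebesgue. (g x $ i - h x $ i) \<bullet> b = 0" for i b
  proof (rule fundamental_lemma_weak)
    have bl: "bounded_linear (\<lambda>v :: 'b ^ 'n. v $ i \<bullet> b)"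
      using bounded_linear_compose[OF bounded_linear_inner_left bounded_linear_vec_nth] .
    have li: "locally_integrable (\<lambda>x. g x $ i \<bullet> b)" "locally_integrable (\<lambda>x. h x $ i \<bullet> b)"
      using g h by (auto simp: is_weak_gradient_def intro: locally_integrable_bounded_linear[OF _ bl])
    show "locally_integrable (\<lambda>x. (g x $ i - h x $ i) \<bullet> b)"
      using li unfolding locally_integrable_def set_integrable_def
      by (auto simp: inner_diff_left right_diff_distrib)
    fix \<eta> :: "real ^ 'n \<Rightarrow> real" assume \<eta>: "\<eta> \<in> Cc_infinity"
    have i: "integrable lebesgue (\<lambda>x. \<eta> x *\<^sub>R (g x $ i))" "integrable lebesgue (\<lambda>x. \<eta> x *\<^sub>R (h x $ i))"
      using g h by (auto simp: is_weak_gradient_def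
        intro!: locally_integrable_scaleR_Cc \<eta> locally_integrable_bounded_linear[OF _ bounded_linear_vec_nth])
    have "(\<integral>x. \<eta> x *\<^sub>R (g x $ i) \<partial>lebesgue) = (\<integral>x. \<eta> x *\<^sub>R (h x $ i) \<partial>lebesgue)"
    proof -
      have "(\<integral>x. partial_deriv i \<eta> x *\<^sub>R f x \<partial>lebesgue) = - (\<integral>x. \<eta> x *\<^sub>R (g x $ i) \<partial>lebesgue)"
        "(\<integral>x. partial_deriv i \<eta> x *\<^sub>R f x \<partial>lebesgue) = - (\<integral>x. \<eta> x *\<^sub>R (h x $ i) \<partial>lebesgue)"
        using g h \<eta> unfolding is_weak_gradient_def by blast+
      then show ?thesis by simp
    qed
    then have "(\<integral>x. \<eta> x *\<^sub>R (g x $ i) - \<eta> x *\<^sub>R (h x $ i) \<partial>lebesgue) \<bullet> b = 0"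
      using i by simp
    then have "(\<integral>x. (\<eta> x *\<^sub>R (g x $ i) - \<eta> x *\<^sub>R (h x $ i)) \<bullet> b \<partial>lebesgue) = 0"
      using i by (subst integral_inner_left) auto
    then show "(\<integral>x. \<eta> x * ((g x $ i - h x $ i) \<bullet> b) \<partial>lebesgue) = 0"
      by (simp add: inner_diff_left right_diff_distrib)
  qed
  then have "AE x in lebesgue. \<forall>i. \<forall>b\<in>Basis. (g x $ i - h x $ i) \<bullet> b = 0"
    by (subst AE_all_countable) (auto intro!: AE_finite_allI)
  then show ?thesis
    by eventually_elim (simp add: vec_eq_iff euclidean_eq_iff[where 'a = 'b] inner_diff_left)
qed

text \<open>The product \<open>\<eta> K\<close> has compact support, so its derivative in each
  direction has integral 0.\<close>

lemma Cc_integral_by_parts: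
  fixes \<eta> K :: "real ^ 'n::finite \<Rightarrow> real"
  assumes \<eta>: "\<eta> \<in> Cc_infinity" and K: "K \<in> Cc_infinity"
  shows "(\<integral>x. partial_deriv i \<eta> x * K x \<partial>lebesgue) = - (\<integral>x. \<eta> x * partial_deriv i K x \<partial>lebesgue)"
proof -
  note c = Cc_infinity_cont[OF \<eta>] Cc_infinity_cont[OF K]
    Cc_infinity_cont[OF Cc_infinity_partial_deriv[OF \<eta>]] Cc_infinity_cont[OF Cc_infinity_partial_deriv[OF K]]
  obtain R where R: "\<And>x. norm x > R \<Longrightarrow> \<eta> x = 0" using \<eta> by (auto simp: Cc_infinity_iff)
  obtain R' where R': "\<And>x. norm x > R' \<Longrightarrow> partial_deriv i \<eta> x = 0"
    using Cc_infinity_partial_deriv[OF \<eta>, of i] unfolding Cc_infinity_iff by blast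
  let ?G = "\<lambda>x. \<eta> x *\<^sub>R gradient K x + K x *\<^sub>R gradient \<eta> x"
  have "(\<integral>x. ?G x \<bullet> axis i 1 \<partial>lborel) = 0"
  proof (rule integral_gradient_eq_0[where R = "\<bar>R\<bar> + 1"])
    show "GDERIV (\<lambda>x. \<eta> x * K x) x :> ?G x" for x
      by (intro GDERIV_mult Cc_infinity_GDERIV \<eta> K)
    show "continuous_on UNIV ?G"
      unfolding gradient_def by (intro continuous_intros continuous_on_vec_lambda c)
  qed (use R in auto)
  moreover have "?G x \<bullet> axis i 1 = \<eta> x * partial_deriv i K x + partial_deriv i \<eta> x * K x" for x
    by (simp add: inner_axis gradient_def)
  moreover have i1: "integrable lborel (\<lambda>x. \<eta> x * partial_deriv i K x)"
    by (rule integrable_lborel_compact_support[where R = R]) (use R c in \<open>auto intro: continuous_intros\<close>)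
  moreover have i2: "integrable lborel (\<lambda>x. partial_deriv i \<eta> x * K x)"
    by (rule integrable_lborel_compact_support[where R = R']) (use R' c in \<open>auto intro: continuous_intros\<close>)
  ultimately have "(\<integral>x. \<eta> x * partial_deriv i K x \<partial>lborel) + (\<integral>x. partial_deriv i \<eta> x * K x \<partial>lborel) = 0"
    by simp
  moreover have "(\<integral>x. \<eta> x * partial_deriv i K x \<partial>lebesgue) = (\<integral>x. \<eta> x * partial_deriv i K x \<partial>lborel)"
    by (rule integral_completion) (use i1 in simp)
  moreover have "(\<integral>x. partial_deriv i \<eta> x * K x \<partial>lebesgue) = (\<integral>x. partial_deriv i \<eta> x * K x \<partial>lborel)"
    by (rule integral_completion) (use i2 in simp)
  ultimately show ?thesis by simp
qed

lemma continuous_imp_locally_integrable: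
  assumes "continuous_on UNIV f" shows "locally_integrable f"
  unfolding locally_integrable_def set_integrable_def
  by (intro allI impI integrable_lebesgue_lborel borel_integrable_compact)
     (auto intro: continuous_on_subset assms)

lemma Cc_is_weak_gradient:
  fixes K :: "real ^ 'n::finite \<Rightarrow> real"
  assumes K: "K \<in> Cc_infinity"
  shows "is_weak_gradient (\<lambda>x. complex_of_real (K x)) (\<lambda>x. \<chi> i. complex_of_real (partial_deriv i K x))"
  unfolding is_weak_gradient_def
proof (intro conjI ballI allI)
  show "locally_integrable (\<lambda>x. complex_of_real (K x))"
    by (intro continuous_imp_locally_integrable continuous_on_of_real Cc_infinity_cont K)
  show "locally_integrable (\<lambda>x. \<chi> i. complex_of_real (partial_deriv i K x))"
    by (intro continuous_imp_locally_integrable continuous_on_vec_lambda continuous_on_of_real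
      Cc_infinity_cont Cc_infinity_partial_deriv K)
  fix \<eta> :: "real ^ 'n \<Rightarrow> real" and i assume \<eta>: "\<eta> \<in> Cc_infinity"
  have "(\<integral>x. partial_deriv i \<eta> x *\<^sub>R complex_of_real (K x) \<partial>lebesgue) = complex_of_real (\<integral>x. partial_deriv i \<eta> x * K x \<partial>lebesgue)"
    by (simp add: scaleR_conv_of_real flip: of_real_mult integral_complex_of_real)
  moreover have "(\<integral>x. \<eta> x *\<^sub>R (\<chi> i. complex_of_real (partial_deriv i K x)) $ i \<partial>lebesgue) = complex_of_real (\<integral>x. \<eta> x * partial_deriv i K x \<partial>lebesgue)"
    by (simp add: scaleR_conv_of_real flip: of_real_mult integral_complex_of_real)
  ultimately show "(\<integral>x. partial_deriv i \<eta> x *\<^sub>R complex_of_real (K x) \<partial>lebesgue)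
      = - (\<integral>x. \<eta> x *\<^sub>R (\<chi> i. complex_of_real (partial_deriv i K x)) $ i \<partial>lebesgue)"
    using Cc_integral_by_parts[OF \<eta> K, of i] by simp
qed

lemma weak_grad_works: "is_weak_gradient f g \<Longrightarrow> is_weak_gradient f (weak_grad f)"
  unfolding weak_grad_def by (rule someI[of "is_weak_gradient f"])

text \<open>A test function lies in \<open>H1_0\<close> because it approximates itself. The error is
  then the zero function, whose chosen weak gradient is known to vanish only almost
  everywhere.\<close>

lemma H1_norm_0: "H1_norm (\<lambda>x :: real ^ 'n::finite. 0 :: 'b::euclidean_space) = 0"
proof -
  have *: "is_weak_gradient (\<lambda>x :: real ^ 'n. 0 :: 'b) (\<lambda>x. 0)"
    unfolding is_weak_gradient_def locally_integrable_def set_integrable_def by simp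
  then have "AE x in lebesgue. weak_grad (\<lambda>x :: real ^ 'n. 0 :: 'b) x = 0"
    by (intro weak_gradient_unique[OF weak_grad_works[OF *] *])
  then have "AE x in lebesgue. (norm (weak_grad (\<lambda>x :: real ^ 'n. 0 :: 'b) x))\<^sup>2 = 0"
    by eventually_elim simp
  then have "(\<integral>x. (norm (weak_grad (\<lambda>x :: real ^ 'n. 0 :: 'b) x))\<^sup>2 \<partial>lebesgue) = 0"
    by (rule integral_eq_zero_AE)
  then show ?thesis by (simp add: H1_norm_def)
qed

lemma Cc_L2:
  fixes f :: "real ^ 'n::finite \<Rightarrow> 'b::euclidean_space"
  assumes "continuous_on UNIV f" "\<And>x. norm x > R \<Longrightarrow> f x = 0"
  shows "f \<in> L2"
  unfolding L2_def
  by (auto intro!: continuous_imp_lebesgue_measurable assms integrable_lebesgue_lborel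
      integrable_lborel_compact_support[where R = R] continuous_intros simp: assms(2))

lemma Cc_H1_0:
  fixes K :: "real ^ 'n::finite \<Rightarrow> real"
  assumes K: "K \<in> Cc_infinity"
  shows "(\<lambda>x. complex_of_real (K x)) \<in> H1_0"
proof -
  obtain R where R: "\<And>x. norm x > R \<Longrightarrow> K x = 0" using K by (auto simp: Cc_infinity_iff)
  have "\<exists>R. \<forall>x. norm x > R \<longrightarrow> partial_deriv i K x = 0" for i
    using Cc_infinity_partial_deriv[OF K, of i] by (auto simp: Cc_infinity_iff)
  then obtain R' where R': "\<And>i x. norm x > R' i \<Longrightarrow> partial_deriv i K x = 0" by metis
  have 1: "(\<lambda>x. complex_of_real (K x)) \<in> L2"
    by (rule Cc_L2[where R = R]) (auto simp: R intro: continuous_on_of_real Cc_infinity_cont K)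
  have 2: "(\<lambda>x. \<chi> i. complex_of_real (partial_deriv i K x)) \<in> L2"
  proof (rule Cc_L2[where R = "Max (range R')"])
    fix x :: "real ^ 'n" assume "Max (range R') < norm x"
    then have "R' i < norm x" for i by (simp add: Max_less_iff)
    then show "(\<chi> i. complex_of_real (partial_deriv i K x)) = 0" by (simp add: R' vec_eq_iff)
  qed (intro continuous_on_vec_lambda continuous_on_of_real Cc_infinity_cont Cc_infinity_partial_deriv K)
  have "(\<lambda>x. complex_of_real (K x)) \<in> H1"
    using 1 2 Cc_is_weak_gradient[OF K] by (auto simp: H1_def)
  moreover have "\<exists>\<eta>\<in>Cc_infinity. H1_norm (\<lambda>x. complex_of_real (K x) - \<eta> x) < e" if "e > 0" for e
    by (rule bexI[OF _ Cc_infinity_complex_of_real[OF K]]) (use that in \<open>simp add: H1_norm_0\<close>)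
  ultimately show ?thesis by (auto simp: H1_0_def)
qed

definition laplacian :: "(real ^ 'n::finite \<Rightarrow> real) \<Rightarrow> real ^ 'n \<Rightarrow> real" where
  "laplacian K x = (\<Sum>i\<in>UNIV. partial_deriv i (partial_deriv i K) x)"

text \<open>The equation is tested with a real bump and the real part is taken; the definition of
  the weak gradient then moves the remaining derivative of \<open>\<psi>\<close> onto the bump. From
  here on the gradient of \<open>\<psi>\<close> no longer occurs.\<close>

lemma weak_solution_distributional:
  fixes \<psi> :: "real ^ 'n::finite \<Rightarrow> real"
  assumes V: "locally_integrable V" and \<psi>: "\<psi> \<in> H1" and ws: "weak_solution V E \<psi>" and K: "K \<in> Cc_infinity"
  shows "integrable lebesgue (\<lambda>x. Re (V x - E) * \<psi> x * K x)"
    and "(\<integral>x. Re (V x - E) * \<psi> x * K x \<partial>lebesgue) = (\<integral>x. \<psi> x * laplacian K x \<partial>lebesgue)"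
proof -
  let ?\<phi> = "\<lambda>x. complex_of_real (K x)"
  obtain g where "is_weak_gradient \<psi> g" using \<psi> by (auto simp: H1_def)
  then have wg: "is_weak_gradient \<psi> (weak_grad \<psi>)" by (rule weak_grad_works)
  then have li: "locally_integrable \<psi>" "locally_integrable (weak_grad \<psi>)" by (auto simp: is_weak_gradient_def)
  have ae: "AE x in lebesgue. weak_grad ?\<phi> x = (\<chi> i. complex_of_real (partial_deriv i K x))"
    using Cc_is_weak_gradient[OF K] weak_grad_works weak_gradient_unique by blast
  note P = Cc_infinity_partial_deriv[OF K]
  have i: "integrable lebesgue (\<lambda>x. partial_deriv i K x * weak_grad \<psi> x $ i)" for i
    using locally_integrable_scaleR_Cc[OF locally_integrable_bounded_linear[OF li(2) bounded_linear_vec_nth] P[of i]]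
    by simp
  have i2: "integrable lebesgue (\<lambda>x. partial_deriv i (partial_deriv i K) x * \<psi> x)" for i
    using locally_integrable_scaleR_Cc[OF li(1) Cc_infinity_partial_deriv[OF P[of i], of i]]
    by simp
  let ?S = "\<lambda>x. \<Sum>i\<in>UNIV. partial_deriv i K x * weak_grad \<psi> x $ i"
  have iS: "integrable lebesgue ?S" using i by simp
  have hb: "has_bochner_integral lebesgue
          (\<lambda>x. (\<Sum>i\<in>UNIV. complex_of_real (weak_grad \<psi> x $ i) * (weak_grad ?\<phi> x $ i))
               + (V x - E) * complex_of_real (\<psi> x) * ?\<phi> x) 0"
    using ws Cc_H1_0[OF K] unfolding weak_solution_def by blast
  let ?F = "\<lambda>x. Re ((\<Sum>i\<in>UNIV. complex_of_real (weak_grad \<psi> x $ i) * (weak_grad ?\<phi> x $ i))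
               + (V x - E) * complex_of_real (\<psi> x) * ?\<phi> x)"
  have hbF: "has_bochner_integral lebesgue ?F 0"
    using has_bochner_integral_bounded_linear[OF bounded_linear_Re hb] by simp
  \<comment> \<open>The zero-order term is integrable as the difference of the full integrand,
    integrable by the definition of \<open>weak_solution\<close>, and the gradient term.\<close>
  have eq: "AE x in lebesgue. ?F x - ?S x = Re (V x - E) * \<psi> x * K x"
    using ae by eventually_elim (simp add: mult_ac)
  have iF: "integrable lebesgue ?F" using hbF by (simp add: has_bochner_integral_iff)
  then have iD: "integrable lebesgue (\<lambda>x. ?F x - ?S x)" using iS by simp
  have [measurable]: "K \<in> borel_measurable lebesgue" by (intro continuous_imp_lebesgue_measurable Cc_infinity_cont K)
  have [measurable]: "\<psi> \<in> borel_measurable lebesgue" using \<psi> by (auto simp: H1_def L2_def)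
  have [measurable]: "V \<in> borel_measurable lebesgue" by (rule locally_integrable_measurable[OF V])
  have m: "(\<lambda>x. Re (V x - E) * \<psi> x * K x) \<in> borel_measurable lebesgue" by measurable
  show int: "integrable lebesgue (\<lambda>x. Re (V x - E) * \<psi> x * K x)"
    by (rule integrable_cong_AE_imp[OF iD m]) (use eq in eventually_elim, auto)
  have "(\<integral>x. Re (V x - E) * \<psi> x * K x \<partial>lebesgue) = (\<integral>x. ?F x - ?S x \<partial>lebesgue)"
    by (rule integral_cong_AE) (use m iD eq in \<open>auto elim: AE_mp\<close>)
  also have "\<dots> = - (\<integral>x. ?S x \<partial>lebesgue)"
    using iF iS hbF by (simp add: has_bochner_integral_iff)
  also have "\<dots> = (\<Sum>i\<in>UNIV. - (\<integral>x. partial_deriv i K x * weak_grad \<psi> x $ i \<partial>lebesgue))"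
    using i by (simp add: sum_negf)
  also have "\<dots> = (\<Sum>i\<in>UNIV. \<integral>x. partial_deriv i (partial_deriv i K) x * \<psi> x \<partial>lebesgue)"
    using wg P unfolding is_weak_gradient_def by (intro sum.cong) auto
  also have "\<dots> = (\<integral>x. \<psi> x * laplacian K x \<partial>lebesgue)"
    using i2 by (simp add: laplacian_def sum_distrib_left mult.commute)
  finally show "(\<integral>x. Re (V x - E) * \<psi> x * K x \<partial>lebesgue) = (\<integral>x. \<psi> x * laplacian K x \<partial>lebesgue)" .
qed

section \<open>Energy estimate and Poincare inequality\<close>

text \<open>Squaring removes the kink of the positive part; thus the square of \<open>cutoff\<close>
  is continuously differentiable although \<open>cutoff\<close> itself has a kink on the
  sphere.\<close>

lemma DERIV_pos_part_square: "((\<lambda>t::real. (max 0 t)\<^sup>2) has_real_derivative 2 * max 0 t) (at t)"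
proof -
  consider "t > 0" | "t < 0" | "t = 0" by linarith
  then show ?thesis
  proof cases
    case 1
    have "((\<lambda>t::real. t\<^sup>2) has_real_derivative 2 * max 0 t) (at t)"
      using 1 by (auto intro!: derivative_eq_intros)
    then show ?thesis
      by (rule has_field_derivative_transform_within_open[of _ _ _ "{0<..}"]) (use 1 in auto)
  next
    case 2
    have "((\<lambda>t::real. 0) has_real_derivative 2 * max 0 t) (at t)"
      using 2 by auto
    then show ?thesis
      by (rule has_field_derivative_transform_within_open[of _ _ _ "{..<0}"]) (use 2 in auto)
  next
    case 3
    have "((\<lambda>h::real. max 0 h) \<longlongrightarrow> 0) (at 0)"
      by (auto intro!: tendsto_eq_intros)
    then have "((\<lambda>h::real. ((max 0 h)\<^sup>2 - (max 0 0)\<^sup>2) / (h - 0)) \<longlongrightarrow> 0) (at 0)"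
      by (rule Lim_transform_eventually)
         (auto simp: eventually_at_filter max_def power2_eq_square)
    then show ?thesis using 3 by (simp add: has_field_derivative_iff)
  qed
qed

text \<open>The profile is chosen so that the gradient of its square still contains one factor
  \<open>cutoff\<close>, the square root of the weight. That factor is what allows the cross term to
  be absorbed in the energy estimate.\<close>

definition cutoff :: "'a::euclidean_space \<Rightarrow> real \<Rightarrow> 'a \<Rightarrow> real" where
  "cutoff x\<^sub>0 r x = max 0 (1 - (x - x\<^sub>0) \<bullet> (x - x\<^sub>0) / r\<^sup>2)"

lemma cutoff_bounds: "0 \<le> cutoff x\<^sub>0 r x" "cutoff x\<^sub>0 r x \<le> 1"
  by (auto simp: cutoff_def)

lemma cutoff_eq_0: "r > 0 \<Longrightarrow> norm (x - x\<^sub>0) \<ge> r \<Longrightarrow> cutoff x\<^sub>0 r x = 0"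
proof -
  assume "r > 0" "norm (x - x\<^sub>0) \<ge> r"
  then have "r\<^sup>2 \<le> (norm (x - x\<^sub>0))\<^sup>2" by (intro power_mono) auto
  then show ?thesis using \<open>r > 0\<close> by (simp add: cutoff_def dot_square_norm field_simps)
qed

lemma cutoff_ge: "r > 0 \<Longrightarrow> norm (x - x\<^sub>0) < r \<Longrightarrow> cutoff x\<^sub>0 (2 * r) x \<ge> 3 / 4"
proof -
  assume "r > 0" "norm (x - x\<^sub>0) < r"
  then have "(norm (x - x\<^sub>0))\<^sup>2 \<le> r\<^sup>2" by (intro power_mono) auto
  then have "(norm (x - x\<^sub>0))\<^sup>2 / (2 * r)\<^sup>2 \<le> 1 / 4"
    using \<open>r > 0\<close> by (simp add: power_mult_distrib divide_le_eq)
  then show ?thesis by (simp add: cutoff_def dot_square_norm le_max_iff_disj)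
qed

lemma continuous_on_cutoff: "continuous_on UNIV (cutoff x\<^sub>0 r)"
  unfolding cutoff_def divide_inverse by (intro continuous_intros)

lemma GDERIV_cutoff_square:
  "GDERIV (\<lambda>x. (cutoff x\<^sub>0 r x)\<^sup>2) x :> (- (4 * cutoff x\<^sub>0 r x / r\<^sup>2)) *\<^sub>R (x - x\<^sub>0)"
proof -
  have "GDERIV (\<lambda>x. 1 - (x - x\<^sub>0) \<bullet> (x - x\<^sub>0) / r\<^sup>2) x :> (- (2 / r\<^sup>2)) *\<^sub>R (x - x\<^sub>0)"
    unfolding gderiv_def divide_inverse
    by (auto intro!: derivative_eq_intros simp: inner_commute algebra_simps)
  from GDERIV_DERIV_compose[OF this DERIV_pos_part_square]
  show ?thesis by (simp add: cutoff_def[symmetric] field_simps)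
qed

text \<open>The vector field \<open>\<zeta> Du / (u + \<delta>)\<close> has integral of divergence 0; the cross term \<open>D\<zeta> \<bullet> Du / (u + \<delta>)\<close>
  is absorbed since the gradient of \<open>\<zeta>\<close> is at most \<open>4 sqrt \<zeta> / r\<close>.\<close>

lemma energy_inequality:
  fixes u :: "'a::euclidean_space \<Rightarrow> real" and x\<^sub>0 :: 'a
  assumes u: "\<And>x. u x \<ge> 0" "\<And>x. GDERIV u x :> Du x"
    and Du: "\<And>b x. b \<in> Basis \<Longrightarrow> GDERIV (\<lambda>x. Du x \<bullet> b) x :> D2 b x"
    and D2: "\<And>b. b \<in> Basis \<Longrightarrow> continuous_on UNIV (D2 b)"
    and \<delta>: "\<delta> > 0" and r: "r > 0"
  defines "\<zeta> \<equiv> \<lambda>x. (cutoff x\<^sub>0 r x)\<^sup>2"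
  shows "integrable lborel (\<lambda>x. \<zeta> x * (norm (Du x) / (u x + \<delta>))\<^sup>2)"
    and "(\<integral>x. \<zeta> x * (norm (Du x) / (u x + \<delta>))\<^sup>2 \<partial>lborel)
      \<le> 16 / r\<^sup>2 * measure lborel (ball x\<^sub>0 r) + 2 * (\<integral>x. \<zeta> x * (\<Sum>b\<in>Basis. D2 b x \<bullet> b) / (u x + \<delta>) \<partial>lborel)"
proof -
  have pos: "u x + \<delta> > 0" for x using u(1)[of x] \<delta> by linarith
  then have nz: "u x + \<delta> \<noteq> 0" for x by (metis less_irrefl)
  have cu: "continuous_on UNIV u" by (rule GDERIV_continuous_on[OF u(2)])
  have cDub: "continuous_on UNIV (\<lambda>x. Du x \<bullet> b)" if "b \<in> Basis" for b
    by (rule GDERIV_continuous_on[OF Du[OF that]])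
  then have cDu: "continuous_on UNIV Du" by (subst continuous_on_componentwise) blast
  have c\<zeta>: "continuous_on UNIV \<zeta>" unfolding \<zeta>_def by (intro continuous_intros continuous_on_cutoff)
  define D\<zeta> where "D\<zeta> x = (- (4 * cutoff x\<^sub>0 r x / r\<^sup>2)) *\<^sub>R (x - x\<^sub>0)" for x
  have D\<zeta>: "GDERIV \<zeta> x :> D\<zeta> x" for x unfolding \<zeta>_def D\<zeta>_def by (rule GDERIV_cutoff_square)
  have cD\<zeta>: "continuous_on UNIV D\<zeta>"
    unfolding D\<zeta>_def divide_inverse by (intro continuous_intros continuous_on_cutoff)
  define R where "R = norm x\<^sub>0 + r"
  have out: "norm (x - x\<^sub>0) \<ge> r" if "norm x \<ge> R" for x
    using that norm_triangle_ineq2[of x x\<^sub>0] by (simp add: R_def)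
  have out\<zeta>: "\<zeta> x = 0" "cutoff x\<^sub>0 r x = 0" "D\<zeta> x = 0" if "norm x \<ge> R" for x
    using cutoff_eq_0[OF r out[OF that]] by (auto simp: \<zeta>_def D\<zeta>_def)
  let ?A = "\<lambda>x. D\<zeta> x \<bullet> Du x / (u x + \<delta>)"
  let ?B = "\<lambda>x. \<zeta> x * (\<Sum>b\<in>Basis. D2 b x \<bullet> b) / (u x + \<delta>)"
  let ?C = "\<lambda>x. \<zeta> x * (norm (Du x) / (u x + \<delta>))\<^sup>2"
  have iA: "integrable lborel ?A"
    by (rule integrable_lborel_compact_support[where R = R])
       (auto intro!: continuous_intros cD\<zeta> cDu cu simp: nz out\<zeta>)
  have iB: "integrable lborel ?B"
    by (rule integrable_lborel_compact_support[where R = R])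
       (auto intro!: continuous_intros c\<zeta> D2 cu simp: nz out\<zeta>)
  show iC: "integrable lborel ?C"
    by (rule integrable_lborel_compact_support[where R = R])
       (auto intro!: continuous_intros c\<zeta> cDu cu simp: nz out\<zeta>)
  \<comment> \<open>The gradient of the b-th component of the vector field
    \<open>\<zeta> Du / (u + \<delta>)\<close>; summing \<open>G b x \<bullet> b\<close> over the
    basis gives the divergence.\<close>
  define G where "G b x = (\<zeta> x * (Du x \<bullet> b)) *\<^sub>R (- (inverse (u x + \<delta>))\<^sup>2 *\<^sub>R Du x)
     + inverse (u x + \<delta>) *\<^sub>R (\<zeta> x *\<^sub>R D2 b x + (Du x \<bullet> b) *\<^sub>R D\<zeta> x)" for b x
  have G: "integrable lborel (\<lambda>x. G b x \<bullet> b)" "(\<integral>x. G b x \<bullet> b \<partial>lborel) = 0" if b: "b \<in> Basis" for b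
  proof -
    have "GDERIV (\<lambda>x. \<zeta> x * (Du x \<bullet> b) * inverse (u x + \<delta>)) x :> G b x" for x
      unfolding G_def
    proof (intro GDERIV_mult GDERIV_inverse D\<zeta> Du[OF b] nz)
      show "GDERIV (\<lambda>x. u x + \<delta>) x :> Du x"
        using GDERIV_add[OF u(2)[of x] GDERIV_const[of \<delta>]] by simp
    qed
    moreover have "continuous_on UNIV (G b)"
      unfolding G_def by (intro continuous_intros c\<zeta> cDu cu D2 cD\<zeta> b) (simp_all add: nz)
    ultimately show "integrable lborel (\<lambda>x. G b x \<bullet> b)" "(\<integral>x. G b x \<bullet> b \<partial>lborel) = 0"
      by (auto intro!: integral_gradient_eq_0[where R = R and G = "G b"] simp: out\<zeta>)
  qed
  have "(\<Sum>b\<in>Basis. G b x \<bullet> b) = ?A x + ?B x - ?C x" for x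
  proof -
    have 1: "(norm (Du x))\<^sup>2 = (\<Sum>b\<in>Basis. (Du x \<bullet> b) * (Du x \<bullet> b))"
      unfolding power2_norm_eq_inner by (rule euclidean_inner)
    have 2: "D\<zeta> x \<bullet> Du x = (\<Sum>b\<in>Basis. (D\<zeta> x \<bullet> b) * (Du x \<bullet> b))" by (rule euclidean_inner)
    obtain i where i: "i = inverse (u x + \<delta>)" by simp
    have "G b x \<bullet> b = (D\<zeta> x \<bullet> b) * (Du x \<bullet> b) * i + \<zeta> x * (D2 b x \<bullet> b) * i - \<zeta> x * ((Du x \<bullet> b) * (Du x \<bullet> b)) * i\<^sup>2" for b
      unfolding G_def i[symmetric] by (simp add: inner_add_left power2_eq_square algebra_simps)
    then have "(\<Sum>b\<in>Basis. G b x \<bullet> b) = (D\<zeta> x \<bullet> Du x) * i + \<zeta> x * (\<Sum>b\<in>Basis. D2 b x \<bullet> b) * i - \<zeta> x * (norm (Du x))\<^sup>2 * i\<^sup>2"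
      by (simp add: 1 2 sum.distrib sum_subtractf sum_distrib_left sum_distrib_right)
    then show ?thesis by (simp add: i divide_inverse power_mult_distrib)
  qed
  then have "(\<integral>x. ?A x + ?B x - ?C x \<partial>lborel) = (\<Sum>b\<in>Basis. \<integral>x. G b x \<bullet> b \<partial>lborel)"
    using G(1) by (subst Bochner_Integration.integral_sum[symmetric]) (auto)
  then have eq: "(\<integral>x. ?C x \<partial>lborel) = (\<integral>x. ?A x \<partial>lborel) + (\<integral>x. ?B x \<partial>lborel)"
    using iA iB iC G(2) by simp
  \<comment> \<open>Pointwise, with W the length of the logarithmic gradient,
    \<open>(cutoff * W) * (4 / r)\<close> is at most half the sum of the squares. One half of the
    energy is absorbed on the left; the remaining \<open>8 / r^2\<close> on the ball becomes
    \<open>16 / r^2\<close> after doubling.\<close>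
  have "(\<integral>x. ?A x \<partial>lborel) \<le> (\<integral>x. ?C x / 2 + 8 / r\<^sup>2 * indicator (ball x\<^sub>0 r) x \<partial>lborel)"
  proof (rule integral_mono)
    show "integrable lborel ?A" by (rule iA)
    show "integrable lborel (\<lambda>x. ?C x / 2 + 8 / r\<^sup>2 * indicator (ball x\<^sub>0 r) x)"
      using iC emeasure_lborel_ball_finite[of x\<^sub>0 r] by (intro Bochner_Integration.integrable_add integrable_divide integrable_mult_right integrable_real_indicator) auto
    fix x
    show "?A x \<le> ?C x / 2 + 8 / r\<^sup>2 * indicator (ball x\<^sub>0 r) x"
    proof (cases "norm (x - x\<^sub>0) < r")
      case False
      then have "cutoff x\<^sub>0 r x = 0" using cutoff_eq_0[OF r, of x x\<^sub>0] by simp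
      then show ?thesis by (simp add: \<zeta>_def D\<zeta>_def)
    next
      case True
      let ?a = "cutoff x\<^sub>0 r x" and ?W = "norm (Du x) / (u x + \<delta>)"
      have W: "?W \<ge> 0" using pos[of x] by simp
      have "norm (D\<zeta> x) = 4 * ?a / r\<^sup>2 * norm (x - x\<^sub>0)"
        using cutoff_bounds[of x\<^sub>0 r x] by (simp add: D\<zeta>_def)
      also have "\<dots> \<le> 4 * ?a / r\<^sup>2 * r"
        using cutoff_bounds[of x\<^sub>0 r x] True by (intro mult_left_mono) auto
      also have "\<dots> = 4 * ?a / r" using r by (simp add: power2_eq_square)
      finally have n: "norm (D\<zeta> x) \<le> 4 * ?a / r" .
      have "D\<zeta> x \<bullet> Du x \<le> norm (D\<zeta> x) * norm (Du x)" by (rule norm_cauchy_schwarz)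
      also have "\<dots> \<le> 4 * ?a / r * norm (Du x)" by (intro mult_right_mono n) auto
      finally have "?A x \<le> 4 * ?a / r * norm (Du x) / (u x + \<delta>)"
        using pos[of x] by (intro divide_right_mono) auto
      also have "\<dots> = 4 * ?a / r * ?W" by simp
      also have "\<dots> = (?a * ?W) * (4 / r)" by (simp add: mult_ac)
      also have "\<dots> \<le> ((?a * ?W)\<^sup>2 + (4 / r)\<^sup>2) / 2"
        using sum_squares_bound[of "?a * ?W" "4 / r"] by simp
      also have "\<dots> = ?C x / 2 + 8 / r\<^sup>2"
        by (simp add: \<zeta>_def power_mult_distrib power_divide add_divide_distrib)
      finally show ?thesis using True by (simp add: dist_norm norm_minus_commute)
    qed
  qed
  also have "\<dots> = (\<integral>x. ?C x \<partial>lborel) / 2 + 8 / r\<^sup>2 * measure lborel (ball x\<^sub>0 r)"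
    using iC emeasure_lborel_ball_finite[of x\<^sub>0 r] by (subst Bochner_Integration.integral_add) auto
  finally have "(\<integral>x. ?A x \<partial>lborel) \<le> (\<integral>x. ?C x \<partial>lborel) / 2 + 8 / r\<^sup>2 * measure lborel (ball x\<^sub>0 r)" .
  moreover have "16 / r\<^sup>2 * measure lborel (ball x\<^sub>0 r) = 2 * (8 / r\<^sup>2 * measure lborel (ball x\<^sub>0 r))" by simp
  ultimately show "(\<integral>x. ?C x \<partial>lborel) \<le> 16 / r\<^sup>2 * measure lborel (ball x\<^sub>0 r) + 2 * (\<integral>x. ?B x \<partial>lborel)"
    using eq by linarith
qed

section \<open>Poincare inequality along segments\<close>

lemma segment_bound:
  fixes w :: "'a::euclidean_space \<Rightarrow> real"
  assumes w: "\<And>x. GDERIV w x :> Dw x" and c: "continuous_on UNIV Dw"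
  shows "ennreal \<bar>w x - w y\<bar> \<le> (\<integral>\<^sup>+t. indicator {0..1} t * ennreal (norm (x - y) * norm (Dw (y + t *\<^sub>R (x - y)))) \<partial>lborel)"
proof -
  let ?f = "\<lambda>t. (x - y) \<bullet> Dw (y + t *\<^sub>R (x - y))"
  have cf: "continuous_on {0..1} ?f"
    by (intro continuous_intros continuous_on_compose2[OF c]) auto
  have "(\<integral>t. indicator {0..1} t *\<^sub>R ?f t \<partial>lborel) = w (y + 1 *\<^sub>R (x - y)) - w (y + 0 *\<^sub>R (x - y))"
  proof (rule integral_FTC_atLeastAtMost[OF _ _ cf])
    fix t :: real
    have "((\<lambda>t. y + t *\<^sub>R (x - y)) has_derivative (\<lambda>t. t *\<^sub>R (x - y))) (at t)"
      by (auto intro!: derivative_eq_intros)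
    from has_derivative_compose[OF this w[unfolded gderiv_def]]
    have "((\<lambda>t. w (y + t *\<^sub>R (x - y))) has_derivative (\<lambda>h. h *\<^sub>R ?f t)) (at t)" by simp
    then show "((\<lambda>t. w (y + t *\<^sub>R (x - y))) has_vector_derivative ?f t) (at t within {0..1})"
      unfolding has_vector_derivative_def by (rule has_derivative_at_withinI)
  qed simp
  then have e: "w x - w y = (\<integral>t. indicator {0..1} t *\<^sub>R ?f t \<partial>lborel)" by simp
  have "ennreal (norm (w x - w y)) \<le> (\<integral>\<^sup>+t. norm (indicator {0..1} t *\<^sub>R ?f t) \<partial>lborel)"
    unfolding e by (intro integral_norm_bound_ennreal borel_integrable_compact cf) auto
  also have "\<dots> \<le> (\<integral>\<^sup>+t. indicator {0..1} t * ennreal (norm (x - y) * norm (Dw (y + t *\<^sub>R (x - y)))) \<partial>lborel)"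
    by (intro nn_integral_mono) (auto simp: indicator_def Cauchy_Schwarz_ineq2 intro!: ennreal_leI)
  finally show ?thesis by simp
qed

text \<open>Contraction towards y by the factor t maps the convex set S into itself, and the change
  of variables costs \<open>t^(-n)\<close>, at most \<open>2^n\<close> for t at least 1/2.\<close>

lemma nn_integral_contracted:
  fixes h :: "'a::euclidean_space \<Rightarrow> ennreal"
  assumes [measurable]: "h \<in> borel_measurable borel" "S \<in> sets borel" and S: "convex S" "y \<in> S" and t: "1 / 2 \<le> t" "t \<le> 1"
  shows "(\<integral>\<^sup>+x. indicator S x * h ((1 - t) *\<^sub>R y + t *\<^sub>R x) \<partial>lborel) \<le> 2 ^ DIM('a) * (\<integral>\<^sup>+x. indicator S x * h x \<partial>lborel)"
proof -
  have "(\<integral>\<^sup>+x. indicator S x * h ((1 - t) *\<^sub>R y + t *\<^sub>R x) \<partial>lborel)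
     \<le> (\<integral>\<^sup>+x. indicator S ((1 - t) *\<^sub>R y + t *\<^sub>R x) * h ((1 - t) *\<^sub>R y + t *\<^sub>R x) \<partial>lborel)"
    using S t by (intro nn_integral_mono) (auto simp: indicator_def convexD)
  also have "\<dots> \<le> 2 ^ DIM('a) * (ennreal (\<bar>t\<bar> ^ DIM('a)) * (\<integral>\<^sup>+x. indicator S ((1 - t) *\<^sub>R y + t *\<^sub>R x) * h ((1 - t) *\<^sub>R y + t *\<^sub>R x) \<partial>lborel))"
  proof -
    have "1 \<le> (2 * \<bar>t\<bar>) ^ DIM('a)" using t by (intro one_le_power) auto
    then have "1 \<le> ennreal ((2 * \<bar>t\<bar>) ^ DIM('a))" by (metis ennreal_1 ennreal_leI)
    also have "\<dots> = 2 ^ DIM('a) * ennreal (\<bar>t\<bar> ^ DIM('a))"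
      by (simp add: power_mult_distrib ennreal_mult flip: ennreal_power)
    finally show ?thesis unfolding mult.assoc[symmetric] using mult_right_mono[of 1] by fastforce
  qed
  also have "ennreal (\<bar>t\<bar> ^ DIM('a)) * (\<integral>\<^sup>+x. indicator S ((1 - t) *\<^sub>R y + t *\<^sub>R x) * h ((1 - t) *\<^sub>R y + t *\<^sub>R x) \<partial>lborel)
     = (\<integral>\<^sup>+x. indicator S x * h x \<partial>lborel)"
    using t by (subst nn_integral_lborel_affine[where c = t and t = "(1 - t) *\<^sub>R y"]) auto
  finally show ?thesis .
qed

text \<open>Divided by the squared measure of S, this is the average of \<open>|w x - w y|\<close>
  over pairs of points. For integrable w it is comparable to the mean oscillation, but it can be
  formed without a mean value and without integrability.\<close>

definition double_osc :: "'a::euclidean_space set \<Rightarrow> ('a \<Rightarrow> real) \<Rightarrow> ennreal" where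
  "double_osc S w = (\<integral>\<^sup>+x. \<integral>\<^sup>+y. indicator S x * (indicator S y * ennreal \<bar>w x - w y\<bar>) \<partial>lborel \<partial>lborel)"

text \<open>On the segment from \<open>y\<close> to \<open>x\<close>, the point \<open>y + t (x - y)\<close> is taken as new variable in place of \<open>x\<close> if
  \<open>t \<ge> 1/2\<close> and in place of \<open>y\<close> otherwise, so that the Jacobian is at most \<open>2 ^ n\<close>.\<close>

lemma poincare_double_integral:
  fixes w :: "'a::euclidean_space \<Rightarrow> real" and x\<^sub>0 :: 'a and r :: real
  assumes w: "\<And>x. GDERIV w x :> Dw x" and c: "continuous_on UNIV Dw"
  defines "S \<equiv> ball x\<^sub>0 r"
  shows "double_osc S w
     \<le> ennreal (2 * r) * 2 ^ DIM('a) * emeasure lborel S * (\<integral>\<^sup>+x. indicator S x * ennreal (norm (Dw x)) \<partial>lborel)"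
proof -
  have S[measurable]: "S \<in> sets borel" and cS: "convex S" by (auto simp: S_def)
  have [measurable]: "Dw \<in> borel_measurable borel" using c by (rule borel_measurable_continuous_onI)
  let ?I = "\<integral>\<^sup>+x. indicator S x * ennreal (norm (Dw x)) \<partial>lborel"
  let ?h = "\<lambda>t x y. indicator S x * (indicator S y * ennreal (norm (Dw (y + t *\<^sub>R (x - y)))))"
  have eq: "y + t *\<^sub>R (x - y) = (1 - t) *\<^sub>R y + t *\<^sub>R x" "y + t *\<^sub>R (x - y) = (1 - (1 - t)) *\<^sub>R x + (1 - t) *\<^sub>R y" for t and x y :: 'a
    by (auto simp: algebra_simps)
  have T: "(\<integral>\<^sup>+x. \<integral>\<^sup>+y. ?h t x y \<partial>lborel \<partial>lborel) \<le> 2 ^ DIM('a) * emeasure lborel S * ?I" if t: "t \<in> {0..1}" for t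
  proof (cases "t \<ge> 1 / 2")
    case True
    have "(\<integral>\<^sup>+x. \<integral>\<^sup>+y. ?h t x y \<partial>lborel \<partial>lborel) = (\<integral>\<^sup>+y. \<integral>\<^sup>+x. ?h t x y \<partial>lborel \<partial>lborel)"
      by (rule lborel_pair.Fubini') measurable
    also have "\<dots> \<le> (\<integral>\<^sup>+y. indicator S y * (2 ^ DIM('a) * ?I) \<partial>lborel)"
    proof (rule nn_integral_mono)
      fix y
      have "(\<integral>\<^sup>+x. ?h t x y \<partial>lborel) = indicator S y * (\<integral>\<^sup>+x. indicator S x * ennreal (norm (Dw ((1 - t) *\<^sub>R y + t *\<^sub>R x))) \<partial>lborel)"
        unfolding eq(1) by (subst nn_integral_cmult[symmetric]) (auto simp: mult_ac)
      also have "\<dots> \<le> indicator S y * (2 ^ DIM('a) * ?I)"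
        using nn_integral_contracted[of "\<lambda>x. ennreal (norm (Dw x))" S y t] cS t True
        by (cases "y \<in> S") auto
      finally show "(\<integral>\<^sup>+x. ?h t x y \<partial>lborel) \<le> indicator S y * (2 ^ DIM('a) * ?I)" .
    qed
    also have "\<dots> = 2 ^ DIM('a) * emeasure lborel S * ?I" by (subst nn_integral_multc) (auto simp: mult_ac)
    finally show ?thesis .
  next
    case False
    have "(\<integral>\<^sup>+x. \<integral>\<^sup>+y. ?h t x y \<partial>lborel \<partial>lborel) \<le> (\<integral>\<^sup>+x. indicator S x * (2 ^ DIM('a) * ?I) \<partial>lborel)"
    proof (rule nn_integral_mono)
      fix x
      have "(\<integral>\<^sup>+y. ?h t x y \<partial>lborel) = indicator S x * (\<integral>\<^sup>+y. indicator S y * ennreal (norm (Dw ((1 - (1 - t)) *\<^sub>R x + (1 - t) *\<^sub>R y))) \<partial>lborel)"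
        unfolding eq(2) by (subst nn_integral_cmult) auto
      also have "\<dots> \<le> indicator S x * (2 ^ DIM('a) * ?I)"
        using nn_integral_contracted[of "\<lambda>x. ennreal (norm (Dw x))" S x "1 - t"] cS t False
        by (cases "x \<in> S") auto
      finally show "(\<integral>\<^sup>+y. ?h t x y \<partial>lborel) \<le> indicator S x * (2 ^ DIM('a) * ?I)" .
    qed
    also have "\<dots> = 2 ^ DIM('a) * emeasure lborel S * ?I" by (subst nn_integral_multc) (auto simp: mult_ac)
    finally show ?thesis .
  qed
  have "double_osc S w
     \<le> (\<integral>\<^sup>+x. \<integral>\<^sup>+y. \<integral>\<^sup>+t. indicator {0..1} t * (ennreal (2 * r) * ?h t x y) \<partial>lborel \<partial>lborel \<partial>lborel)"
    unfolding double_osc_def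
  proof (intro nn_integral_mono)
    fix x y
    show "indicator S x * (indicator S y * ennreal \<bar>w x - w y\<bar>) \<le> (\<integral>\<^sup>+t. indicator {0..1::real} t * (ennreal (2 * r) * ?h t x y) \<partial>lborel)"
    proof (cases "x \<in> S \<and> y \<in> S")
      case True
      then have "norm (x - y) \<le> 2 * r"
        using dist_triangle[of x y x\<^sub>0] by (simp add: S_def dist_norm[symmetric] dist_commute)
      then have "ennreal (norm (x - y) * norm (Dw (y + t *\<^sub>R (x - y)))) \<le> ennreal (2 * r) * ennreal (norm (Dw (y + t *\<^sub>R (x - y))))" for t
        using order_trans[OF norm_ge_zero \<open>norm (x - y) \<le> 2 * r\<close>]
        by (subst ennreal_mult[symmetric]) (auto intro!: ennreal_leI mult_right_mono)
      then have "(\<integral>\<^sup>+t. indicator {0..1} t * ennreal (norm (x - y) * norm (Dw (y + t *\<^sub>R (x - y)))) \<partial>lborel)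
          \<le> (\<integral>\<^sup>+t. indicator {0..1::real} t * (ennreal (2 * r) * ?h t x y) \<partial>lborel)"
        using True by (intro nn_integral_mono mult_left_mono) auto
      from order_trans[OF segment_bound[OF w c] this] show ?thesis using True by simp
    qed auto
  qed
  also have "\<dots> = (\<integral>\<^sup>+x. \<integral>\<^sup>+t. \<integral>\<^sup>+y. indicator {0..1} t * (ennreal (2 * r) * ?h t x y) \<partial>lborel \<partial>lborel \<partial>lborel)"
    by (intro nn_integral_cong lborel_pair.Fubini') measurable
  also have "\<dots> = (\<integral>\<^sup>+t. \<integral>\<^sup>+x. \<integral>\<^sup>+y. indicator {0..1} t * (ennreal (2 * r) * ?h t x y) \<partial>lborel \<partial>lborel \<partial>lborel)"
    by (rule lborel_pair.Fubini') measurable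
  also have "\<dots> = (\<integral>\<^sup>+t. indicator {0..1::real} t * (ennreal (2 * r) * (\<integral>\<^sup>+x. \<integral>\<^sup>+y. ?h t x y \<partial>lborel \<partial>lborel)) \<partial>lborel)"
    by (simp add: nn_integral_cmult)
  also have "\<dots> \<le> (\<integral>\<^sup>+t. indicator {0..1::real} t * (ennreal (2 * r) * (2 ^ DIM('a) * emeasure lborel S * ?I)) \<partial>lborel)"
    using T by (intro nn_integral_mono) (auto simp: indicator_def intro!: mult_left_mono)
  also have "\<dots> = ennreal (2 * r) * 2 ^ DIM('a) * emeasure lborel S * ?I"
    by (subst nn_integral_multc) (auto simp: mult_ac)
  finally show ?thesis .
qed

section \<open>Oscillation of the logarithm\<close>

lemma partial_deriv_shift:
  assumes "K \<in> Cc_infinity"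
  shows "partial_deriv i (\<lambda>x. K (x - y)) = (\<lambda>x. partial_deriv i K (x - y))"
proof
  fix x
  have "((\<lambda>x. x - y) has_derivative (\<lambda>h. h)) (at x)" by (auto intro!: derivative_eq_intros)
  from has_derivative_compose[OF this Cc_infinity_has_derivative[OF assms]]
  show "partial_deriv i (\<lambda>x. K (x - y)) x = partial_deriv i K (x - y)"
    by (subst partial_deriv_eq) (auto simp: partial_deriv_def)
qed

lemma laplacian_shift:
  assumes "K \<in> Cc_infinity"
  shows "laplacian (\<lambda>x. K (x - y)) = (\<lambda>x. laplacian K (x - y))"
  unfolding laplacian_def
  by (simp add: partial_deriv_shift assms Cc_infinity_partial_deriv)

lemma integrable_mult_Cc:
  fixes f K :: "real ^ 'n::finite \<Rightarrow> real"
  assumes "integrable lborel f" "K \<in> Cc_infinity"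
  shows "integrable lborel (\<lambda>x. f x * K (x - y))"
proof -
  obtain B where B: "\<And>x. norm (K x) \<le> B" using Cc_infinity_bounded[OF assms(2)] by blast
  have [measurable]: "K \<in> borel_measurable borel"
    using Cc_infinity_cont[OF assms(2)] by (rule borel_measurable_continuous_onI)
  show ?thesis using B by (intro integrable_mult_bounded[where B = B] assms(1)) auto
qed

lemma conv_laplacian:
  fixes f :: "real ^ 'n::finite \<Rightarrow> real"
  assumes f: "integrable lborel f" and K: "K \<in> Cc_infinity"
  shows "conv (laplacian K) f y = (\<Sum>i\<in>UNIV. conv (partial_deriv i (partial_deriv i K)) f y)"
  unfolding conv_def laplacian_def sum_distrib_left
  by (intro Bochner_Integration.integral_sum integrable_mult_Cc f Cc_infinity_partial_deriv K)

text \<open>The equation that the Laplacian of f equals g in the sense of distributions. The test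
  functions vanish outside S, so for an open ball their supports may touch the sphere.\<close>

definition distributional_laplace ::
    "(real ^ 'n::finite \<Rightarrow> real) \<Rightarrow> (real ^ 'n \<Rightarrow> real) \<Rightarrow> (real ^ 'n) set \<Rightarrow> bool" where
  "distributional_laplace f g S \<longleftrightarrow> (\<forall>K\<in>Cc_infinity. (\<forall>x. x \<notin> S \<longrightarrow> K x = 0) \<longrightarrow>
     (\<integral>x. g x * K x \<partial>lborel) = (\<integral>x. f x * laplacian K x \<partial>lborel))"

text \<open>The kernel centred at y is an admissible test function because its support lies within
  \<open>\<epsilon>\<close> of y, hence in the ball. Two derivatives in y produce two sign changes,
  which cancel.\<close>

lemma conv_moll_laplacian:
  fixes f g :: "real ^ 'n::finite \<Rightarrow> real"
  assumes eq: "distributional_laplace f g (ball x\<^sub>0 R)"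
    and \<rho>: "\<rho> \<in> Cc_infinity" "\<And>x. norm x \<ge> 1 \<Longrightarrow> \<rho> x = 0"
    and \<epsilon>: "\<epsilon> > 0" "norm (y - x\<^sub>0) + \<epsilon> \<le> R"
  shows "conv (laplacian (moll \<rho> \<epsilon>)) f y = conv (moll \<rho> \<epsilon>) g y"
proof -
  have "moll \<rho> \<epsilon> (x - y) = 0" if "x \<notin> ball x\<^sub>0 R" for x
  proof (rule moll_eq_0[OF \<rho>(2) \<epsilon>(1)])
    have "R \<le> norm (x - x\<^sub>0)" using that by (simp add: dist_norm norm_minus_commute)
    also have "\<dots> \<le> norm (x - y) + norm (y - x\<^sub>0)" using norm_triangle_ineq[of "x - y" "y - x\<^sub>0"] by simp
    finally show "\<epsilon> \<le> norm (x - y)" using \<epsilon>(2) by simp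
  qed
  then have "(\<integral>x. g x * moll \<rho> \<epsilon> (x - y) \<partial>lborel) = (\<integral>x. f x * laplacian (\<lambda>x. moll \<rho> \<epsilon> (x - y)) x \<partial>lborel)"
    using eq[unfolded distributional_laplace_def, rule_format, OF moll_Cc(2)[OF \<rho>(1) \<epsilon>(1)]] by simp
  then show ?thesis
    by (simp add: conv_def laplacian_shift[OF moll_Cc(1)[OF \<rho>(1) \<epsilon>(1)]])
qed

lemma sum_Basis_cart: "(\<Sum>b\<in>(Basis :: (real ^ 'n::finite) set). h b) = (\<Sum>i\<in>UNIV. h (axis i 1))"
proof -
  have B: "(Basis :: (real ^ 'n) set) = range (\<lambda>i. axis i 1)" by (auto simp: Basis_vec_def)
  have i: "inj (\<lambda>i::'n. axis i (1::real))" by (auto simp: inj_on_def axis_eq_axis)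
  show ?thesis unfolding B by (subst sum.reindex[OF i]) simp
qed

lemma conv_nonneg: "(\<And>x. f x \<ge> 0) \<Longrightarrow> (\<And>x. K x \<ge> 0) \<Longrightarrow> conv K f y \<ge> 0"
  unfolding conv_def by (intro integral_nonneg_AE AE_I2) auto

lemma moll_nonneg: "(\<And>x. \<rho> x \<ge> 0) \<Longrightarrow> \<epsilon> > 0 \<Longrightarrow> moll \<rho> \<epsilon> x \<ge> 0"
  by (simp add: moll_def)

text \<open>The mollified equation holds only at distance at least \<open>\<epsilon>\<close> from
  the sphere of radius R. Since \<open>r + \<epsilon>\<close> is at most R, this covers the ball
  where \<open>\<zeta>\<close> is nonzero, and elsewhere the factor \<open>\<zeta>\<close> makes
  both sides of the substitution 0.\<close>

lemma mollified_energy: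
  fixes f g :: "real ^ 'n::finite \<Rightarrow> real"
  assumes f: "integrable lborel f" "\<And>x. f x \<ge> 0"
    and eq: "distributional_laplace f g (ball x\<^sub>0 R)"
    and \<rho>: "\<rho> \<in> Cc_infinity" "\<And>x. \<rho> x \<ge> 0" "\<And>x. norm x \<ge> 1 \<Longrightarrow> \<rho> x = 0"
    and \<epsilon>: "\<epsilon> > 0" "r + \<epsilon> \<le> R" and r: "r > 0" and \<delta>: "\<delta> > 0"
  defines "u \<equiv> conv (moll \<rho> \<epsilon>) f" and "\<zeta> \<equiv> \<lambda>x. (cutoff x\<^sub>0 r x)\<^sup>2"
  shows "\<exists>Du. (\<forall>x. GDERIV u x :> Du x) \<and> continuous_on UNIV Du \<and>
    integrable lborel (\<lambda>x. \<zeta> x * (norm (Du x) / (u x + \<delta>))\<^sup>2) \<and>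
    (\<integral>x. \<zeta> x * (norm (Du x) / (u x + \<delta>))\<^sup>2 \<partial>lborel)
      \<le> 16 / r\<^sup>2 * measure lborel (ball x\<^sub>0 r) + 2 * (\<integral>x. \<zeta> x * conv (moll \<rho> \<epsilon>) g x / (u x + \<delta>) \<partial>lborel)"
proof -
  let ?m = "moll \<rho> \<epsilon>"
  have m: "?m \<in> Cc_infinity" by (rule moll_Cc(1)[OF \<rho>(1) \<epsilon>(1)])
  note Pm = Cc_infinity_partial_deriv[OF m]
  define Du where "Du x = - (\<chi> i. conv (partial_deriv i ?m) f x)" for x
  \<comment> \<open>Linear in b, so that continuity can be shown for all b at once; on the axis
    vectors the sum collapses to the second derivatives that are needed.\<close>
  define D2 where "D2 b x = (\<chi> j. \<Sum>i\<in>UNIV. b $ i * conv (partial_deriv j (partial_deriv i ?m)) f x)" for b x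
  have Du: "GDERIV u x :> Du x" for x
    unfolding u_def Du_def by (rule conv_Cc_GDERIV[OF f(1) m])
  have cDu: "continuous_on UNIV Du"
    unfolding Du_def by (intro continuous_intros continuous_on_vec_lambda continuous_on_conv_Cc f Pm)
  have D2_axis: "D2 (axis i 1) x = (\<chi> j. conv (partial_deriv j (partial_deriv i ?m)) f x)" for i x
    by (simp add: D2_def axis_def if_distrib[of "\<lambda>c. c * _"] cong: if_cong)
  have gD2: "GDERIV (\<lambda>x. Du x \<bullet> b) x :> D2 b x" if b: "b \<in> Basis" for b x
  proof -
    obtain i where i: "b = axis i 1" using b by (auto simp: Basis_vec_def)
    have "(\<lambda>x. Du x \<bullet> b) = (\<lambda>x. - conv (partial_deriv i ?m) f x)"
      by (simp add: Du_def i inner_axis)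
    moreover have "GDERIV (\<lambda>x. - conv (partial_deriv i ?m) f x) x :> - (- (\<chi> j. conv (partial_deriv j (partial_deriv i ?m)) f x))"
      by (intro GDERIV_minus conv_Cc_GDERIV f Pm)
    ultimately show ?thesis by (simp add: i D2_axis)
  qed
  have cD2: "continuous_on UNIV (D2 b)" for b
    unfolding D2_def by (intro continuous_intros continuous_on_vec_lambda continuous_on_conv_Cc f Cc_infinity_partial_deriv Pm)
  have lap: "(\<Sum>b\<in>Basis. D2 b x \<bullet> b) = conv (laplacian ?m) f x" for x
    unfolding sum_Basis_cart conv_laplacian[OF f(1) m] by (simp add: D2_axis inner_axis)
  have u0: "u x \<ge> 0" for x
    unfolding u_def by (intro conv_nonneg f(2) moll_nonneg \<rho>(2) \<epsilon>)
  have key: "\<zeta> x * (\<Sum>b\<in>Basis. D2 b x \<bullet> b) / (u x + \<delta>) = \<zeta> x * conv ?m g x / (u x + \<delta>)" for x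
  proof (cases "norm (x - x\<^sub>0) < r")
    case True
    then have "(\<Sum>b\<in>Basis. D2 b x \<bullet> b) = conv ?m g x"
      unfolding lap using \<epsilon> by (intro conv_moll_laplacian[OF eq \<rho>(1,3)]) auto
    then show ?thesis by simp
  next
    case False
    then show ?thesis using cutoff_eq_0[OF r, of x x\<^sub>0] by (simp add: \<zeta>_def)
  qed
  note E = energy_inequality[OF u0 Du gD2 cD2 \<delta> r, of x\<^sub>0, unfolded key[unfolded \<zeta>_def]]
  show ?thesis
    unfolding \<zeta>_def by (intro exI[of _ Du] conjI allI Du cDu E)
qed

text \<open>This transfers the oscillation bound from the logarithm of a mollification to its limit,
  given closeness in \<open>L^1\<close>.\<close>

lemma double_integral_triangle:
  fixes w v :: "'a::euclidean_space \<Rightarrow> real"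
  assumes [measurable]: "w \<in> borel_measurable borel" "v \<in> borel_measurable borel" "S \<in> sets borel"
  shows "double_osc S w
    \<le> double_osc S v
      + 2 * emeasure lborel S * (\<integral>\<^sup>+x. ennreal \<bar>w x - v x\<bar> \<partial>lborel)"
proof -
  let ?e = "\<integral>\<^sup>+x. ennreal \<bar>w x - v x\<bar> \<partial>lborel"
  have "double_osc S w
    \<le> (\<integral>\<^sup>+x. \<integral>\<^sup>+y. indicator S x * (indicator S y * ennreal \<bar>v x - v y\<bar>)
        + (indicator S y * ennreal \<bar>w x - v x\<bar> + indicator S x * ennreal \<bar>w y - v y\<bar>) \<partial>lborel \<partial>lborel)"
    unfolding double_osc_def
  proof (intro nn_integral_mono)
    fix x y
    have "ennreal \<bar>w x - w y\<bar> \<le> ennreal (\<bar>v x - v y\<bar> + (\<bar>w x - v x\<bar> + \<bar>w y - v y\<bar>))"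
      by (intro ennreal_leI) linarith
    then show "indicator S x * (indicator S y * ennreal \<bar>w x - w y\<bar>)
      \<le> indicator S x * (indicator S y * ennreal \<bar>v x - v y\<bar>)
        + (indicator S y * ennreal \<bar>w x - v x\<bar> + indicator S x * ennreal \<bar>w y - v y\<bar>)"
      by (auto simp: indicator_def)
  qed
  also have "\<dots> = double_osc S v
      + (emeasure lborel S * ?e + emeasure lborel S * ?e)"
    by (simp add: double_osc_def nn_integral_add nn_integral_cmult nn_integral_multc)
  also have "emeasure lborel S * ?e + emeasure lborel S * ?e = 2 * emeasure lborel S * ?e"
    by (simp add: mult_2 distrib_right)
  finally show ?thesis .
qed

text \<open>On the half-line from \<open>\<delta>\<close> on, the logarithm is Lipschitz with
  constant \<open>1 / \<delta>\<close>. Hence \<open>L^1\<close> convergence survives taking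
  \<open>ln (u + \<delta>)\<close>.\<close>

lemma abs_ln_diff_le:
  fixes a b :: real
  assumes "\<delta> > 0" "a \<ge> \<delta>" "b \<ge> \<delta>"
  shows "\<bar>ln a - ln b\<bar> \<le> \<bar>a - b\<bar> / \<delta>"
proof -
  have *: "ln a - ln b \<le> \<bar>a - b\<bar> / \<delta>" if "a \<ge> \<delta>" "b \<ge> \<delta>" for a b
  proof -
    have "ln a - ln b = ln (a / b)" using that assms(1) by (simp add: ln_div)
    also have "\<dots> \<le> a / b - 1" using that assms(1) by (intro ln_le_minus_one) auto
    also have "\<dots> = (a - b) / b" using that assms(1) by (simp add: field_simps)
    also have "\<dots> \<le> \<bar>a - b\<bar> / \<delta>" using that assms(1) by (intro frac_le) auto
    finally show ?thesis .
  qed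
  have "ln b - ln a \<le> \<bar>a - b\<bar> / \<delta>" using *[OF assms(3,2)] by (simp add: abs_minus_commute)
  with *[OF assms(2,3)] show ?thesis by linarith
qed

text \<open>The hypothesis controls \<open>|g| / (f + \<delta>)\<close> for the unmollified pair.
  For fixed r and \<open>\<delta>\<close> the right-hand side of the energy estimate converges to an
  integral bounded by it; hence late mollifications obey the energy bound up to a fixed slack.
  Poincare's inequality turns this into an oscillation bound that passes to the limit with the same
  constant.\<close>

lemma log_oscillation:
  fixes f g :: "real ^ 'n::finite \<Rightarrow> real"
  assumes n: "CARD('n) \<ge> 2"
    and f: "integrable lborel f" "\<And>x. f x \<ge> 0" and g: "integrable lborel g"
    and eq: "distributional_laplace f g (ball x\<^sub>0 R)"
    and C: "C \<ge> 0" "\<And>r \<delta>. 0 < r \<Longrightarrow> r \<le> R \<Longrightarrow> \<delta> > 0 \<Longrightarrow>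
        (\<integral>x. indicator (ball x\<^sub>0 r) x * (\<bar>g x\<bar> / (f x + \<delta>)) \<partial>lborel) \<le> C * r ^ (CARD('n) - 2)"
  shows "\<exists>K\<ge>0. \<forall>r \<delta>. 0 < r \<longrightarrow> 3 * r \<le> R \<longrightarrow> \<delta> > 0 \<longrightarrow>
    double_osc (ball x\<^sub>0 r) (\<lambda>x. ln (f x + \<delta>))
      \<le> ennreal (K * (measure lborel (ball x\<^sub>0 r))\<^sup>2)"
proof -
  define N where "N = CARD('n)"
  define \<omega> where "\<omega> = unit_ball_vol (real N)"
  have \<omega>: "\<omega> > 0" by (simp add: \<omega>_def)
  have vol: "measure lborel (ball x\<^sub>0 r) = \<omega> * r ^ N" if "r > 0" for r
    using content_ball[of r x\<^sub>0] that by (simp add: \<omega>_def N_def)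
  \<comment> \<open>The three terms are the volume term of the energy estimate at radius
    \<open>2 r\<close>, twice the hypothesis at radius \<open>2 r\<close>, and twice the slack
    \<open>r ^ (N - 2)\<close> granted to late mollifications.\<close>
  define A where "A = 4 * 2 ^ N * \<omega> + 2 * C * 2 ^ (N - 2) + 2"
  have A: "A \<ge> 0" using \<omega> C(1) by (simp add: A_def)
  \<comment> \<open>The Poincare factor \<open>2 r * 2^N * |S|\<close> times the gradient bound
    \<open>r^(N-1) * (\<omega> / 2 + A)\<close>, divided by the square of
    \<open>|S| = \<omega> r^N\<close>; all powers of r cancel.\<close>
  define K where "K = 2 * 2 ^ N * (\<omega> / 2 + A) / \<omega>"
  obtain \<rho> :: "real ^ 'n \<Rightarrow> real" and s\<^sub>0 where \<rho>: "\<rho> \<in> Cc_infinity" "\<And>x. \<rho> x \<ge> 0" "\<And>x. norm x \<ge> 1 \<Longrightarrow> \<rho> x = 0"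
    "integrable lborel \<rho>" "(\<integral>x. \<rho> x \<partial>lborel) = 1"
    by (rule exists_mollifier) blast
  obtain B where "\<And>x. norm (\<rho> x) \<le> B" using Cc_infinity_bounded[OF \<rho>(1)] by blast
  then have B: "\<rho> x \<le> B" for x by (metis abs_le_D1 real_norm_def)
  have [measurable]: "f \<in> borel_measurable borel" "g \<in> borel_measurable borel" using f g by auto
  show ?thesis
  proof (intro exI[of _ K] conjI allI impI)
    show "K \<ge> 0" using \<omega> A by (simp add: K_def)
    fix r \<delta> :: real assume r: "r > 0" "3 * r \<le> R" and \<delta>: "\<delta> > 0"
    define S where "S = ball x\<^sub>0 r"
    have [measurable]: "S \<in> sets borel" by (simp add: S_def)
    have volS: "emeasure lborel S = ennreal (\<omega> * r ^ N)"
      using emeasure_ball[of r x\<^sub>0] r by (simp add: \<omega>_def N_def S_def)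
    \<comment> \<open>Never more than r, so that the energy ball of radius \<open>2 r\<close>
      enlarged by \<open>\<epsilon> k\<close> fits into the ball of radius
      \<open>3 r\<close>.\<close>
    define \<epsilon> where "\<epsilon> k = r * inverse (real (Suc k))" for k
    have \<epsilon>: "\<epsilon> k > 0" "\<epsilon> k \<le> r" for k
      using r by (auto simp: \<epsilon>_def intro!: mult_left_le simp: inverse_le_1_iff)
    have \<epsilon>0: "\<epsilon> \<longlonglongrightarrow> 0"
      unfolding \<epsilon>_def using tendsto_mult_right_zero[OF LIMSEQ_inverse_real_of_nat, of r] by simp
    define u where "u k = conv (moll \<rho> (\<epsilon> k)) f" for k
    define h where "h k = conv (moll \<rho> (\<epsilon> k)) g" for k
    note mCc = moll_Cc(1)[OF \<rho>(1) \<epsilon>(1)]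
    have u0: "u k x \<ge> 0" for k x unfolding u_def by (intro conv_nonneg f(2) moll_nonneg \<rho>(2) \<epsilon>)
    have "continuous_on UNIV (u k)" "continuous_on UNIV (h k)" for k
      unfolding u_def h_def by (intro continuous_on_conv_Cc f g mCc)+
    then have mu[measurable]: "u k \<in> borel_measurable borel" "h k \<in> borel_measurable borel" for k
      by (auto intro: borel_measurable_continuous_onI)
    have u_lim: "(\<lambda>k. \<integral>\<^sup>+y. ennreal \<bar>u k y - f y\<bar> \<partial>lborel) \<longlonglongrightarrow> 0"
      unfolding u_def by (rule conv_moll_L1[OF f(1) \<rho>(4,2,5) B \<epsilon>(1) \<epsilon>0])
    have h_lim: "(\<lambda>k. \<integral>\<^sup>+y. ennreal \<bar>h k y - g y\<bar> \<partial>lborel) \<longlonglongrightarrow> 0"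
      unfolding h_def by (rule conv_moll_L1[OF g \<rho>(4,2,5) B \<epsilon>(1) \<epsilon>0])
    have iu: "integrable lborel (\<lambda>y. u k y - f y)" for k
      using conv_moll_diff_finite[OF f(1) \<rho>(4,2,5) B \<epsilon>(1)] by (simp add: integrable_iff_bounded u_def[symmetric])
    have ih: "integrable lborel (\<lambda>y. h k y - g y)" for k
      using conv_moll_diff_finite[OF g \<rho>(4,2,5) B \<epsilon>(1)] by (simp add: integrable_iff_bounded h_def[symmetric])
    have "(\<lambda>k. \<integral>y. norm (u k y - f y) \<partial>lborel) \<longlonglongrightarrow> 0"
      using tendsto_enn2real[of _ 0, OF u_lim[folded ennreal_0]] iu by (simp add: integral_eq_nn_integral)
    \<comment> \<open>Since u occurs in the denominator, the limit of the integrals is taken by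
      dominated convergence, for which almost everywhere convergence is extracted along a
      subsequence.\<close>
    from tendsto_L1_AE_subseq[OF iu this] obtain s where s: "strict_mono s"
      and ae: "AE x in lborel. (\<lambda>k. u (s k) x - f x) \<longlonglongrightarrow> 0" by blast
    have hs: "(\<lambda>k. \<integral>y. norm (h (s k) y - g y) \<partial>lborel) \<longlonglongrightarrow> 0"
      using LIMSEQ_subseq_LIMSEQ[OF tendsto_enn2real[of _ 0, OF h_lim[folded ennreal_0]] s] ih by (simp add: integral_eq_nn_integral o_def)
    define \<zeta> where "\<zeta> x = (cutoff x\<^sub>0 (2 * r) x)\<^sup>2" for x
    have \<zeta>: "0 \<le> \<zeta> x" "\<zeta> x \<le> 1" for x
      using cutoff_bounds[of x\<^sub>0 "2 * r" x] by (auto simp: \<zeta>_def power_le_one)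
    have [measurable]: "\<zeta> \<in> borel_measurable borel"
      unfolding \<zeta>_def by (intro borel_measurable_continuous_onI continuous_intros continuous_on_cutoff)
    have ud: "u k x + \<delta> \<ge> \<delta>" "f x + \<delta> \<ge> \<delta>" for k x using u0[of k x] f(2)[of x] by auto
    have bd: "\<bar>a * b / (c + \<delta>)\<bar> \<le> \<bar>b\<bar> / \<delta>" if "0 \<le> a" "a \<le> 1" "c \<ge> 0" for a b c
    proof -
      have "\<bar>a * b / (c + \<delta>)\<bar> = a * \<bar>b\<bar> / (c + \<delta>)" using that \<delta> by (simp add: abs_mult)
      also have "\<dots> \<le> \<bar>b\<bar> / \<delta>" using that \<delta> by (intro frac_le mult_left_le_one_le) auto
      finally show ?thesis .
    qed
    define J where "J k = (\<integral>x. \<zeta> x * h (s k) x / (u (s k) x + \<delta>) \<partial>lborel)" for k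
    have J: "J \<longlonglongrightarrow> (\<integral>x. \<zeta> x * g x / (f x + \<delta>) \<partial>lborel)"
    proof -
      have i1: "integrable lborel (\<lambda>x. \<zeta> x * (h (s k) x - g x) / (u (s k) x + \<delta>))" for k
        by (rule Bochner_Integration.integrable_bound[OF integrable_divide[OF ih[of "s k"], of \<delta>]])
           (use bd \<zeta> u0 \<delta> in auto)
      have i2: "integrable lborel (\<lambda>x. \<zeta> x * g x / (u (s k) x + \<delta>))" for k
        by (rule Bochner_Integration.integrable_bound[OF integrable_divide[OF g, of \<delta>]])
           (use bd \<zeta> u0 \<delta> in auto)
      \<comment> \<open>The numerator is only known to converge in \<open>L^1\<close>, the
        denominator almost everywhere, so the two limits are separated. The first integral tends to
        0 because the denominators are at least \<open>\<delta>\<close>; the second is dominated by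
        \<open>|g| / \<delta>\<close>.\<close>
      have Jeq: "J k = (\<integral>x. \<zeta> x * (h (s k) x - g x) / (u (s k) x + \<delta>) \<partial>lborel) + (\<integral>x. \<zeta> x * g x / (u (s k) x + \<delta>) \<partial>lborel)" for k
        unfolding J_def Bochner_Integration.integral_add[OF i1 i2, symmetric]
        by (intro Bochner_Integration.integral_cong) (auto simp: right_diff_distrib diff_divide_distrib)
      have l1: "(\<lambda>k. \<integral>x. \<zeta> x * (h (s k) x - g x) / (u (s k) x + \<delta>) \<partial>lborel) \<longlonglongrightarrow> 0"
      proof (rule Lim_null_comparison)
        show "(\<lambda>k. (\<integral>y. norm (h (s k) y - g y) \<partial>lborel) / \<delta>) \<longlonglongrightarrow> 0"
          using tendsto_divide[OF hs tendsto_const[of \<delta>]] \<delta> by simp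
        show "\<forall>\<^sub>F k in sequentially. norm (\<integral>x. \<zeta> x * (h (s k) x - g x) / (u (s k) x + \<delta>) \<partial>lborel) \<le> (\<integral>y. norm (h (s k) y - g y) \<partial>lborel) / \<delta>"
          unfolding integral_divide_zero[symmetric]
        proof (intro always_eventually allI order_trans[OF integral_norm_bound integral_mono])
          show "norm (\<zeta> x * (h (s k) x - g x) / (u (s k) x + \<delta>)) \<le> norm (h (s k) x - g x) / \<delta>" for x k
            using bd[OF \<zeta> u0] by simp
        qed (intro integrable_norm i1 integrable_divide ih)+
      qed
      have l2: "(\<lambda>k. \<integral>x. \<zeta> x * g x / (u (s k) x + \<delta>) \<partial>lborel) \<longlonglongrightarrow> (\<integral>x. \<zeta> x * g x / (f x + \<delta>) \<partial>lborel)"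
      proof (rule integral_dominated_convergence[where w = "\<lambda>x. \<bar>g x\<bar> / \<delta>"])
        show "AE x in lborel. (\<lambda>k. \<zeta> x * g x / (u (s k) x + \<delta>)) \<longlonglongrightarrow> \<zeta> x * g x / (f x + \<delta>)"
          using ae
        proof eventually_elim
          case (elim x)
          then have "(\<lambda>k. u (s k) x) \<longlonglongrightarrow> f x" using LIM_zero_iff by blast
          moreover have "f x + \<delta> \<noteq> 0" using ud(2)[of x] \<delta> by linarith
          ultimately show ?case by (intro tendsto_intros)
        qed
      qed (use g bd \<zeta> u0 in auto)
      from tendsto_add[OF l1 l2] show ?thesis unfolding Jeq[symmetric] by simp
    qed
    have "(\<integral>x. \<zeta> x * g x / (f x + \<delta>) \<partial>lborel) \<le> C * (2 * r) ^ (N - 2)"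
    proof -
      have "(\<integral>x. \<zeta> x * g x / (f x + \<delta>) \<partial>lborel) \<le> (\<integral>x. indicator (ball x\<^sub>0 (2 * r)) x * (\<bar>g x\<bar> / (f x + \<delta>)) \<partial>lborel)"
      proof (rule integral_mono)
        show "integrable lborel (\<lambda>x. \<zeta> x * g x / (f x + \<delta>))"
          by (rule Bochner_Integration.integrable_bound[OF integrable_divide[OF g, of \<delta>]])
             (use bd \<zeta> f \<delta> in auto)
        show "integrable lborel (\<lambda>x. indicator (ball x\<^sub>0 (2 * r)) x * (\<bar>g x\<bar> / (f x + \<delta>)))"
        proof (rule Bochner_Integration.integrable_bound[OF integrable_divide[OF g, of \<delta>]])
          show "AE x in lborel. norm (indicat_real (ball x\<^sub>0 (2 * r)) x * (\<bar>g x\<bar> / (f x + \<delta>))) \<le> norm (g x / \<delta>)"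
            using bd[of "indicator (ball x\<^sub>0 (2 * r)) _" "f _" "\<bar>g _\<bar>"] f \<delta> by (intro AE_I2) (auto simp: indicator_def)
        qed (intro borel_measurable_times borel_measurable_indicator, simp, simp)
        fix x
        show "\<zeta> x * g x / (f x + \<delta>) \<le> indicator (ball x\<^sub>0 (2 * r)) x * (\<bar>g x\<bar> / (f x + \<delta>))"
        proof (cases "norm (x - x\<^sub>0) < 2 * r")
          case True
          have "\<zeta> x * g x \<le> \<zeta> x * \<bar>g x\<bar>" using \<zeta> by (intro mult_left_mono) auto
          also have "\<dots> \<le> \<bar>g x\<bar>" using \<zeta> by (intro mult_left_le_one_le) auto
          finally have "\<zeta> x * g x / (f x + \<delta>) \<le> \<bar>g x\<bar> / (f x + \<delta>)" using ud(2)[of x] \<delta> by (intro divide_right_mono) auto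
          then show ?thesis using True by (simp add: dist_norm norm_minus_commute)
        next
          case False
          then have "\<zeta> x = 0" using cutoff_eq_0[of "2 * r" x x\<^sub>0] r by (simp add: \<zeta>_def)
          then show ?thesis using ud(2)[of x] \<delta> by simp
        qed
      qed
      also have "\<dots> \<le> C * (2 * r) ^ (N - 2)" using C(2)[of "2 * r" \<delta>] r \<delta> by (simp add: N_def)
      finally show ?thesis .
    qed
    \<comment> \<open>The slack makes the inequality strict, so that it holds for all late members
      of the sequence; being a multiple of \<open>r ^ (N - 2)\<close> it does not spoil the
      scaling.\<close>
    also have "\<dots> < C * (2 * r) ^ (N - 2) + r ^ (N - 2)" using r by simp
    finally have ev: "\<forall>\<^sub>F k in sequentially. J k < C * (2 * r) ^ (N - 2) + r ^ (N - 2)"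
      by (rule order_tendstoD(2)[OF J])
    let ?D = "double_osc S"
    let ?w = "\<lambda>x. ln (f x + \<delta>)"
    have bound: "?D (\<lambda>x. ln (u (s k) x + \<delta>)) \<le> ennreal (K * (measure lborel S)\<^sup>2)"
      if Jk: "J k < C * (2 * r) ^ (N - 2) + r ^ (N - 2)" for k
    proof -
      let ?u = "u (s k)"
      obtain Du where Du: "\<And>x. GDERIV ?u x :> Du x" "continuous_on UNIV Du"
        and iW: "integrable lborel (\<lambda>x. \<zeta> x * (norm (Du x) / (?u x + \<delta>))\<^sup>2)"
        and E: "(\<integral>x. \<zeta> x * (norm (Du x) / (?u x + \<delta>))\<^sup>2 \<partial>lborel)
          \<le> 16 / (2 * r)\<^sup>2 * measure lborel (ball x\<^sub>0 (2 * r)) + 2 * J k"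
        using mollified_energy[OF f eq \<rho>(1-3) \<epsilon>(1)[of "s k"], of "2 * r" \<delta>] r \<delta> \<epsilon>(2)[of "s k"]
        unfolding u_def[symmetric] h_def[symmetric] \<zeta>_def[symmetric] J_def by auto
      have r2: "r ^ N = r ^ (N - 2) * r\<^sup>2" 
      proof -
        have "N = (N - 2) + 2" using n by (simp add: N_def)
        then show ?thesis by (metis power_add)
      qed
      have E': "(\<integral>x. \<zeta> x * (norm (Du x) / (?u x + \<delta>))\<^sup>2 \<partial>lborel) \<le> A * r ^ (N - 2)"
      proof -
        have "16 / (2 * r)\<^sup>2 * measure lborel (ball x\<^sub>0 (2 * r)) = 4 * 2 ^ N * \<omega> * r ^ (N - 2)"
          using r by (simp add: vol power_mult_distrib r2 field_simps)
        then show ?thesis using E Jk by (simp add: A_def power_mult_distrib algebra_simps)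
      qed
      have nz: "?u x + \<delta> > 0" for x using ud(1)[of "s k" x] \<delta> by linarith
      define Dw where "Dw x = inverse (?u x + \<delta>) *\<^sub>R Du x" for x
      have gw: "GDERIV (\<lambda>x. ln (?u x + \<delta>)) x :> Dw x" for x
      proof -
        have "GDERIV (\<lambda>x. ?u x + \<delta>) x :> Du x" using GDERIV_add[OF Du(1)[of x] GDERIV_const[of \<delta>]] by simp
        from GDERIV_DERIV_compose[OF this DERIV_ln[OF nz]] show ?thesis by (simp add: Dw_def)
      qed
      have cw: "continuous_on UNIV Dw"
        unfolding Dw_def using nz by (intro continuous_intros Du(2) GDERIV_continuous_on[OF Du(1)]) (auto simp: less_le)
      have nDw: "norm (Dw x) = norm (Du x) / (?u x + \<delta>)" for x
        using nz[of x] by (simp add: Dw_def divide_inverse mult.commute)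
      \<comment> \<open>A pointwise replacement for the Cauchy-Schwarz inequality: W is at most
        \<open>1 / (2 r) + r W^2 / 2\<close>, and \<open>\<zeta>\<close> is at least 9/16, hence at
        least 1/2, on S. The weight r makes both terms scale alike.\<close>
      have "(\<integral>\<^sup>+x. indicator S x * ennreal (norm (Dw x)) \<partial>lborel)
         \<le> (\<integral>\<^sup>+x. ennreal (indicator S x / (2 * r) + r * (\<zeta> x * (norm (Dw x))\<^sup>2)) \<partial>lborel)"
      proof (intro nn_integral_mono)
        fix x
        show "indicator S x * ennreal (norm (Dw x)) \<le> ennreal (indicator S x / (2 * r) + r * (\<zeta> x * (norm (Dw x))\<^sup>2))"
        proof (cases "x \<in> S")
          case True
          let ?W = "norm (Dw x)"
          have "cutoff x\<^sub>0 (2 * r) x \<ge> 3 / 4" using cutoff_ge[OF r(1), of x x\<^sub>0] True by (simp add: S_def dist_norm norm_minus_commute)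
          then have "(3 / 4)\<^sup>2 \<le> \<zeta> x" unfolding \<zeta>_def by (intro power_mono) auto
          then have "1 / 2 \<le> \<zeta> x" by (simp add: power2_eq_square)
          then have z: "1 / 2 * ?W\<^sup>2 \<le> \<zeta> x * ?W\<^sup>2" by (intro mult_right_mono) auto
          have "2 * ?W * r \<le> 1 + (?W * r)\<^sup>2"
            using sum_squares_bound[of 1 "?W * r"] by simp
          then have "?W \<le> 1 / (2 * r) + r * (1 / 2 * ?W\<^sup>2)"
            using r by (simp add: field_simps power2_eq_square)
          also have "\<dots> \<le> 1 / (2 * r) + r * (\<zeta> x * ?W\<^sup>2)" using z r by (intro add_left_mono mult_left_mono) auto
          finally show ?thesis using True by (simp add: ennreal_leI)
        qed simp
      qed
      also have "\<dots> = ennreal (\<integral>x. indicator S x / (2 * r) + r * (\<zeta> x * (norm (Dw x))\<^sup>2) \<partial>lborel)"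
        using iW volS \<zeta> r by (intro nn_integral_eq_integral) (auto simp: nDw)
      also have "(\<integral>x. indicator S x / (2 * r) + r * (\<zeta> x * (norm (Dw x))\<^sup>2) \<partial>lborel) = \<omega> * r ^ N / (2 * r) + r * (\<integral>x. \<zeta> x * (norm (Dw x))\<^sup>2 \<partial>lborel)"
        using iW volS \<omega> r by (subst Bochner_Integration.integral_add) (auto simp: nDw S_def vol)
      also have "ennreal \<dots> \<le> ennreal (r ^ (N - 2) * r * (\<omega> / 2 + A))"
      proof (rule ennreal_leI)
        have "r * (\<integral>x. \<zeta> x * (norm (Dw x))\<^sup>2 \<partial>lborel) \<le> r * (A * r ^ (N - 2))"
          using E' r by (intro mult_left_mono) (auto simp: nDw)
        moreover have "\<omega> * r ^ N / (2 * r) = r ^ (N - 2) * r * (\<omega> / 2)"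
          using r by (simp add: r2 power2_eq_square)
        ultimately show "\<omega> * r ^ N / (2 * r) + r * (\<integral>x. \<zeta> x * (norm (Dw x))\<^sup>2 \<partial>lborel) \<le> r ^ (N - 2) * r * (\<omega> / 2 + A)"
          by (simp add: algebra_simps)
      qed
      finally have I: "(\<integral>\<^sup>+x. indicator S x * ennreal (norm (Dw x)) \<partial>lborel) \<le> ennreal (r ^ (N - 2) * r * (\<omega> / 2 + A))" .
      have "?D (\<lambda>x. ln (?u x + \<delta>)) \<le> ennreal (2 * r) * 2 ^ N * emeasure lborel S * (\<integral>\<^sup>+x. indicator S x * ennreal (norm (Dw x)) \<partial>lborel)"
        using poincare_double_integral[OF gw cw, of x\<^sub>0 r] by (simp add: S_def N_def)
      also have "\<dots> \<le> ennreal (2 * r) * 2 ^ N * emeasure lborel S * ennreal (r ^ (N - 2) * r * (\<omega> / 2 + A))"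
        by (intro mult_left_mono I) auto
      also have "\<dots> = ennreal (2 * r) * ennreal (2 ^ N) * ennreal (\<omega> * r ^ N) * ennreal (r ^ (N - 2) * r * (\<omega> / 2 + A))"
        by (simp add: volS flip: ennreal_power)
      also have "\<dots> = ennreal (2 * r * 2 ^ N * (\<omega> * r ^ N) * (r ^ (N - 2) * r * (\<omega> / 2 + A)))"
        using r \<omega> A by (simp add: ennreal_mult)
      also have "2 * r * 2 ^ N * (\<omega> * r ^ N) * (r ^ (N - 2) * r * (\<omega> / 2 + A)) = K * (measure lborel S)\<^sup>2"
        using \<omega> by (simp add: K_def S_def vol[OF r(1)] r2 power2_eq_square)
      finally show ?thesis .
    qed
    have mw: "?w \<in> borel_measurable borel" "(\<lambda>x. ln (u k x + \<delta>)) \<in> borel_measurable borel" for k by measurable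
    let ?e = "\<lambda>k. \<integral>\<^sup>+y. ennreal \<bar>u (s k) y - f y\<bar> \<partial>lborel"
    have fin: "?D ?w \<le> ennreal (K * (measure lborel S)\<^sup>2) + 2 * emeasure lborel S * (ennreal (1 / \<delta>) * ?e k)"
      if Jk: "J k < C * (2 * r) ^ (N - 2) + r ^ (N - 2)" for k
    proof -
      have "(\<integral>\<^sup>+x. ennreal \<bar>?w x - ln (u (s k) x + \<delta>)\<bar> \<partial>lborel) \<le> (\<integral>\<^sup>+x. ennreal (1 / \<delta>) * ennreal \<bar>u (s k) x - f x\<bar> \<partial>lborel)"
      proof (intro nn_integral_mono)
        fix x
        have "\<bar>?w x - ln (u (s k) x + \<delta>)\<bar> \<le> 1 / \<delta> * \<bar>u (s k) x - f x\<bar>"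
          using abs_ln_diff_le[OF \<delta> ud(2)[of x] ud(1)[of "s k" x]] by (simp add: abs_minus_commute)
        then show "ennreal \<bar>?w x - ln (u (s k) x + \<delta>)\<bar> \<le> ennreal (1 / \<delta>) * ennreal \<bar>u (s k) x - f x\<bar>"
          using \<delta> by (subst ennreal_mult[symmetric]) (auto intro: ennreal_leI)
      qed
      also have "\<dots> = ennreal (1 / \<delta>) * ?e k" by (intro nn_integral_cmult) measurable
      finally have "(\<integral>\<^sup>+x. ennreal \<bar>?w x - ln (u (s k) x + \<delta>)\<bar> \<partial>lborel) \<le> ennreal (1 / \<delta>) * ?e k" .
      then show ?thesis
        using bound[OF Jk]
        by (intro order_trans[OF double_integral_triangle[OF mw(1) mw(2)[of "s k"], of S]] add_mono mult_left_mono) auto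
    qed
    have lim: "(\<lambda>k. ennreal (K * (measure lborel S)\<^sup>2) + 2 * emeasure lborel S * (ennreal (1 / \<delta>) * ?e k)) \<longlonglongrightarrow> ennreal (K * (measure lborel S)\<^sup>2) + 2 * emeasure lborel S * (ennreal (1 / \<delta>) * 0)"
    proof -
      have "?e \<longlonglongrightarrow> 0" using LIMSEQ_subseq_LIMSEQ[OF u_lim s] by (simp add: o_def)
      then show ?thesis
        by (intro tendsto_add ennreal_tendsto_cmult tendsto_const) (auto simp: volS ennreal_mult_less_top)
    qed
    have "?D ?w \<le> ennreal (K * (measure lborel S)\<^sup>2) + 2 * emeasure lborel S * (ennreal (1 / \<delta>) * 0)"
      by (rule tendsto_lowerbound[OF lim]) (use ev fin in \<open>auto elim: eventually_mono\<close>)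
    then show "double_osc (ball x\<^sub>0 r) (\<lambda>x. ln (f x + \<delta>))
      \<le> ennreal (K * (measure lborel (ball x\<^sub>0 r))\<^sup>2)" by (simp add: S_def)
  qed
qed

section \<open>Zeros of infinite order\<close>

text \<open>Integrating \<open>w y - w x\<close> over y in S and x in A leaves the difference of the
  two means, multiplied by both measures; the absolute values are then part of
  \<open>double_osc S w\<close>. Later A is either a ball of half the radius or a level set of
  f.\<close>

lemma integral_oscillation:
  fixes w :: "'a::euclidean_space \<Rightarrow> real"
  assumes [measurable]: "A \<in> sets borel" "S \<in> sets borel" and AS: "A \<subseteq> S" "emeasure lborel S < \<infinity>"
    and [measurable]: "w \<in> borel_measurable borel" and iS: "integrable lborel (\<lambda>x. indicator S x * w x)"
    and D: "double_osc S w \<le> ennreal D" "D \<ge> 0"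
  shows "\<bar>measure lborel A * (\<integral>x. indicator S x * w x \<partial>lborel) - measure lborel S * (\<integral>x. indicator A x * w x \<partial>lborel)\<bar> \<le> D"
proof -
  let ?I = "\<integral>x. indicator S x * w x \<partial>lborel"
  have fA: "emeasure lborel A < \<infinity>" using AS emeasure_mono[of A S lborel] by (auto simp: order_le_less_trans)
  have "integrable lborel (\<lambda>x. indicator A x *\<^sub>R (indicator S x * w x))"
    by (rule integrable_mult_indicator) (use iS in auto)
  moreover have "(\<lambda>x. indicator A x *\<^sub>R (indicator S x * w x)) = (\<lambda>x. indicator A x * w x)"
    using AS by (auto simp: indicator_def fun_eq_iff)
  ultimately have iA: "integrable lborel (\<lambda>x. indicator A x * w x)" by simp
  have iA': "integrable lborel (\<lambda>x. ?I * indicator A x - measure lborel S * (indicator A x * w x))"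
    using fA iA by simp
  have "measure lborel A * ?I - measure lborel S * (\<integral>x. indicator A x * w x \<partial>lborel)
     = (\<integral>x. ?I * indicator A x - measure lborel S * (indicator A x * w x) \<partial>lborel)"
    using fA iA by simp
  then have "ennreal \<bar>measure lborel A * ?I - measure lborel S * (\<integral>x. indicator A x * w x \<partial>lborel)\<bar>
     \<le> (\<integral>\<^sup>+x. norm (?I * indicator A x - measure lborel S * (indicator A x * w x)) \<partial>lborel)"
    using integral_norm_bound_ennreal[OF iA'] by simp
  also have "\<dots> \<le> double_osc S w"
    unfolding double_osc_def
  proof (intro nn_integral_mono)
    fix x
    show "ennreal (norm (?I * indicator A x - measure lborel S * (indicator A x * w x)))
      \<le> (\<integral>\<^sup>+y. indicator S x * (indicator S y * ennreal \<bar>w x - w y\<bar>) \<partial>lborel)"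
    proof (cases "x \<in> A")
      case True
      have i: "integrable lborel (\<lambda>y. indicator S y * w y - w x * indicator S y)" using iS AS(2) by simp
      have "?I - measure lborel S * w x = (\<integral>y. indicator S y * w y - w x * indicator S y \<partial>lborel)"
        using iS AS(2) by simp
      then have "ennreal (norm (?I - measure lborel S * w x)) \<le> (\<integral>\<^sup>+y. norm (indicator S y * w y - w x * indicator S y) \<partial>lborel)"
        using integral_norm_bound_ennreal[OF i] by simp
      also have "\<dots> = (\<integral>\<^sup>+y. indicator S x * (indicator S y * ennreal \<bar>w x - w y\<bar>) \<partial>lborel)"
        using True AS(1) by (intro nn_integral_cong) (auto simp: indicator_def abs_minus_commute)
      finally show ?thesis using True by simp
    qed simp
  qed
  finally have "ennreal \<bar>measure lborel A * ?I - measure lborel S * (\<integral>x. indicator A x * w x \<partial>lborel)\<bar> \<le> ennreal D"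
    using D(1) by (rule order_trans)
  then show ?thesis using D(2) by simp
qed

lemma integrable_ln_shift:
  fixes f :: "'a::euclidean_space \<Rightarrow> real"
  assumes f: "integrable lborel f" "\<And>x. f x \<ge> 0" and \<delta>: "\<delta> > 0" and S: "S \<in> sets borel" "emeasure lborel S < \<infinity>"
  shows "integrable lborel (\<lambda>x. indicator S x * ln (f x + \<delta>))"
proof (rule Bochner_Integration.integrable_bound)
  have [measurable]: "f \<in> borel_measurable borel" "S \<in> sets borel" using f S by auto
  show "integrable lborel (\<lambda>x. \<bar>ln \<delta>\<bar> * indicator S x + f x / \<delta>)" using f S by simp
  show "(\<lambda>x. indicator S x * ln (f x + \<delta>)) \<in> borel_measurable lborel" by measurable
  show "AE x in lborel. norm (indicat_real S x * ln (f x + \<delta>)) \<le> norm (\<bar>ln \<delta>\<bar> * indicat_real S x + f x / \<delta>)"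
  proof (intro AE_I2)
    fix x
    have "\<bar>ln (f x + \<delta>) - ln \<delta>\<bar> \<le> f x / \<delta>" using abs_ln_diff_le[OF \<delta>, of "f x + \<delta>" \<delta>] f(2)[of x] by simp
    then have "\<bar>ln (f x + \<delta>)\<bar> \<le> \<bar>ln \<delta>\<bar> + f x / \<delta>" by linarith
    then show "norm (indicat_real S x * ln (f x + \<delta>)) \<le> norm (\<bar>ln \<delta>\<bar> * indicat_real S x + f x / \<delta>)"
      using f(2)[of x] \<delta> by (auto simp: indicator_def)
  qed
qed

text \<open>The logarithm lies below its tangent at c, the mean of \<open>f + \<delta>\<close>;
  integrating the tangent line over S gives exactly \<open>ln c\<close> times the measure.\<close>

lemma jensen_ln:
  fixes f :: "'a::euclidean_space \<Rightarrow> real"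
  assumes f: "integrable lborel f" "\<And>x. f x \<ge> 0" and \<delta>: "\<delta> > 0" and S: "S \<in> sets borel" "emeasure lborel S < \<infinity>"
    and pos: "measure lborel S > 0"
  shows "(\<integral>x. indicator S x * ln (f x + \<delta>) \<partial>lborel) / measure lborel S
    \<le> ln ((\<integral>x. indicator S x * f x \<partial>lborel) / measure lborel S + \<delta>)"
proof -
  have [measurable]: "f \<in> borel_measurable borel" "S \<in> sets borel" using f S by auto
  let ?V = "measure lborel S"
  define c where "c = (\<integral>x. indicator S x * f x \<partial>lborel) / ?V + \<delta>"
  have ifS: "integrable lborel (\<lambda>x. indicator S x * f x)"
    using integrable_mult_indicator[of S lborel f] f by simp
  have "(\<integral>x. indicator S x * f x \<partial>lborel) \<ge> 0" using f(2) by (intro integral_nonneg_AE) auto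
  then have c: "c > 0" using \<delta> pos by (simp add: c_def add_nonneg_pos)
  have "(\<integral>x. indicator S x * ln (f x + \<delta>) \<partial>lborel) \<le> (\<integral>x. (ln c - 1 + \<delta> / c) * indicator S x + (indicator S x * f x) / c \<partial>lborel)"
  proof (rule integral_mono)
    show "integrable lborel (\<lambda>x. indicat_real S x * ln (f x + \<delta>))" by (rule integrable_ln_shift[OF f \<delta> S])
    show "integrable lborel (\<lambda>x. (ln c - 1 + \<delta> / c) * indicat_real S x + indicat_real S x * f x / c)"
      using S ifS by simp
    fix x
    have p: "f x + \<delta> > 0" using f(2)[of x] \<delta> by linarith
    have "ln (f x + \<delta>) - ln c = ln ((f x + \<delta>) / c)" using p c by (simp add: ln_div)
    also have "\<dots> \<le> (f x + \<delta>) / c - 1" using p c by (intro ln_le_minus_one) auto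
    finally show "indicat_real S x * ln (f x + \<delta>) \<le> (ln c - 1 + \<delta> / c) * indicat_real S x + indicat_real S x * f x / c"
      by (auto simp: indicator_def add_divide_distrib)
  qed
  also have "\<dots> = (ln c - 1 + \<delta> / c) * ?V + (\<integral>x. indicator S x * f x \<partial>lborel) / c"
    using S ifS by simp
  also have "(\<integral>x. indicator S x * f x \<partial>lborel) = (c - \<delta>) * ?V" using pos by (simp add: c_def)
  also have "(ln c - 1 + \<delta> / c) * ?V + (c - \<delta>) * ?V / c = ln c * ?V"
    using c by (simp add: field_simps)
  finally show ?thesis using pos by (simp add: c_def[symmetric] pos_divide_le_eq)
qed

text \<open>Each halving of the radius lowers the mean of \<open>ln (f + \<delta>)\<close> by at most \<open>C = K 2 ^ n\<close>. If \<open>f > a\<close> on a set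
  \<open>A\<close> of positive measure, then comparing the means over \<open>A\<close> and over the ball of radius \<open>R\<close> bounds the
  latter below by a constant \<open>L\<close> not depending on \<open>\<delta>\<close>.\<close>

lemma infinite_order_zero_vanishes:
  fixes f :: "'a::euclidean_space \<Rightarrow> real"
  assumes f: "integrable lborel f" "\<And>x. f x \<ge> 0" and R: "R > 0" and K: "K \<ge> 0"
    and osc: "\<And>r \<delta>. 0 < r \<Longrightarrow> r \<le> R \<Longrightarrow> \<delta> > 0 \<Longrightarrow>
    double_osc (ball x\<^sub>0 r) (\<lambda>x. ln (f x + \<delta>))
      \<le> ennreal (K * (measure lborel (ball x\<^sub>0 r))\<^sup>2)"
    and inf: "\<And>m::real. m > 0 \<Longrightarrow> (\<lambda>\<epsilon>. \<integral>x. indicator (ball x\<^sub>0 \<epsilon>) x * f x \<partial>lborel) \<in> O[at_right 0](\<lambda>\<epsilon>. \<epsilon> powr m)"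
  shows "AE x in lborel. x \<in> ball x\<^sub>0 R \<longrightarrow> f x = 0"
proof (rule ccontr)
  assume neg: "\<not> ?thesis"
  have [measurable]: "f \<in> borel_measurable borel" using f by auto
  define N where "N = DIM('a)"
  define \<omega> where "\<omega> = unit_ball_vol (real N)"
  have \<omega>: "\<omega> > 0" by (simp add: \<omega>_def)
  have vol: "measure lborel (ball x\<^sub>0 r) = \<omega> * r ^ N" if "r > 0" for r
    using content_ball[of r x\<^sub>0] that by (simp add: \<omega>_def N_def)
  have fin: "emeasure lborel (ball x\<^sub>0 r) < \<infinity>" for r by (rule emeasure_lborel_ball_finite)
  let ?B = "\<lambda>r. ball x\<^sub>0 r"
  have osc': "\<bar>(\<integral>x. indicator (?B r) x * ln (f x + \<delta>) \<partial>lborel) / measure lborel (?B r) - (\<integral>x. indicator A x * ln (f x + \<delta>) \<partial>lborel) / measure lborel A\<bar>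
      \<le> K * measure lborel (?B r) / measure lborel A"
    if "0 < r" "r \<le> R" "\<delta> > 0" "A \<in> sets borel" "A \<subseteq> ?B r" "measure lborel A > 0" for r \<delta> A
  proof -
    let ?V = "measure lborel (?B r)" and ?a = "measure lborel A"
    let ?I = "\<integral>x. indicator (?B r) x * ln (f x + \<delta>) \<partial>lborel" and ?J = "\<integral>x. indicator A x * ln (f x + \<delta>) \<partial>lborel"
    have V: "?V > 0" using that \<omega> by (simp add: vol)
    have "\<bar>?a * ?I - ?V * ?J\<bar> \<le> K * ?V\<^sup>2"
      by (rule integral_oscillation[OF that(4) _ that(5) fin _ integrable_ln_shift[OF f that(3) _ fin] osc[OF that(1-3)]])
         (use K in auto)
    moreover have "?I / ?V - ?J / ?a = (?a * ?I - ?V * ?J) / (?V * ?a)"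
      using V that(6) by (simp add: field_simps)
    ultimately have "\<bar>?I / ?V - ?J / ?a\<bar> \<le> K * ?V\<^sup>2 / (?V * ?a)"
      using V that(6) by (simp add: divide_right_mono)
    also have "\<dots> = K * ?V / ?a" using V by (simp add: power2_eq_square)
    finally show ?thesis .
  qed
  define M where "M k \<delta> = (\<integral>x. indicator (?B (R / 2 ^ k)) x * ln (f x + \<delta>) \<partial>lborel) / measure lborel (?B (R / 2 ^ k))" for k \<delta>
  define C where "C = K * 2 ^ N"
  have C: "C \<ge> 0" using K by (simp add: C_def)
  have Rk: "R / 2 ^ k > 0" "R / 2 ^ k \<le> R" for k using R by (auto simp: field_simps)
  have step: "M k \<delta> - C \<le> M (Suc k) \<delta>" if "\<delta> > 0" for k \<delta>
  proof -
    have V: "measure lborel (?B (R / 2 ^ Suc k)) > 0" using vol[OF Rk(1)] R \<omega> by simp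
    have "\<bar>M k \<delta> - M (Suc k) \<delta>\<bar> \<le> K * measure lborel (?B (R / 2 ^ k)) / measure lborel (?B (R / 2 ^ Suc k))"
      unfolding M_def by (rule osc'[OF Rk that _ _ V]) (use R in \<open>auto simp: field_simps\<close>)
    also have "\<dots> = C"
      using R \<omega> unfolding vol[OF Rk(1)] C_def by (simp add: field_simps power_mult_distrib power_divide)
    finally show ?thesis by linarith
  qed
  have iter: "M 0 \<delta> - real k * C \<le> M k \<delta>" if "\<delta> > 0" for k \<delta>
    by (induction k) (use step[OF that] in \<open>auto simp: algebra_simps intro: order_trans\<close>)
  \<comment> \<open>Countably many level sets exhaust the set where f is positive, so one of them is
    not null. A strictly positive level is needed for a lower bound on the logarithm that does not
    depend on \<open>\<delta>\<close>.\<close>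
  have "\<exists>n. emeasure lborel {x \<in> ?B R. f x > inverse (real (Suc n))} \<noteq> 0"
  proof (rule ccontr)
    assume "\<not> ?thesis"
    then have "AE x in lborel. \<not> (x \<in> ?B R \<and> f x > inverse (real (Suc n)))" for n
      by (subst AE_iff_measurable[OF _ refl]) auto
    then have "AE x in lborel. \<forall>n. \<not> (x \<in> ?B R \<and> f x > inverse (real (Suc n)))"
      by (subst AE_all_countable) blast
    then have "AE x in lborel. x \<in> ?B R \<longrightarrow> f x = 0"
    proof eventually_elim
      case (elim x)
      show ?case
      proof (rule impI, rule ccontr)
        assume x: "x \<in> ?B R" "f x \<noteq> 0"
        then have "f x > 0" using f(2)[of x] by simp
        then obtain n where "inverse (real (Suc n)) < f x" using reals_Archimedean by blast
        then show False using elim x by blast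
      qed
    qed
    then show False using neg by simp
  qed
  then obtain n where n: "emeasure lborel {x \<in> ?B R. f x > inverse (real (Suc n))} \<noteq> 0" by blast
  define a where "a = inverse (real (Suc n))"
  have a: "a > 0" by (simp add: a_def)
  define A where "A = {x \<in> ?B R. f x > a}"
  have Am[measurable]: "A \<in> sets borel" unfolding A_def by measurable
  have AB: "A \<subseteq> ?B R" by (auto simp: A_def)
  have fA: "emeasure lborel A < \<infinity>" using emeasure_mono[OF AB, of lborel] fin[of R] by (simp add: order_le_less_trans)
  have A0: "measure lborel A > 0"
    using n fA unfolding A_def a_def measure_def by (simp add: enn2real_positive_iff zero_less_iff_neq_zero)
  define L where "L = ln a - K * measure lborel (?B R) / measure lborel A"
  have M0: "M 0 \<delta> \<ge> L" if \<delta>: "\<delta> > 0" for \<delta>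
  proof -
    have "ln a * measure lborel A = (\<integral>x. indicator A x * ln a \<partial>lborel)" using fA by simp
    also have "\<dots> \<le> (\<integral>x. indicator A x * ln (f x + \<delta>) \<partial>lborel)"
    proof (rule integral_mono)
      show "integrable lborel (\<lambda>x. indicat_real A x * ln a)" using fA by simp
      show "integrable lborel (\<lambda>x. indicat_real A x * ln (f x + \<delta>))"
        using fA by (intro integrable_ln_shift f \<delta>) auto
      show "indicat_real A x * ln a \<le> indicat_real A x * ln (f x + \<delta>)" for x
        using a \<delta> by (auto simp: indicator_def A_def intro!: ln_mono)
    qed
    finally have "ln a \<le> (\<integral>x. indicator A x * ln (f x + \<delta>) \<partial>lborel) / measure lborel A"
      using A0 by (simp add: pos_le_divide_eq)
    moreover have "\<bar>M 0 \<delta> - (\<integral>x. indicator A x * ln (f x + \<delta>) \<partial>lborel) / measure lborel A\<bar> \<le> K * measure lborel (?B R) / measure lborel A"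
      using osc'[OF R order_refl \<delta> Am AB A0] by (simp add: M_def)
    ultimately show ?thesis unfolding L_def by linarith
  qed
  define I where "I \<epsilon> = (\<integral>x. indicator (?B \<epsilon>) x * f x \<partial>lborel)" for \<epsilon>
  \<comment> \<open>Up to constants, this bounds the integral of f over the ball of radius
    \<open>R / 2 ^ k\<close> below by the power \<open>N + C / ln 2\<close> of that radius.\<close>
  have lower: "exp (L - real k * C) * (\<omega> * (R / 2 ^ k) ^ N) \<le> I (R / 2 ^ k)" for k
  proof -
    let ?V = "measure lborel (?B (R / 2 ^ k))"
    have V: "?V > 0" using vol[OF Rk(1)[of k]] R \<omega> by simp
    have I0: "I (R / 2 ^ k) / ?V \<ge> 0" unfolding I_def using f(2) V by (intro divide_nonneg_pos integral_nonneg_AE) auto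
    have "exp (L - real k * C) \<le> I (R / 2 ^ k) / ?V + \<delta>" if \<delta>: "\<delta> > 0" for \<delta>
    proof -
      have "L - real k * C \<le> M k \<delta>" using iter[OF \<delta>, of k] M0[OF \<delta>] by linarith
      also have "\<dots> \<le> ln (I (R / 2 ^ k) / ?V + \<delta>)"
        unfolding M_def I_def by (rule jensen_ln[OF f \<delta> _ fin V]) simp
      finally have "exp (L - real k * C) \<le> exp (ln (I (R / 2 ^ k) / ?V + \<delta>))" by simp
      then show ?thesis using I0 \<delta> by simp
    qed
    then have "exp (L - real k * C) \<le> I (R / 2 ^ k) / ?V" by (rule field_le_epsilon)
    then show ?thesis using V by (simp add: pos_le_divide_eq vol[OF Rk(1)])
  qed
  \<comment> \<open>The exponent of the lower bound plus \<open>1 / ln 2\<close>: along the radii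
    \<open>R / 2 ^ k\<close> the excess contributes the factor \<open>exp (- k)\<close>, which
    forces the contradiction.\<close>
  define m where "m = real N + (C + 1) / ln 2"
  have m: "m > 0" using C by (simp add: m_def N_def add_pos_nonneg)
  obtain c where c: "c > 0" and ev: "\<forall>\<^sub>F \<epsilon> in at_right 0. norm (I \<epsilon>) \<le> c * norm (\<epsilon> powr m)"
    using landau_o.bigE[OF inf[OF m]] unfolding I_def by blast
  have "(\<lambda>k. R / 2 ^ k) \<longlonglongrightarrow> 0" by real_asymp
  then have "filterlim (\<lambda>k. R / 2 ^ k) (at_right 0) sequentially"
    using R by (auto simp: filterlim_at intro!: always_eventually)
  then have "\<forall>\<^sub>F k in sequentially. norm (I (R / 2 ^ k)) \<le> c * norm ((R / 2 ^ k) powr m)"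
    by (rule eventually_compose_filterlim[OF ev])
  then have "\<forall>\<^sub>F k in sequentially. exp L * \<omega> * R ^ N \<le> c * R powr m * exp (- real k)"
  proof eventually_elim
    case (elim k)
    have e: "(2::real) ^ k = exp (real k * ln 2)" by (simp add: exp_of_nat_mult)
    have "(R / 2 ^ k) powr m = R powr m * exp (- real k * (real N * ln 2 + (C + 1)))"
    proof -
      have "ln (R / 2 ^ k) = ln R - real k * ln 2" using R by (simp add: ln_div ln_realpow)
      moreover have "m * ln 2 = real N * ln 2 + (C + 1)"
      proof -
        have "(C + 1) / ln 2 * ln 2 = C + 1" by (subst times_divide_eq_left, subst nonzero_mult_div_cancel_right) simp_all
        then show ?thesis by (simp only: m_def distrib_right)
      qed
      moreover have "m * (ln R - real k * ln 2) = m * ln R + - real k * (m * ln 2)"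
        by (simp add: algebra_simps)
      ultimately have "m * ln (R / 2 ^ k) = m * ln R + - real k * (real N * ln 2 + (C + 1))" by metis
      then show ?thesis using R by (simp add: powr_def exp_add[symmetric])
    qed
    moreover have "(R / 2 ^ k) ^ N = R ^ N * exp (- real k * (real N * ln 2))"
      by (simp add: power_divide e exp_of_nat_mult[symmetric] exp_minus field_simps)
    ultimately have "exp (L - real k * C) * (\<omega> * (R ^ N * exp (- real k * (real N * ln 2)))) \<le> c * (R powr m * exp (- real k * (real N * ln 2 + (C + 1))))"
      using lower[of k] elim by simp
    also have "exp (L - real k * C) * (\<omega> * (R ^ N * exp (- real k * (real N * ln 2))))
       = (exp L * \<omega> * R ^ N) * exp (- real k * (real N * ln 2) - real k * C)"
      by (simp add: exp_diff exp_minus field_simps)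
    also have "c * (R powr m * exp (- real k * (real N * ln 2 + (C + 1))))
       = (c * R powr m * exp (- real k)) * exp (- real k * (real N * ln 2) - real k * C)"
      by (simp add: exp_diff exp_add exp_minus distrib_left field_simps)
    finally show ?case by simp
  qed
  moreover have "(\<lambda>k. c * R powr m * exp (- real k)) \<longlonglongrightarrow> 0" by real_asymp
  ultimately have "exp L * \<omega> * R ^ N \<le> 0"
    using tendsto_lowerbound[of "\<lambda>k. c * R powr m * exp (- real k)" 0 sequentially "exp L * \<omega> * R ^ N"] by simp
  moreover have "exp L * \<omega> * R ^ N > 0" using \<omega> R by simp
  ultimately show False by simp
qed

section \<open>Bounds on the potential\<close>

lemma dyadic_cube_eq:
  fixes j :: "int ^ 'n::finite" and c :: real
  assumes c: "c > 0"
  shows "(\<lambda>x. c *\<^sub>R (x + (\<chi> i. of_int (j $ i)))) ` {x :: real ^ 'n. \<forall>i. 0 \<le> x $ i \<and> x $ i < 1}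
    = {y. \<forall>i. c * j $ i \<le> y $ i \<and> y $ i < c * (j $ i + 1)}" (is "?f ` ?U = ?Q")
proof (intro equalityI subsetI)
  fix y assume "y \<in> ?f ` ?U"
  then obtain x where x: "\<And>i. 0 \<le> x $ i" "\<And>i. x $ i < 1" and y: "y = ?f x" by blast
  have "c * j $ i \<le> y $ i \<and> y $ i < c * (j $ i + 1)" for i
    using x(1,2)[of i] c by (simp add: y)
  then show "y \<in> ?Q" by simp
next
  fix y assume y: "y \<in> ?Q"
  let ?x = "(1 / c) *\<^sub>R y - (\<chi> i. of_int (j $ i))"
  have "y = ?f ?x" using c by simp
  moreover have "?x \<in> ?U" using y c by (auto simp: field_simps)
  ultimately show "y \<in> ?f ` ?U" by blast
qed

lemma dyadic_cubesI:
  fixes j :: "int ^ 'n::finite"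
  shows "{y :: real ^ 'n. \<forall>i. (2::real) powi k * j $ i \<le> y $ i \<and> y $ i < 2 powi k * (j $ i + 1)} \<in> dyadic_cubes"
  unfolding dyadic_cubes_def by (subst dyadic_cube_eq[symmetric]) (auto simp: zero_less_power_int)

lemma half_open_cube_borel:
  "{y :: real ^ 'n::finite. \<forall>i. a i \<le> y $ i \<and> y $ i < b i} \<in> sets borel"
proof -
  have "{y :: real ^ 'n. \<forall>i. a i \<le> y $ i \<and> y $ i < b i} = (\<Inter>i. {y. a i \<le> y $ i} \<inter> {y. y $ i < b i})" by auto
  also have "\<dots> \<in> sets borel"
    by (intro sets.finite_INT sets.Int borel_closed borel_open closed_Collect_le open_Collect_less continuous_intros) auto
  finally show ?thesis .
qed

text \<open>Two points of Q are at most n c apart, so the kernel is at least \<open>1 / D\<close>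
  with \<open>D = (n c)^(n-2)\<close>. If I is the integral of \<open>|V|\<close> over Q, the double
  integral is at least \<open>I^2 / D\<close>, and the quotient in \<open>potential_norm\<close> is
  at least \<open>I / D\<close>. Cubes with I = 0 do not occur in the supremum, but satisfy the
  bound trivially.\<close>

lemma cube_integral_bound:
  fixes V :: "real ^ 'n::finite \<Rightarrow> complex" and j :: "int ^ 'n"
  assumes V: "locally_integrable V" and c: "c = (2::real) powi k"
  defines "Q \<equiv> {y :: real ^ 'n. \<forall>i. c * j $ i \<le> y $ i \<and> y $ i < c * (j $ i + 1)}"
  shows "(\<integral>\<^sup>+x\<in>Q. ennreal (cmod (V x)) \<partial>lebesgue) \<le> potential_norm V * ennreal ((real CARD('n) * c) ^ (CARD('n) - 2))"
proof -
  let ?N = "CARD('n)"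
  have c0: "c > 0" by (simp add: c zero_less_power_int)
  define D where "D = (real ?N * c) ^ (?N - 2)"
  have D: "D > 0" using c0 by (simp add: D_def)
  define I where "I = (\<integral>\<^sup>+x\<in>Q. ennreal (cmod (V x)) \<partial>lebesgue)"
  have [measurable]: "V \<in> borel_measurable lebesgue" by (rule locally_integrable_measurable[OF V])
  have "Q \<in> sets borel" unfolding Q_def by (rule half_open_cube_borel)
  then have [measurable]: "Q \<in> sets lebesgue" by simp
  have dist: "norm (x - y) \<le> real ?N * c" if "x \<in> Q" "y \<in> Q" for x y
  proof -
    have "\<bar>(x - y) $ i\<bar> \<le> c" for i
    proof -
      have "c * j $ i \<le> x $ i" "x $ i < c * (j $ i + 1)" "c * j $ i \<le> y $ i" "y $ i < c * (j $ i + 1)"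
        using that by (auto simp: Q_def)
      then show ?thesis by (simp add: distrib_left abs_le_iff)
    qed
    then have "(\<Sum>i\<in>UNIV. \<bar>(x - y) $ i\<bar>) \<le> (\<Sum>i\<in>(UNIV::'n set). c)" by (intro sum_mono)
    then show ?thesis using norm_le_l1_cart[of "x - y"] by simp
  qed
  show ?thesis
  proof (cases "I = 0")
    case True then show ?thesis by (simp add: I_def)
  next
    case False
    define y\<^sub>0 :: "real ^ 'n" where "y\<^sub>0 = (\<chi> i. c * j $ i)"
    have y\<^sub>0: "y\<^sub>0 \<in> Q" using c0 by (simp add: Q_def y\<^sub>0_def)
    \<comment> \<open>Local integrability makes I finite, which is what permits the later
      cancellation of \<open>inverse I * I\<close> in the extended reals.\<close>
    have "Q \<subseteq> cball y\<^sub>0 (real ?N * c)" using dist[OF y\<^sub>0] by (auto simp: dist_norm)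
    then have "I \<le> (\<integral>\<^sup>+x. ennreal (norm (indicator (cball y\<^sub>0 (real ?N * c)) x *\<^sub>R V x)) \<partial>lebesgue)"
      unfolding I_def by (intro nn_integral_mono) (auto simp: indicator_def)
    also have "\<dots> < \<infinity>" using locally_integrable_cball[OF V, of y\<^sub>0 "real ?N * c"] by (simp add: integrable_iff_bounded)
    finally have fin: "I < \<infinity>" .
    have inner: "ennreal (cmod (V y) / D) * I \<le> (\<integral>\<^sup>+x\<in>Q. ennreal (cmod (V x * V y) / norm (x - y) ^ (?N - 2)) \<partial>lebesgue)" if y: "y \<in> Q" for y
    proof -
      have "ennreal (cmod (V y) / D) * I = (\<integral>\<^sup>+x. ennreal (cmod (V y) / D) * (ennreal (cmod (V x)) * indicator Q x) \<partial>lebesgue)"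
        unfolding I_def by (rule nn_integral_cmult[symmetric]) measurable
      also have "\<dots> \<le> (\<integral>\<^sup>+x\<in>Q. ennreal (cmod (V x * V y) / norm (x - y) ^ (?N - 2)) \<partial>lebesgue)"
      proof (rule nn_integral_mono_AE)
        \<comment> \<open>For a positive exponent, division by zero makes the quotient 0 on the
          diagonal, so the pointwise lower bound is claimed only off it.\<close>
        have "AE x in lebesgue. x \<noteq> y" by (rule AE_completion[OF AE_lborel_singleton])
        then show "AE x in lebesgue. ennreal (cmod (V y) / D) * (ennreal (cmod (V x)) * indicator Q x)
          \<le> ennreal (cmod (V x * V y) / norm (x - y) ^ (?N - 2)) * indicator Q x"
        proof eventually_elim
          case (elim x)
          show ?case
          proof (cases "x \<in> Q")
            case True
            have "norm (x - y) ^ (?N - 2) \<le> D" unfolding D_def by (intro power_mono dist True y) auto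
            then have "cmod (V x * V y) / D \<le> cmod (V x * V y) / norm (x - y) ^ (?N - 2)"
              using elim D by (intro divide_left_mono) auto
            then have "cmod (V y) / D * cmod (V x) \<le> cmod (V x * V y) / norm (x - y) ^ (?N - 2)"
              by (simp add: norm_mult mult.commute)
            then show ?thesis using True D by (simp add: ennreal_mult[symmetric] ennreal_leI)
          qed simp
        qed
      qed
      finally show ?thesis .
    qed
    have "ennreal (1 / D) * I * I = (\<integral>\<^sup>+y. (ennreal (1 / D) * I) * (ennreal (cmod (V y)) * indicator Q y) \<partial>lebesgue)"
      unfolding I_def by (rule nn_integral_cmult[symmetric]) measurable
    also have "\<dots> \<le> (\<integral>\<^sup>+y\<in>Q. (\<integral>\<^sup>+x\<in>Q. ennreal (cmod (V x * V y) / norm (x - y) ^ (?N - 2)) \<partial>lebesgue) \<partial>lebesgue)"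
    proof (rule nn_integral_mono)
      fix y
      have "ennreal (1 / D) * I * ennreal (cmod (V y)) = ennreal (cmod (V y) / D) * I"
      proof -
        have "ennreal (1 / D) * ennreal (cmod (V y)) = ennreal (cmod (V y) / D)"
          using D by (subst ennreal_mult[symmetric]) auto
        then show ?thesis by (simp only: mult_ac)
      qed
      then show "ennreal (1 / D) * I * (ennreal (cmod (V y)) * indicator Q y)
        \<le> (\<integral>\<^sup>+x\<in>Q. ennreal (cmod (V x * V y) / norm (x - y) ^ (?N - 2)) \<partial>lebesgue) * indicator Q y"
        using inner[of y] by (auto simp: indicator_def)
    qed
    finally have "inverse I * (ennreal (1 / D) * I * I)
      \<le> inverse I * (\<integral>\<^sup>+y\<in>Q. (\<integral>\<^sup>+x\<in>Q. ennreal (cmod (V x * V y) / norm (x - y) ^ (?N - 2)) \<partial>lebesgue) \<partial>lebesgue)"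
      by (rule mult_left_mono) simp
    also have "\<dots> \<le> potential_norm V"
      unfolding potential_norm_def I_def
      by (rule SUP_upper) (use dyadic_cubesI[of k j] False in \<open>auto simp: Q_def c I_def\<close>)
    also have "inverse I * (ennreal (1 / D) * I * I) = (inverse I * I) * (ennreal (1 / D) * I)" by (simp add: mult_ac)
    also have "inverse I * I = 1" using ennreal_divide_self[of I] False fin by (simp add: divide_ennreal_def mult.commute)
    finally have "ennreal (1 / D) * I \<le> potential_norm V" by simp
    then have "ennreal (1 / D) * I * ennreal D \<le> potential_norm V * ennreal D" by (rule mult_right_mono) simp
    moreover have "ennreal (1 / D) * I * ennreal D = I * (ennreal (1 / D) * ennreal D)" by (simp add: mult_ac)
    moreover have "ennreal (1 / D) * ennreal D = 1" using D by (simp flip: ennreal_mult)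
    ultimately show ?thesis by (simp add: I_def D_def)
  qed
qed

text \<open>A small ball need not lie in a dyadic cube of comparable size, for it may straddle a
  coordinate hyperplane. It is covered instead by the cube containing its centre and the neighbours
  of that cube, all of side c, the power of 2 with \<open>r \<le> c \<le> 2 r\<close>. Coordinates
  differing by less than c have integer parts, after division by c, that differ by at most 1; hence
  the index set D.\<close>

lemma potential_ball_bound:
  fixes V :: "real ^ 'n::finite \<Rightarrow> complex"
  assumes V: "locally_integrable V" and fin: "potential_norm V < \<infinity>"
  shows "\<exists>C\<ge>0. \<forall>r>0. (\<integral>\<^sup>+x\<in>ball x\<^sub>0 r. ennreal (cmod (V x)) \<partial>lebesgue) \<le> ennreal (C * r ^ (CARD('n) - 2))"
proof -
  let ?N = "CARD('n)"
  obtain P where P: "P \<ge> 0" "potential_norm V = ennreal P" using fin by (cases "potential_norm V") auto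
  define D :: "(int ^ 'n) set" where "D = {d. \<forall>i. d $ i \<in> {-1..1}}"
  have "D \<subseteq> vec_lambda ` (UNIV \<rightarrow>\<^sub>E {-1..1})"
    by (auto simp: D_def image_iff intro!: bexI[of _ "vec_nth _"])
  then have finD: "finite D" by (rule finite_subset) (intro finite_imageI finite_PiE, auto)
  have [measurable]: "V \<in> borel_measurable lebesgue" by (rule locally_integrable_measurable[OF V])
  define C where "C = real (card D) * (P * (real ?N * 2) ^ (?N - 2))"
  show ?thesis
  proof (intro exI[of _ C] conjI allI impI)
    show "C \<ge> 0" using P by (simp add: C_def)
    fix r :: real assume r: "r > 0"
    define k where "k = \<lceil>log 2 r\<rceil>"
    define c where "c = (2::real) powi k"
    have c0: "c > 0" by (simp add: c_def zero_less_power_int)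
    have c_powr: "c = 2 powr (real_of_int k)" by (simp add: c_def powr_real_of_int')
    have "2 powr (log 2 r) \<le> c" unfolding c_powr k_def by (intro powr_mono) auto
    then have rc: "r \<le> c" using r by simp
    have "c \<le> 2 powr (log 2 r + 1)" unfolding c_powr k_def by (intro powr_mono of_int_ceiling_le_add_one) auto
    then have cr: "c \<le> r * 2" using r by (simp add: powr_add)
    define a :: "int ^ 'n" where "a = (\<chi> i. \<lfloor>x\<^sub>0 $ i / c\<rfloor>)"
    define Q where "Q d = {y :: real ^ 'n. \<forall>i. c * (a + d) $ i \<le> y $ i \<and> y $ i < c * ((a + d) $ i + 1)}" for d
    have cover: "\<exists>d\<in>D. y \<in> Q d" if "y \<in> ball x\<^sub>0 r" for y
    proof -
      define d :: "int ^ 'n" where "d = (\<chi> i. \<lfloor>y $ i / c\<rfloor> - \<lfloor>x\<^sub>0 $ i / c\<rfloor>)"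
      have "d $ i \<in> {-1..1}" for i
      proof -
        have "\<bar>y $ i - x\<^sub>0 $ i\<bar> < c"
          using component_le_norm_cart[of "y - x\<^sub>0" i] that rc by (simp add: dist_norm norm_minus_commute)
        then have "\<bar>y $ i / c - x\<^sub>0 $ i / c\<bar> < 1" using c0 by (simp add: diff_divide_distrib[symmetric])
        then show ?thesis unfolding d_def by simp linarith
      qed
      moreover have "y \<in> Q d"
      proof -
        have "c * \<lfloor>y $ i / c\<rfloor> \<le> y $ i \<and> y $ i < c * (\<lfloor>y $ i / c\<rfloor> + 1)" for i
          using floor_correct[of "y $ i / c", unfolded pos_le_divide_eq[OF c0] pos_divide_less_eq[OF c0]]
          by (simp add: mult.commute)
        then show ?thesis by (simp add: Q_def a_def d_def)
      qed
      ultimately show ?thesis by (auto simp: D_def)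
    qed
    have [measurable]: "Q d \<in> sets lebesgue" for d using half_open_cube_borel by (simp add: Q_def)
    have "(\<integral>\<^sup>+x\<in>ball x\<^sub>0 r. ennreal (cmod (V x)) \<partial>lebesgue) \<le> (\<integral>\<^sup>+x. (\<Sum>d\<in>D. ennreal (cmod (V x)) * indicator (Q d) x) \<partial>lebesgue)"
    proof (rule nn_integral_mono)
      fix x
      show "ennreal (cmod (V x)) * indicator (ball x\<^sub>0 r) x \<le> (\<Sum>d\<in>D. ennreal (cmod (V x)) * indicator (Q d) x)"
      proof (cases "x \<in> ball x\<^sub>0 r")
        case True
        then obtain d where "d \<in> D" "x \<in> Q d" using cover by blast
        then show ?thesis
          using member_le_sum[of d D "\<lambda>d. ennreal (cmod (V x)) * indicator (Q d) x"] finD True by auto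
      qed simp
    qed
    also have "\<dots> = (\<Sum>d\<in>D. \<integral>\<^sup>+x\<in>Q d. ennreal (cmod (V x)) \<partial>lebesgue)"
      by (rule nn_integral_sum) measurable
    also have "\<dots> \<le> (\<Sum>d\<in>D. potential_norm V * ennreal ((real ?N * c) ^ (?N - 2)))"
      unfolding Q_def by (intro sum_mono cube_integral_bound[OF V c_def])
    also have "\<dots> = ennreal (real (card D) * (P * (real ?N * c) ^ (?N - 2)))"
      using P(1) c0 unfolding P(2) by (simp add: ennreal_mult ennreal_of_nat_eq_real_of_nat)
    also have "\<dots> \<le> ennreal (C * r ^ (?N - 2))"
    proof (rule ennreal_leI)
      have "(real ?N * c) ^ (?N - 2) \<le> (real ?N * (r * 2)) ^ (?N - 2)" using cr c0 by (intro power_mono mult_left_mono) auto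
      then have "real (card D) * (P * (real ?N * c) ^ (?N - 2)) \<le> real (card D) * (P * (real ?N * (r * 2)) ^ (?N - 2))"
        using P by (intro mult_left_mono) auto
      also have "\<dots> = C * r ^ (?N - 2)" by (simp add: C_def power_mult_distrib mult_ac)
      finally show "real (card D) * (P * (real ?N * c) ^ (?N - 2)) \<le> C * r ^ (?N - 2)" .
    qed
    finally show "(\<integral>\<^sup>+x\<in>ball x\<^sub>0 r. ennreal (cmod (V x)) \<partial>lebesgue) \<le> ennreal (C * r ^ (?N - 2))" .
  qed
qed

section \<open>Conclusion\<close>

lemma laplacian_eq_0:
  fixes K :: "real ^ 'n::finite \<Rightarrow> real"
  assumes "open U" "\<And>x. x \<in> U \<Longrightarrow> K x = 0" "x \<in> U"
  shows "laplacian K x = 0"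
  unfolding laplacian_def
  by (intro sum.neutral ballI partial_deriv_eq_0[OF assms(1) _ assms(3)]) (rule partial_deriv_eq_0[OF assms(1,2)])

lemma laplacian_measurable:
  "K \<in> Cc_infinity \<Longrightarrow> laplacian K \<in> borel_measurable borel"
  unfolding laplacian_def
  by (intro borel_measurable_continuous_onI continuous_intros Cc_infinity_cont Cc_infinity_partial_deriv)

text \<open>The weak equation makes \<open>Re (V - E) \<psi> K\<close> integrable for every bump K.
  A bump with a positive minimum on the closed ball can be divided out.\<close>

lemma weak_solution_integrable_ball:
  fixes \<psi> :: "real ^ 'n::finite \<Rightarrow> real"
  assumes V: "locally_integrable V" and \<psi>: "\<psi> \<in> H1" and ws: "weak_solution V E \<psi>" and R: "R > 0"
  shows "integrable lebesgue (\<lambda>x. indicator (ball x\<^sub>0 R) x * (Re (V x - E) * \<psi> x))"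
proof -
  obtain \<rho> :: "real ^ 'n \<Rightarrow> real" and s where \<rho>: "\<rho> \<in> Cc_infinity" "s > 0" "\<And>x. norm x < s \<Longrightarrow> \<rho> x > 0"
    by (rule exists_mollifier) blast
  \<comment> \<open>Scaling by c sends the ball of radius R to radius \<open>s / 2\<close>, inside
    the region where \<open>\<rho>\<close> is positive.\<close>
  define c where "c = s / (2 * R)"
  have c: "c > 0" using \<rho>(2) R by (simp add: c_def)
  define K where "K x = \<rho> (- (c *\<^sub>R x\<^sub>0) + c *\<^sub>R x)" for x
  have K: "K \<in> Cc_infinity" using Cc_infinity_affine[OF \<rho>(1), of c 1 "- (c *\<^sub>R x\<^sub>0)"] c by (simp add: K_def[abs_def])
  have pos: "K x > 0" if "x \<in> cball x\<^sub>0 R" for x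
  proof -
    have "norm (- (c *\<^sub>R x\<^sub>0) + c *\<^sub>R x) = c * norm (x - x\<^sub>0)"
      using c by (metis abs_of_pos add.commute norm_scaleR scaleR_right_diff_distrib uminus_add_conv_diff)
    also have "\<dots> \<le> c * R" using that c by (intro mult_left_mono) (auto simp: dist_norm norm_minus_commute)
    also have "\<dots> < s" using R \<rho>(2) by (simp add: c_def)
    finally show ?thesis unfolding K_def by (rule \<rho>(3))
  qed
  have "\<exists>z\<in>cball x\<^sub>0 R. \<forall>y\<in>cball x\<^sub>0 R. K z \<le> K y"
    using R by (intro continuous_attains_inf) (auto intro: continuous_on_subset[OF Cc_infinity_cont[OF K]])
  then obtain z where z: "z \<in> cball x\<^sub>0 R" "\<And>y. y \<in> cball x\<^sub>0 R \<Longrightarrow> K z \<le> K y" by blast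
  have [measurable]: "\<psi> \<in> borel_measurable lebesgue" using \<psi> by (auto simp: H1_def L2_def)
  have [measurable]: "V \<in> borel_measurable lebesgue" by (rule locally_integrable_measurable[OF V])
  show ?thesis
  proof (rule Bochner_Integration.integrable_bound)
    show "integrable lebesgue (\<lambda>x. (Re (V x - E) * \<psi> x * K x) / K z)"
      by (intro integrable_divide weak_solution_distributional(1)[OF V \<psi> ws K])
    have "(\<lambda>x. Re (V x - E) * \<psi> x) \<in> borel_measurable lebesgue" by measurable
    then show "(\<lambda>x. indicat_real (ball x\<^sub>0 R) x * (Re (V x - E) * \<psi> x)) \<in> borel_measurable lebesgue"
      by (intro borel_measurable_times borel_measurable_indicator) auto
    show "AE x in lebesgue. norm (indicat_real (ball x\<^sub>0 R) x * (Re (V x - E) * \<psi> x)) \<le> norm (Re (V x - E) * \<psi> x * K x / K z)"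
    proof (rule AE_I2)
      fix x
      show "norm (indicat_real (ball x\<^sub>0 R) x * (Re (V x - E) * \<psi> x)) \<le> norm (Re (V x - E) * \<psi> x * K x / K z)"
      proof (cases "x \<in> ball x\<^sub>0 R")
        case True
        then have x: "x \<in> cball x\<^sub>0 R" by simp
        then have "1 \<le> K x / K z" using z pos[OF z(1)] by simp
        then have "\<bar>Re (V x - E) * \<psi> x\<bar> * 1 \<le> \<bar>Re (V x - E) * \<psi> x\<bar> * (K x / K z)" by (intro mult_left_mono) auto
        then show ?thesis using True pos[OF x] pos[OF z(1)] by (simp add: abs_mult)
      qed simp
    qed
  qed
qed

text \<open>The factor \<open>\<sigma>\<close> treats both signs at once. Here f and g represent the
  restrictions of \<open>\<sigma> \<psi>\<close> and \<open>Re (V - E) \<sigma> \<psi>\<close> to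
  the ball; the work consists in verifying the hypotheses of \<open>log_oscillation\<close> and
  \<open>infinite_order_zero_vanishes\<close> for them.\<close>

lemma one_signed_zero:
  fixes V :: "real ^ 'n::finite \<Rightarrow> complex"
    and E :: complex
    and \<psi> :: "real ^ 'n \<Rightarrow> real"
    and x\<^sub>0 :: "real ^ 'n"
  assumes n: "CARD('n) \<ge> 2"
    and V: "locally_integrable V" and fin: "potential_norm V < \<infinity>"
    and \<psi>: "\<psi> \<in> H1" and ws: "weak_solution V E \<psi>" and zero: "zero_of_infinite_order \<psi> x\<^sub>0"
    and R0: "R\<^sub>0 > 0" and \<sigma>: "\<bar>\<sigma>\<bar> = (1::real)"
    and sgn: "AE x in lebesgue. x \<in> ball x\<^sub>0 R\<^sub>0 \<longrightarrow> \<sigma> * \<psi> x \<ge> 0"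
  shows "\<exists>r>0. AE x in lebesgue. x \<in> ball x\<^sub>0 r \<longrightarrow> \<psi> x = 0"
proof -
  define N where "N = CARD('n)"
  \<comment> \<open>The smaller radius avoids a continuity argument on the sphere: a test function supported in its ball
    vanishes on an open set containing the complement of the larger ball, and so does its Laplacian.\<close>
  define R where "R = R\<^sub>0 / 2"
  have R: "R > 0" "R < R\<^sub>0" using R0 by (auto simp: R_def)
  have m\<psi>[measurable]: "\<psi> \<in> borel_measurable lebesgue" using \<psi> by (auto simp: H1_def L2_def)
  have mV[measurable]: "V \<in> borel_measurable lebesgue" by (rule locally_integrable_measurable[OF V])
  have ball[measurable]: "ball a r \<in> sets lebesgue" for a :: "real ^ 'n" and r by simp
  let ?B = "ball x\<^sub>0 R\<^sub>0"
  define F where "F x = indicator ?B x * (\<sigma> * \<psi> x)" for x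
  define G where "G x = indicator ?B x * (Re (V x - E) * (\<sigma> * \<psi> x))" for x
  have li\<psi>: "locally_integrable \<psi>" using \<psi> by (auto simp: H1_def is_weak_gradient_def)
  have iF: "integrable lebesgue F"
  proof -
    have "integrable lebesgue (\<lambda>x. indicator ?B x *\<^sub>R (\<sigma> * (indicator (cball x\<^sub>0 R\<^sub>0) x *\<^sub>R \<psi> x)))"
      by (intro integrable_mult_indicator integrable_mult_right locally_integrable_cball li\<psi>) simp
    moreover have "(\<lambda>x. indicator ?B x *\<^sub>R (\<sigma> * (indicator (cball x\<^sub>0 R\<^sub>0) x *\<^sub>R \<psi> x))) = F"
      by (auto simp: F_def indicator_def fun_eq_iff)
    ultimately show ?thesis by simp
  qed
  have iG: "integrable lebesgue G"
    using integrable_mult_right[OF weak_solution_integrable_ball[OF V \<psi> ws R0, of x\<^sub>0], of \<sigma>]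
    by (simp add: G_def[abs_def] mult_ac)
  obtain f\<^sub>0 where f0: "integrable lborel f\<^sub>0" "AE x in lebesgue. F x = f\<^sub>0 x"
    using lebesgue_borel_rep[OF iF] by blast
  obtain g where g: "integrable lborel g" "AE x in lebesgue. G x = g x"
    using lebesgue_borel_rep[OF iG] by blast
  \<comment> \<open>A Borel representative need be nonnegative only almost everywhere; the maximum
    with 0 makes it so at every point without changing it almost everywhere.\<close>
  define f where "f x = max 0 (f\<^sub>0 x)" for x
  have f: "integrable lborel f" "\<And>x. f x \<ge> 0"
    using f0(1) by (auto simp: f_def[abs_def])
  have Ff: "AE x in lebesgue. F x = f x"
    using f0(2) sgn
  proof eventually_elim
    case (elim x)
    have "F x \<ge> 0" using elim(2) by (cases "x \<in> ?B") (auto simp: F_def)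
    then show ?case using elim(1) by (simp add: f_def)
  qed
  have [measurable]: "f \<in> borel_measurable borel" "g \<in> borel_measurable borel" using f g by auto
  have eq: "distributional_laplace f g (ball x\<^sub>0 R)"
    unfolding distributional_laplace_def
  proof (intro ballI impI)
    fix K :: "real ^ 'n \<Rightarrow> real" assume K: "K \<in> Cc_infinity" and K0: "\<forall>x. x \<notin> ball x\<^sub>0 R \<longrightarrow> K x = 0"
    have lap0: "laplacian K x = 0" if "x \<notin> ?B" for x
      by (rule laplacian_eq_0[of "- cball x\<^sub>0 R"]) (use that K0 R in auto)
    have "(\<integral>x. g x * K x \<partial>lborel) = (\<integral>x. G x * K x \<partial>lebesgue)"
      using Cc_infinity_cont[OF K] by (intro integral_lebesgue_borel_cong[symmetric] iG g borel_measurable_continuous_onI)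
    also have "\<dots> = (\<integral>x. \<sigma> * (Re (V x - E) * \<psi> x * K x) \<partial>lebesgue)"
      using K0 R by (intro Bochner_Integration.integral_cong) (auto simp: G_def indicator_def)
    also have "\<dots> = \<sigma> * (\<integral>x. \<psi> x * laplacian K x \<partial>lebesgue)"
      using weak_solution_distributional(2)[OF V \<psi> ws K] by simp
    also have "\<dots> = (\<integral>x. \<sigma> * (\<psi> x * laplacian K x) \<partial>lebesgue)" by simp
    also have "\<dots> = (\<integral>x. F x * laplacian K x \<partial>lebesgue)"
      using lap0 by (intro Bochner_Integration.integral_cong) (auto simp: F_def indicator_def)
    also have "\<dots> = (\<integral>x. f x * laplacian K x \<partial>lborel)"
      by (intro integral_lebesgue_borel_cong iF f Ff laplacian_measurable K)
    finally show "(\<integral>x. g x * K x \<partial>lborel) = (\<integral>x. f x * laplacian K x \<partial>lborel)" .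
  qed
  obtain C\<^sub>1 where C1: "C\<^sub>1 \<ge> 0" "\<And>r. r > 0 \<Longrightarrow> (\<integral>\<^sup>+x\<in>ball x\<^sub>0 r. ennreal (cmod (V x)) \<partial>lebesgue) \<le> ennreal (C\<^sub>1 * r ^ (N - 2))"
    using potential_ball_bound[OF V fin, of x\<^sub>0] unfolding N_def by blast
  \<comment> \<open>The energy contributes \<open>|E| \<omega> r^N\<close>, and \<open>r^N\<close>
    is at most \<open>R^2 r^(N-2)\<close> for r up to R.\<close>
  define C where "C = C\<^sub>1 + cmod E * (unit_ball_vol (real N) * R\<^sup>2)"
  have C: "C \<ge> 0" using C1(1) by (simp add: C_def)
  have gbound: "(\<integral>x. indicator (ball x\<^sub>0 r) x * (\<bar>g x\<bar> / (f x + \<delta>)) \<partial>lborel) \<le> C * r ^ (CARD('n) - 2)"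
    if r: "0 < r" "r \<le> R" and \<delta>: "\<delta> > 0" for r \<delta>
  proof -
    let ?h = "\<lambda>x. indicator (ball x\<^sub>0 r) x * (\<bar>g x\<bar> / (f x + \<delta>))"
    have h0: "0 \<le> ?h x" for x using f(2)[of x] \<delta> by simp
    have hm: "?h \<in> borel_measurable lborel" by (intro borel_measurable_times borel_measurable_indicator) auto
    have "(\<integral>\<^sup>+x. ennreal (?h x) \<partial>lborel) = (\<integral>\<^sup>+x. ennreal (?h x) \<partial>lebesgue)"
      by (rule nn_integral_completion[symmetric])
    also have "\<dots> \<le> (\<integral>\<^sup>+x. ennreal (cmod (V x)) * indicator (ball x\<^sub>0 r) x + ennreal (cmod E) * indicator (ball x\<^sub>0 r) x \<partial>lebesgue)"
    proof (rule nn_integral_mono_AE)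
      show "AE x in lebesgue. ennreal (?h x) \<le> ennreal (cmod (V x)) * indicator (ball x\<^sub>0 r) x + ennreal (cmod E) * indicator (ball x\<^sub>0 r) x"
        using Ff g(2)
      proof eventually_elim
        case (elim x)
        show ?case
        proof (cases "x \<in> ball x\<^sub>0 r")
          case True
          then have xB: "x \<in> ?B" using r R by simp
          have fx: "f x = \<sigma> * \<psi> x" using elim(1) xB by (simp add: F_def)
          have "g x = Re (V x - E) * f x" using elim(2) xB by (simp add: G_def fx)
          \<comment> \<open>The solution cancels here: \<open>f / (f + \<delta>)\<close> is at most
            1 for every \<open>\<delta>\<close>, leaving a bound that involves only V and E.\<close>
          then have "\<bar>g x\<bar> / (f x + \<delta>) = \<bar>Re (V x - E)\<bar> * (f x / (f x + \<delta>))"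
            using f(2)[of x] by (simp add: abs_mult)
          also have "\<dots> \<le> \<bar>Re (V x - E)\<bar>" using f(2)[of x] \<delta> by (intro mult_left_le) auto
          also have "\<dots> \<le> cmod (V x - E)" by (rule abs_Re_le_cmod)
          also have "\<dots> \<le> cmod (V x) + cmod E" by (rule norm_triangle_ineq4)
          finally show ?thesis using True by (simp add: ennreal_leI flip: ennreal_plus)
        qed simp
      qed
    qed
    also have "\<dots> = (\<integral>\<^sup>+x\<in>ball x\<^sub>0 r. ennreal (cmod (V x)) \<partial>lebesgue) + (\<integral>\<^sup>+x. ennreal (cmod E) * indicator (ball x\<^sub>0 r) x \<partial>lebesgue)"
      by (rule nn_integral_add) (intro borel_measurable_times_ennreal borel_measurable_indicator ball, measurable)+
    also have "(\<integral>\<^sup>+x. ennreal (cmod E) * indicator (ball x\<^sub>0 r) x \<partial>lebesgue) = ennreal (cmod E * (unit_ball_vol (real N) * r ^ N))"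
      using emeasure_ball[of r x\<^sub>0] r by (simp add: nn_integral_cmult_indicator ennreal_mult[symmetric] N_def)
    also have "(\<integral>\<^sup>+x\<in>ball x\<^sub>0 r. ennreal (cmod (V x)) \<partial>lebesgue) + ennreal (cmod E * (unit_ball_vol (real N) * r ^ N))
      \<le> ennreal (C\<^sub>1 * r ^ (N - 2)) + ennreal (cmod E * (unit_ball_vol (real N) * r ^ N))"
      by (intro add_right_mono C1(2) r)
    also have "\<dots> = ennreal (C\<^sub>1 * r ^ (N - 2) + cmod E * (unit_ball_vol (real N) * r ^ N))"
      using C1(1) r by simp
    also have "\<dots> \<le> ennreal (C * r ^ (N - 2))"
    proof (rule ennreal_leI)
      have "r ^ N = r ^ (N - 2) * r\<^sup>2"
      proof -
        have "N = (N - 2) + 2" using n by (simp add: N_def)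
        then show ?thesis by (metis power_add)
      qed
      also have "\<dots> \<le> r ^ (N - 2) * R\<^sup>2" using r by (intro mult_left_mono power_mono) auto
      finally have "cmod E * (unit_ball_vol (real N) * r ^ N) \<le> cmod E * (unit_ball_vol (real N) * (r ^ (N - 2) * R\<^sup>2))"
        by (intro mult_left_mono) auto
      then show "C\<^sub>1 * r ^ (N - 2) + cmod E * (unit_ball_vol (real N) * r ^ N) \<le> C * r ^ (N - 2)"
        by (simp add: C_def algebra_simps)
    qed
    finally have "enn2real (\<integral>\<^sup>+x. ennreal (?h x) \<partial>lborel) \<le> C * r ^ (N - 2)"
      using C r by (intro enn2real_leI) auto
    then show ?thesis
      using integral_eq_nn_integral[OF hm] h0 by (simp add: N_def)
  qed
  obtain K where K: "K \<ge> 0" and osc: "\<And>r \<delta>. 0 < r \<Longrightarrow> 3 * r \<le> R \<Longrightarrow> \<delta> > 0 \<Longrightarrow>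
    double_osc (ball x\<^sub>0 r) (\<lambda>x. ln (f x + \<delta>))
      \<le> ennreal (K * (measure lborel (ball x\<^sub>0 r))\<^sup>2)"
    using log_oscillation[OF n f g(1) eq C gbound] by blast
  have "AE x in lborel. x \<in> ball x\<^sub>0 (R / 3) \<longrightarrow> f x = 0"
  proof (rule infinite_order_zero_vanishes[OF f _ K])
    show "R / 3 > 0" using R by simp
    show "double_osc (ball x\<^sub>0 r) (\<lambda>x. ln (f x + \<delta>))
      \<le> ennreal (K * (measure lborel (ball x\<^sub>0 r))\<^sup>2)" if "0 < r" "r \<le> R / 3" "\<delta> > 0" for r \<delta>
      using osc[of r \<delta>] that by simp
    fix m :: real assume "m > 0"
    then have "(\<lambda>\<epsilon>. LINT x:ball x\<^sub>0 \<epsilon>|lebesgue. \<psi> x) \<in> O[at_right 0](\<lambda>\<epsilon>. \<epsilon> powr m)"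
      using zero unfolding zero_of_infinite_order_def by blast
    then obtain c where c: "c > 0" "\<forall>\<^sub>F \<epsilon> in at_right 0. norm (LINT x:ball x\<^sub>0 \<epsilon>|lebesgue. \<psi> x) \<le> c * norm (\<epsilon> powr m)"
      by (rule landau_o.bigE)
    \<comment> \<open>For such radii the ball lies where F equals \<open>\<sigma> \<psi>\<close>, so
      the two integrals differ only by the sign \<open>\<sigma>\<close>.\<close>
    have "\<forall>\<^sub>F \<epsilon> in at_right 0. \<epsilon> < R" using R by (intro eventually_at_rightI[of 0 R]) auto
    with c(2) have "\<forall>\<^sub>F \<epsilon> in at_right 0. norm (\<integral>x. indicator (ball x\<^sub>0 \<epsilon>) x * f x \<partial>lborel) \<le> c * norm (\<epsilon> powr m)"
    proof eventually_elim
      case (elim \<epsilon>)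
      have "(\<integral>x. indicator (ball x\<^sub>0 \<epsilon>) x * f x \<partial>lborel) = (\<integral>x. f x * indicator (ball x\<^sub>0 \<epsilon>) x \<partial>lborel)"
        by (simp add: mult.commute)
      also have "\<dots> = (\<integral>x. F x * indicator (ball x\<^sub>0 \<epsilon>) x \<partial>lebesgue)"
        by (intro integral_lebesgue_borel_cong[symmetric] iF f Ff borel_measurable_indicator) simp
      also have "\<dots> = (\<integral>x. \<sigma> * (indicator (ball x\<^sub>0 \<epsilon>) x *\<^sub>R \<psi> x) \<partial>lebesgue)"
        using elim(2) R by (intro Bochner_Integration.integral_cong) (auto simp: F_def indicator_def)
      also have "\<dots> = \<sigma> * (LINT x:ball x\<^sub>0 \<epsilon>|lebesgue. \<psi> x)"
        by (simp add: set_lebesgue_integral_def)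
      finally show ?case using elim(1) \<sigma> by (simp add: abs_mult)
    qed
    then show "(\<lambda>\<epsilon>. \<integral>x. indicator (ball x\<^sub>0 \<epsilon>) x * f x \<partial>lborel) \<in> O[at_right 0](\<lambda>\<epsilon>. \<epsilon> powr m)"
      by (rule landau_o.bigI[OF c(1)])
  qed
  from AE_completion[OF this] Ff have "AE x in lebesgue. x \<in> ball x\<^sub>0 (R / 3) \<longrightarrow> \<psi> x = 0"
  proof eventually_elim
    case (elim x)
    show ?case using elim R \<sigma> by (auto simp: F_def)
  qed
  then show ?thesis using R by (intro exI[of _ "R / 3"]) simp
qed

theorem theorem1p1:
  fixes V :: "real ^ 'n::finite \<Rightarrow> complex"
    and E :: complex
    and \<psi> :: "real ^ 'n \<Rightarrow> real"
    and x\<^sub>0 :: "real ^ 'n"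
  assumes "CARD('n) \<ge> 3"
    and "locally_integrable V"
    and "potential_norm V < \<infinity>"
    and "\<psi> \<in> H1"
    and "weak_solution V E \<psi>"
    and "zero_of_infinite_order \<psi> x\<^sub>0"
  shows "(\<exists>r>0. AE x in lebesgue. x \<in> ball x\<^sub>0 r \<longrightarrow> \<psi> x = 0) \<or>
         (\<forall>r>0. emeasure lebesgue {x \<in> ball x\<^sub>0 r. \<psi> x > 0} > 0 \<and>
                emeasure lebesgue {x \<in> ball x\<^sub>0 r. \<psi> x < 0} > 0)"
proof (rule disjCI)
  assume "\<not> (\<forall>r>0. emeasure lebesgue {x \<in> ball x\<^sub>0 r. \<psi> x > 0} > 0 \<and>
                emeasure lebesgue {x \<in> ball x\<^sub>0 r. \<psi> x < 0} > 0)"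
  then obtain r where r: "r > 0" and one_sided:
    "emeasure lebesgue {x \<in> ball x\<^sub>0 r. \<psi> x > 0} = 0 \<or> emeasure lebesgue {x \<in> ball x\<^sub>0 r. \<psi> x < 0} = 0"
    by (auto simp: zero_less_iff_neq_zero)
  from one_sided obtain \<sigma> :: real where \<sigma>: "\<bar>\<sigma>\<bar> = 1" and 0: "emeasure lebesgue {x \<in> ball x\<^sub>0 r. \<sigma> * \<psi> x < 0} = 0"
  proof
    assume "emeasure lebesgue {x \<in> ball x\<^sub>0 r. \<psi> x > 0} = 0"
    then show thesis using that[of "- 1"] by simp
  next
    assume "emeasure lebesgue {x \<in> ball x\<^sub>0 r. \<psi> x < 0} = 0"
    then show thesis using that[of 1] by simp
  qed
  have [measurable]: "\<psi> \<in> borel_measurable lebesgue" using assms(4) by (auto simp: H1_def L2_def)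
  have "{x \<in> ball x\<^sub>0 r. \<sigma> * \<psi> x < 0} = ball x\<^sub>0 r \<inter> {x \<in> space lebesgue. \<sigma> * \<psi> x < 0}" by auto
  also have "\<dots> \<in> sets lebesgue" by (intro sets.Int) (simp, measurable)
  finally have "AE x in lebesgue. \<not> (x \<in> ball x\<^sub>0 r \<and> \<sigma> * \<psi> x < 0)"
    using 0 by (subst AE_iff_measurable[OF _ refl]) auto
  then have "AE x in lebesgue. x \<in> ball x\<^sub>0 r \<longrightarrow> \<sigma> * \<psi> x \<ge> 0"
    by eventually_elim (auto simp: not_less)
  then show "\<exists>r>0. AE x in lebesgue. x \<in> ball x\<^sub>0 r \<longrightarrow> \<psi> x = 0"
    using assms by (intro one_signed_zero[OF _ _ _ _ _ _ r \<sigma>]) auto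
qed

end
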